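(* Let $1<p_j<\infty$ for $j=1,\dots,m$, and let $\frac1p=\frac1{p_1}+\dots+\frac1{p_m}$. Let $\vec w=(w_1,\dots,w_m)$ be an $m$-tuple of weights on $\mathbf R^n$ and $\nu_{\vec w}=\prod_{j=1}^m w_j^{p/p_j}$. Then the multilinear strong maximal function $\mathcal M_{\mathcal R}$ is bounded $$\mathcal M_{\mathcal R}:\ L^{p_1}(w_1)\times\cdots\times L^{p_m}(w_m)\to L^{p}(\nu_{\vec w})$$ if and only if $\vec w\in A_{\vec P,\mathcal R}$, where $\vec P=(p_1,\dots,p_m)$.
   Context: $\mathcal R$ is the family of all open rectangles in $\mathbf R^n$ with sides parallel to the coordinate axes. For a vector $\vec f=(f_1,\dots,f_m)$ of locally integrable functions on $\mathbf R^n$, $$\mathcal M_{\mathcal R}(\vec f\,)(x)=\sup_{R\ni x,\ R\in\mathcal R}\ \prod_{i=1}^m\Big(\frac1{|R|}\int_R|f_i(y)|\,dy\Big),\qquad x\in\mathbf R^n.$$ A weight (associated with $\mathcal R$) is a non-negative measurable function $w$ on $\mathbf R^n$ with $\int_R w\,dx<\infty$ for every $R\in\mathcal R$; $\|f\|_{L^q(w)}=(\int_{\mathbf R^n}|f|^q w\,dx)^{1/q}$. Boundedness means that $\|\mathcal M_{\mathcal R}(\vec f\,)\|_{L^p(\nu_{\vec w})}\le C\prod_{i=1}^m\|f_i\|_{L^{p_i}(w_i)}$ with a constant $C$ independent of $\vec f$. The condition $\vec w\in A_{\vec P,\mathcal R}$ means $$\sup_{R\in\mathcal R}\Big(\frac1{|R|}\int_R\nu_{\vec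 w}(x)\,dx\Big)\prod_{j=1}^m\Big(\frac1{|R|}\int_R w_j(x)^{1-p_j'}\,dx\Big)^{p/p_j'}<\infty,$$ where $1/p_j+1/p_j'=1$. *)

theory Defs
  imports "HOL-Analysis.Analysis"
begin

(* Real powers on [0,\<infinity>].  Unlike the real-valued powr (where 0 powr a = 0 for every a),
   a negative power of 0 is \<infinity>, so that w^(1-p') is \<infinity> at the zeros of a weight w. *)
definition ennpowr :: "ennreal \<Rightarrow> real \<Rightarrow> ennreal" (infixr "epowr" 80) where
  "x epowr a =
     (if a = 0 then 1
      else if x = 0 then (if 0 < a then 0 else \<infinity>)
      else if x = \<infinity> then (if 0 < a then \<infinity> else 0)
      else ennreal (enn2real x powr a))"

definition open_rectangles :: "(real ^ 'n) set set" where
  "open_rectangles = {box a b | a b. \<forall>k. a $ k < b $ k}"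

definition average :: "(real ^ 'n) set \<Rightarrow> (real ^ 'n \<Rightarrow> ennreal) \<Rightarrow> ennreal" where
  "average R g = (\<integral>\<^sup>+y\<in>R. g y \<partial>lebesgue) / emeasure lebesgue R"

definition locally_integrable :: "(real ^ 'n \<Rightarrow> real) \<Rightarrow> bool" where
  "locally_integrable f \<longleftrightarrow> (\<forall>K. compact K \<longrightarrow> set_integrable lebesgue K f)"

definition strong_maximal ::
    "nat \<Rightarrow> (nat \<Rightarrow> real ^ 'n \<Rightarrow> real) \<Rightarrow> real ^ 'n \<Rightarrow> ennreal" where
  "strong_maximal m f x =
     (SUP R\<in>{R \<in> open_rectangles. x \<in> R}. \<Prod>i=1..m. average R (\<lambda>y. ennreal \<bar>f i y\<bar>))"

definition weight :: "(real ^ 'n \<Rightarrow> real) \<Rightarrow> bool" where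
  "weight w \<longleftrightarrow> w \<in> borel_measurable lebesgue \<and> (\<forall>x. 0 \<le> w x) \<and>
     (\<forall>R\<in>open_rectangles. (\<integral>\<^sup>+x\<in>R. ennreal (w x) \<partial>lebesgue) < \<infinity>)"

definition Lnorm :: "real \<Rightarrow> (real ^ 'n \<Rightarrow> real) \<Rightarrow> (real ^ 'n \<Rightarrow> ennreal) \<Rightarrow> ennreal" where
  "Lnorm q w g = (\<integral>\<^sup>+x. (g x epowr q) * ennreal (w x) \<partial>lebesgue) epowr (1 / q)"

definition in_Lspace :: "real \<Rightarrow> (real ^ 'n \<Rightarrow> real) \<Rightarrow> (real ^ 'n \<Rightarrow> real) \<Rightarrow> bool" where
  "in_Lspace q w f \<longleftrightarrow>
     f \<in> borel_measurable lebesgue \<and> Lnorm q w (\<lambda>x. ennreal \<bar>f x\<bar>) < \<infinity>"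

definition product_weight ::
    "nat \<Rightarrow> real \<Rightarrow> (nat \<Rightarrow> real) \<Rightarrow> (nat \<Rightarrow> real ^ 'n \<Rightarrow> real) \<Rightarrow> real ^ 'n \<Rightarrow> real" where
  "product_weight m p P w x = (\<Prod>j=1..m. w j x powr (p / P j))"

(* Boundedness L^(P 1)(w 1) x ... x L^(P m)(w m) -> L^p(v); the maximal function is a notion
   for locally integrable functions, which is therefore required of the f i. *)
definition strong_maximal_bounded ::
    "nat \<Rightarrow> (nat \<Rightarrow> real) \<Rightarrow> (nat \<Rightarrow> real ^ 'n \<Rightarrow> real) \<Rightarrow> real \<Rightarrow> (real ^ 'n \<Rightarrow> real) \<Rightarrow> bool" where
  "strong_maximal_bounded m P w p v \<longleftrightarrow>
     (\<exists>C::real. 0 \<le> C \<and>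
       (\<forall>f. (\<forall>i\<in>{1..m}. locally_integrable (f i) \<and> in_Lspace (P i) (w i) (f i)) \<longrightarrow>
          Lnorm p v (strong_maximal m f)
            \<le> ennreal C * (\<Prod>i=1..m. Lnorm (P i) (w i) (\<lambda>x. ennreal \<bar>f i x\<bar>))))"

definition conj_exponent :: "real \<Rightarrow> real" where
  "conj_exponent q = q / (q - 1)"

lemma conj_exponent: "1 < q \<Longrightarrow> 1 / q + 1 / conj_exponent q = 1"
  by (simp add: conj_exponent_def field_simps)

(* Products follow the convention 0 * \<infinity> = 0 of ennreal. *)
definition multiple_A ::
    "nat \<Rightarrow> real \<Rightarrow> (nat \<Rightarrow> real) \<Rightarrow> (nat \<Rightarrow> real ^ 'n \<Rightarrow> real) \<Rightarrow> bool" where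
  "multiple_A m p P w \<longleftrightarrow>
     (SUP R\<in>open_rectangles.
        average R (\<lambda>x. ennreal (product_weight m p P w x)) *
        (\<Prod>j=1..m. average R (\<lambda>x. ennreal (w j x) epowr (1 - conj_exponent (P j)))
                      epowr (p / conj_exponent (P j)))) < \<infinity>"

end

(* Sufficiency is discretised: on a lattice of mesh 2^-N the rectangles become integer boxes and the
   weights become their cell means, so that only finite sums over integer points occur; Fatou's lemma
   removes the mesh. The A_P condition and Hoelder's inequality bound the w- and sigma_j-measure of a
   box by that of any of its large subsets. For the product weight this yields a restricted weak type
   estimate for the strong maximal operator (one coordinate direction at a time), hence a sparse
   family of boxes that controls the maximal function; for the dual weights sigma_j it yields a
   reverse Hoelder inequality, hence a power bump that reduces the sum over the sparse family to the
   unweighted strong maximal theorem on the lattice. *)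

theory Submission
  imports Defs "HOL-Real_Asymp.Real_Asymp"
begin

section \<open>Boxes in the integer lattice\<close>

text \<open>Rectangles of arbitrary eccentricity admit no Vitali-type covering lemma; segments do,
  with overlap at most two, and this is the only geometric covering used. A second obstacle is that
  products do not commute with averaging: on a mesh the cell means of \<open>product_weight\<close>
  are not products of powers of the cell means of the \<open>w j\<close>. The discrete part
  therefore never uses that formula, but only two inequalities that survive averaging: the A_P bound
  on boxes and an opposite bound, valid for every finite set of cells. Both are homogeneous of
  degree \<open>m * p\<close> in the cardinality. All constants depend on \<open>K\<close>,
  \<open>m\<close>, \<open>p\<close>, \<open>P\<close> and the dimension alone, so they do not
  change with the mesh. Since p may be less than 1, the passage to the sparse family works with the
  square root of V^p. Finally, the convention 0 * \<infinity> = 0 lets the A_P condition hold with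
  dual weights that are not locally integrable, but only if the product weight vanishes almost
  everywhere; that case is split off.\<close>

lemma finite_int_box [simp]: "finite {a..b :: 'n::finite \<Rightarrow> int}"
proof -
  have "{a..b} = PiE UNIV (\<lambda>i. {a i..b i})"
    by (auto simp: PiE_def Pi_def le_fun_def)
  then show ?thesis
    by (simp add: finite_PiE)
qed

text \<open>Fubini in the direction \<open>j\<close>. The slice is encoded as a box whose j-th
  coordinate is frozen at an arbitrary value \<open>s\<close>, so that it stays in the same
  type.\<close>

lemma sum_int_box_split:
  fixes a b :: "'n::finite \<Rightarrow> int" and g :: "('n \<Rightarrow> int) \<Rightarrow> 'b::comm_monoid_add"
  shows "sum g {a..b} = (\<Sum>y\<in>{a(j:=s)..b(j:=s)}. \<Sum>t\<in>{a j..b j}. g (y(j:=t)))"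
proof -
  let ?Y = "{a(j:=s)..b(j:=s)}" and ?T = "{a j..b j}"
  have "sum g {a..b} = (\<Sum>z\<in>?Y \<times> ?T. g ((fst z)(j := snd z)))"
  proof (rule sum.reindex_bij_witness[where i = "\<lambda>z. (fst z)(j := snd z)" and j = "\<lambda>x. (x(j := s), x j)"])
    show "(x(j := s), x j) \<in> ?Y \<times> ?T" if "x \<in> {a..b}" for x
      using that by (auto simp: le_fun_def)
    show "(fst z)(j := snd z) \<in> {a..b}" if "z \<in> ?Y \<times> ?T" for z
      using that by (auto simp: le_fun_def split: if_splits)
    show "((fst z)(j := snd z, j := s), ((fst z)(j := snd z)) j) = z" if "z \<in> ?Y \<times> ?T" for z
    proof -
      have "fst z j = s"
        using that by (auto simp: le_fun_def split: if_splits intro!: antisym dest!: spec[where x = j])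
      then show ?thesis by (auto simp: prod_eq_iff)
    qed
  qed auto
  also have "\<dots> = (\<Sum>y\<in>?Y. \<Sum>t\<in>?T. g (y(j:=t)))"
    by (simp add: sum.cartesian_product case_prod_beta)
  finally show ?thesis .
qed

lemma card_int_box_split:
  fixes a b :: "'n::finite \<Rightarrow> int"
  shows "card {a..b} = card {a(j:=s)..b(j:=s)} * card {a j..b j}"
  using sum_int_box_split[of "\<lambda>_. 1::nat" a b j s] by simp

text \<open>\<open>J\<close> lists the directions in which a box may extend: \<open>{}\<close> gives
  points, \<open>{j}\<close> segments and \<open>UNIV\<close> all boxes in \<open>B\<close>. This
  makes induction on the directions possible.\<close>

definition subboxes :: "'n set \<Rightarrow> ('n \<Rightarrow> int) set \<Rightarrow> ('n \<Rightarrow> int) set set" where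
  "subboxes J B = {{a..b} | a b. a \<le> b \<and> {a..b} \<subseteq> B \<and> (\<forall>i. i \<notin> J \<longrightarrow> a i = b i)}"

lemma subboxesI: "a \<le> b \<Longrightarrow> {a..b} \<subseteq> B \<Longrightarrow> (\<And>i. i \<notin> J \<Longrightarrow> a i = b i) \<Longrightarrow> {a..b} \<in> subboxes J B"
  unfolding subboxes_def by auto

lemma subboxesE:
  assumes "R \<in> subboxes J B"
  obtains a b where "R = {a..b}" "a \<le> b" "{a..b} \<subseteq> B" "\<And>i. i \<notin> J \<Longrightarrow> a i = b i"
  using assms unfolding subboxes_def by auto

lemma finite_subboxes: "finite B \<Longrightarrow> finite (subboxes J B)"
  by (rule finite_subset[of _ "Pow B"]) (auto simp: subboxes_def)

lemma subboxesD:
  assumes "R \<in> subboxes J (B :: ('n::finite \<Rightarrow> int) set)"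
  shows "R \<subseteq> B" "finite R" "R \<noteq> {}" "card R > 0"
proof -
  from assms obtain a b where *: "R = {a..b}" "a \<le> b" "{a..b} \<subseteq> B"
    by (rule subboxesE)
  show "R \<subseteq> B" "finite R" "R \<noteq> {}" using * by auto
  then show "card R > 0" by (simp add: card_gt_0_iff)
qed

lemma singleton_subboxes: "x \<in> B \<Longrightarrow> {x} \<in> subboxes J B"
  using subboxesI[of x x B J] by simp

lemma sum_Union_le:
  fixes u :: "'a \<Rightarrow> real"
  assumes "finite G" "\<And>I. I \<in> G \<Longrightarrow> finite I" "\<And>x. 0 \<le> u x"
  shows "sum u (\<Union>G) \<le> (\<Sum>I\<in>G. sum u I)"
  using assms
proof (induction G)
  case (insert I G)
  have "sum u (I \<union> \<Union>G) \<le> sum u I + sum u (\<Union>G)"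
    using insert sum.union_inter[of I "\<Union>G" u] sum_nonneg[of "I \<inter> \<Union>G" u] by fastforce
  then show ?case using insert by fastforce
qed simp

text \<open>A subfamily of minimal cardinality with the same union covers every point at most twice.\<close>

lemma segment_covering:
  fixes u v :: "('n::finite \<Rightarrow> int) \<Rightarrow> real"
  assumes "finite F" "F \<subseteq> subboxes {j} B" and v: "\<And>x. 0 \<le> v x" and u: "\<And>x. 0 \<le> u x"
    and uv: "\<And>I. I \<in> F \<Longrightarrow> sum u I \<le> sum v I"
  shows "sum u (\<Union>F) \<le> 2 * sum v (\<Union>F)"
proof -
  define S where "S = {G. G \<subseteq> F \<and> \<Union>G = \<Union>F}"
  have "F \<in> S" by (auto simp: S_def)
  then obtain G where G: "G \<in> S" and Gmin: "\<And>H. H \<in> S \<Longrightarrow> card G \<le> card H"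
    by (metis arg_min_nat_lemma[where P = "\<lambda>G. G \<in> S" and m = card])
  have GF: "G \<subseteq> F" "\<Union>G = \<Union>F" using G by (auto simp: S_def)
  have finG: "finite G" using GF(1) assms(1) finite_subset by blast
  have fin: "finite I" if "I \<in> G" for I using that GF assms(2) subboxesD(2) by blast
  have finU: "finite (\<Union>F)" using GF(2) finG fin by (metis finite_Union)
  have overlap: "card {I\<in>G. x \<in> I} \<le> 2" for x
  proof (cases "{I\<in>G. x \<in> I} = {}")
    case True then show ?thesis by (metis card.empty zero_le)
  next
    case False
    let ?X = "{I\<in>G. x \<in> I}"
    have ex: "\<exists>a b. I = {x(j:=a)..x(j:=b)} \<and> a \<le> x j \<and> x j \<le> b" if I: "I \<in> ?X" for I
    proof -
      have "I \<in> subboxes {j} B" using I GF assms(2) by blast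
      then obtain a b where ab: "I = {a..b}" "\<And>i. i \<notin> {j} \<Longrightarrow> a i = b i" by (rule subboxesE) blast
      have x: "a \<le> x" "x \<le> b" using I ab by auto
      have "a = x(j := a j)" "b = x(j := b j)"
        using x ab(2) by (auto simp: fun_eq_iff le_fun_def intro!: antisym) (metis antisym)+
      then show ?thesis using ab(1) x by (metis le_fun_def)
    qed
    then obtain l r where lr: "\<And>I. I \<in> ?X \<Longrightarrow> I = {x(j:=l I)..x(j:=r I)} \<and> l I \<le> x j \<and> x j \<le> r I"
      by metis
    have finX: "finite ?X" using finG by simp
    \<comment> \<open>Of the segments through \<open>x\<close>, \<open>I1\<close> reaches furthest
      to the left and \<open>I2\<close> furthest to the right. A third one lies in their union, and
      dropping it would contradict minimality.\<close>
    obtain I1 where I1: "I1 \<in> ?X" "\<And>I. I \<in> ?X \<Longrightarrow> l I1 \<le> l I"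
      using finX False by (metis (no_types, lifting) arg_min_if_finite(1) arg_min_least)
    obtain I2 where I2: "I2 \<in> ?X" "\<And>I. I \<in> ?X \<Longrightarrow> - r I2 \<le> - r I"
      using finX False arg_min_if_finite(1)[of ?X "\<lambda>I. - r I"] arg_min_least[of ?X _ "\<lambda>I. - r I"] by blast
    have "?X \<subseteq> {I1, I2}"
    proof (rule ccontr)
      assume "\<not> ?X \<subseteq> {I1, I2}"
      then obtain K where K: "K \<in> ?X" "K \<noteq> I1" "K \<noteq> I2" by blast
      have "K \<subseteq> I1 \<union> I2"
      proof
        fix y assume y: "y \<in> K"
        have y': "y \<in> {x(j:=l K)..x(j:=r K)}" using lr[OF K(1)] y by blast
        have yi: "y i = x i" if "i \<noteq> j" for i
          using y' that unfolding atLeastAtMost_iff le_fun_def by (metis antisym fun_upd_other)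
        have yj: "l K \<le> y j" "y j \<le> r K"
          using y' unfolding atLeastAtMost_iff le_fun_def by (metis fun_upd_same)+
        have "l I1 \<le> l K" "r K \<le> r I2" using I1(2)[OF K(1)] I2(2)[OF K(1)] by auto
        then have "(l I1 \<le> y j \<and> y j \<le> r I1) \<or> (l I2 \<le> y j \<and> y j \<le> r I2)"
          using yj lr[OF I1(1)] lr[OF I2(1)] by linarith
        then have "y \<in> {x(j:=l I1)..x(j:=r I1)} \<or> y \<in> {x(j:=l I2)..x(j:=r I2)}"
          using yi by (auto simp: le_fun_def)
        then show "y \<in> I1 \<union> I2" using lr[OF I1(1)] lr[OF I2(1)] by blast
      qed
      then have "\<Union>(G - {K}) = \<Union>G" using K I1(1) I2(1) by blast
      then have "G - {K} \<in> S" using GF by (auto simp: S_def)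
      then have "card G \<le> card (G - {K})" by (rule Gmin)
      moreover have "card (G - {K}) < card G"
        using K(1) finG by (intro psubset_card_mono) auto
      ultimately show False by simp
    qed
    then have "card ?X \<le> card {I1, I2}" by (intro card_mono) auto
    also have "\<dots> \<le> 2" by (simp add: card_insert_if)
    finally show ?thesis .
  qed
  have "sum u (\<Union>F) \<le> (\<Sum>I\<in>G. sum u I)"
    unfolding GF(2)[symmetric] by (rule sum_Union_le) (use finG fin u in auto)
  also have "\<dots> \<le> (\<Sum>I\<in>G. sum v I)" by (rule sum_mono) (use uv GF in auto)
  also have "\<dots> = (\<Sum>I\<in>G. \<Sum>x\<in>\<Union>F. if x \<in> I then v x else 0)"
  proof (rule sum.cong[OF refl])
    fix I assume "I \<in> G"
    then have "\<Union>F \<inter> I = I" using GF by auto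
    then show "sum v I = (\<Sum>x\<in>\<Union>F. if x \<in> I then v x else 0)"
      using sum.inter_restrict[OF finU, of v I] by simp
  qed
  also have "\<dots> = (\<Sum>x\<in>\<Union>F. \<Sum>I\<in>G. if x \<in> I then v x else 0)" by (rule sum.swap)
  also have "\<dots> = (\<Sum>x\<in>\<Union>F. real (card {I\<in>G. x \<in> I}) * v x)"
    using finG by (intro sum.cong refl) (simp add: sum.If_cases Int_def)
  also have "\<dots> \<le> (\<Sum>x\<in>\<Union>F. 2 * v x)"
    using overlap v by (intro sum_mono mult_right_mono) (auto simp: of_nat_le_iff[of _ 2, simplified])
  finally show ?thesis by (simp add: sum_distrib_left)
qed

section \<open>The strong maximal theorem on the lattice\<close>

text \<open>The finite-step form of d(t^q) = q/(q-1) * t * d(t^(q-1)); Young's inequality for t *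
  s^(q-1) allows steps of any size, with the larger endpoint in front.\<close>

lemma powr_increment_le:
  fixes s t q :: real
  assumes "1 < q" "0 \<le> s" "s \<le> t"
  shows "t powr q - s powr q \<le> q / (q - 1) * (t * (t powr (q - 1) - s powr (q - 1)))"
proof -
  have "t * s powr (q - 1) \<le> t powr q / q + (s powr (q - 1)) powr (q / (q - 1)) / (q / (q - 1))"
    using assms by (intro Youngs_inequality) (auto simp: field_simps)
  also have "(s powr (q - 1)) powr (q / (q - 1)) = s powr q"
    using assms by (simp add: powr_powr)
  finally have "q / (q - 1) * (t * s powr (q - 1)) \<le> q / (q - 1) * (t powr q / q + s powr q / (q / (q - 1)))"
    using assms by (intro mult_left_mono) auto
  also have "\<dots> = t powr q / (q - 1) + s powr q"
    using assms by (simp add: field_simps)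
  finally have 1: "q / (q - 1) * (t * s powr (q - 1)) \<le> t powr q / (q - 1) + s powr q" .
  have 2: "t * t powr (q - 1) = t powr q"
    using assms by (cases "t = 0") (auto simp: powr_mult_base)
  have "q / (q - 1) * t powr q = t powr q / (q - 1) + t powr q"
    using assms by (simp add: field_simps)
  with 1 2 show ?thesis by (simp add: right_diff_distrib)
qed

text \<open>A discrete form of Doob's argument: the layer-cake formula applied to a weak type inequality.\<close>

lemma weak_type_imp_powr_sum_le:
  fixes M u :: "'a \<Rightarrow> real" and V v :: "'b \<Rightarrow> real"
  assumes X: "finite X" and Y: "finite Y" and q: "1 < q"
    and u: "\<And>x. x \<in> X \<Longrightarrow> 0 \<le> u x" and v: "\<And>y. y \<in> Y \<Longrightarrow> 0 \<le> v y"
    and M: "\<And>x. x \<in> X \<Longrightarrow> 0 \<le> M x" and V: "\<And>y. y \<in> Y \<Longrightarrow> 0 \<le> V y"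
    and weak: "\<And>\<alpha>. 0 < \<alpha> \<Longrightarrow> \<alpha> * (\<Sum>x | x \<in> X \<and> \<alpha> \<le> M x. u x) \<le> (\<Sum>y | y \<in> Y \<and> \<alpha> \<le> V y. v y)"
  shows "(\<Sum>x\<in>X. u x * M x powr q) \<le> q / (q - 1) * (\<Sum>y\<in>Y. v y * V y powr (q - 1))"
  using M V weak
proof (induction "card (M ` X - {0})" arbitrary: M V rule: less_induct)
  case less
  have finMX: "finite (M ` X)" using X by simp
  show ?case
  proof (cases "M ` X - {0} = {}")
    case True
    then have "(\<Sum>x\<in>X. u x * M x powr q) = 0" by (intro sum.neutral) auto
    moreover have "0 \<le> q / (q - 1) * (\<Sum>y\<in>Y. v y * V y powr (q - 1))"
      using q v by (intro mult_nonneg_nonneg sum_nonneg) auto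
    ultimately show ?thesis by simp
  next
    case False
    \<comment> \<open>The largest value \<open>t\<close> of \<open>M\<close> is lowered to the next
      one, \<open>s\<close> (0 if there is none), and \<open>V\<close> is cut off at the same
      height. This preserves the weak type hypothesis and removes one nonzero value.\<close>
    define t where "t = Max (M ` X - {0})"
    define s where "s = Max (insert 0 (M ` X - {t}))"
    have t: "t \<in> M ` X" "t \<noteq> 0"
      using Max_in[of "M ` X - {0}"] False finMX unfolding t_def by auto
    then have tpos: "0 < t" using less.prems(1) by force
    have Mt: "M x \<le> t" if "x \<in> X" for x
      using that tpos Max_ge[of "M ` X - {0}" "M x"] finMX unfolding t_def[symmetric] by (cases "M x = 0") auto
    have s0: "0 \<le> s" unfolding s_def using finMX by (intro Max_ge) auto
    have s_in: "s \<in> insert 0 (M ` X - {t})" unfolding s_def using finMX by (intro Max_in) auto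
    then have st: "s < t" using Mt tpos by (force simp: less_le)
    have Ms: "M x \<le> s" if "x \<in> X" "M x \<noteq> t" for x
      unfolding s_def using finMX that by (intro Max_ge) auto
    define M' where "M' = (\<lambda>x. min (M x) s)"
    define V' where "V' = (\<lambda>y. min (V y) s)"
    have sub: "M' ` X - {0} \<subseteq> (M ` X - {0}) - {t}"
      using s_in st by (auto simp: M'_def min_def)
    have "card (M' ` X - {0}) < card (M ` X - {0})"
      by (rule psubset_card_mono) (use sub t finMX in auto)
    moreover have "\<alpha> * (\<Sum>x | x \<in> X \<and> \<alpha> \<le> M' x. u x) \<le> (\<Sum>y | y \<in> Y \<and> \<alpha> \<le> V' y. v y)" if "0 < \<alpha>" for \<alpha>
    proof (cases "\<alpha> \<le> s")
      case True
      then show ?thesis using less.prems(3)[OF that] by (simp add: M'_def V'_def)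
    next
      case False
      then show ?thesis using v by (auto simp: M'_def V'_def intro!: sum_nonneg)
    qed
    ultimately have IH: "(\<Sum>x\<in>X. u x * M' x powr q) \<le> q / (q - 1) * (\<Sum>y\<in>Y. v y * V' y powr (q - 1))"
      by (intro less.hyps) (use s0 less.prems in \<open>auto simp: M'_def V'_def\<close>)
    \<comment> \<open>Cutting off \<open>V\<close> at \<open>s\<close> loses at least the layer from
      \<open>s\<close> to \<open>t\<close> wherever \<open>V\<close> reaches \<open>t\<close>, and a
      nonnegative amount elsewhere.\<close>
    have "(\<Sum>y | y \<in> Y \<and> t \<le> V y. v y) * (t powr (q - 1) - s powr (q - 1))
        = (\<Sum>y\<in>Y. if t \<le> V y then v y * (t powr (q - 1) - s powr (q - 1)) else 0)"
      using Y by (simp add: sum.If_cases sum_distrib_right Int_def)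
    also have "\<dots> \<le> (\<Sum>y\<in>Y. v y * V y powr (q - 1) - v y * V' y powr (q - 1))"
    proof (intro sum_mono)
      fix y assume y: "y \<in> Y"
      have "t powr (q - 1) \<le> V y powr (q - 1)" if "t \<le> V y"
        using that tpos q by (intro powr_mono2) auto
      moreover have "V' y powr (q - 1) \<le> V y powr (q - 1)"
        using less.prems(2)[OF y] s0 q by (intro powr_mono2) (auto simp: V'_def)
      ultimately show "(if t \<le> V y then v y * (t powr (q - 1) - s powr (q - 1)) else 0)
          \<le> v y * V y powr (q - 1) - v y * V' y powr (q - 1)"
        using v[OF y] st by (auto simp: V'_def min_def right_diff_distrib[symmetric] intro!: mult_left_mono)
    qed
    finally have V_step: "(\<Sum>y | y \<in> Y \<and> t \<le> V y. v y) * (t powr (q - 1) - s powr (q - 1))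
        \<le> (\<Sum>y\<in>Y. v y * V y powr (q - 1) - v y * V' y powr (q - 1))" .
    have "(\<Sum>x\<in>X. u x * M x powr q) - (\<Sum>x\<in>X. u x * M' x powr q)
        = (\<Sum>x\<in>X. if t \<le> M x then u x * (t powr q - s powr q) else 0)"
      unfolding sum_subtractf[symmetric] right_diff_distrib
    proof (intro sum.cong refl)
      fix x assume x: "x \<in> X"
      show "u x * M x powr q - u x * M' x powr q = (if t \<le> M x then u x * t powr q - u x * s powr q else 0)"
        using Mt[OF x] Ms[OF x] st by (cases "M x = t") (auto simp: M'_def min_def)
    qed
    also have "\<dots> = (\<Sum>x | x \<in> X \<and> t \<le> M x. u x) * (t powr q - s powr q)"
      using X by (simp add: sum.If_cases sum_distrib_right Int_def)
    also have "\<dots> \<le> (\<Sum>x | x \<in> X \<and> t \<le> M x. u x) * (q / (q - 1) * (t * (t powr (q - 1) - s powr (q - 1))))"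
      using powr_increment_le[OF q s0, of t] st u by (intro mult_left_mono sum_nonneg) auto
    also have "\<dots> = q / (q - 1) * ((t * (\<Sum>x | x \<in> X \<and> t \<le> M x. u x)) * (t powr (q - 1) - s powr (q - 1)))"
      by (simp add: algebra_simps)
    also have "\<dots> \<le> q / (q - 1) * ((\<Sum>y | y \<in> Y \<and> t \<le> V y. v y) * (t powr (q - 1) - s powr (q - 1)))"
      using less.prems(3)[OF tpos] q s0 st
      by (intro mult_left_mono mult_right_mono) (auto intro!: powr_mono2)
    also have "\<dots> \<le> q / (q - 1) * (\<Sum>y\<in>Y. v y * V y powr (q - 1) - v y * V' y powr (q - 1))"
      using q by (intro mult_left_mono V_step) auto
    finally have "(\<Sum>x\<in>X. u x * M x powr q) - (\<Sum>x\<in>X. u x * M' x powr q)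
      \<le> q / (q - 1) * ((\<Sum>y\<in>Y. v y * V y powr (q - 1)) - (\<Sum>y\<in>Y. v y * V' y powr (q - 1)))"
      by (simp only: sum_subtractf)
    with IH show ?thesis by (simp add: right_diff_distrib)
  qed
qed

section \<open>Unweighted maximal operators on finite sets of lattice points\<close>

definition box_average :: "('a \<Rightarrow> real) \<Rightarrow> 'a set \<Rightarrow> real" where
  "box_average h R = sum h R / real (card R)"

text \<open>Outside \<open>B\<close> no box qualifies and \<open>Max\<close> would be taken over the
  empty set, hence the value 0; inside \<open>B\<close> the box \<open>{x}\<close> always
  qualifies.\<close>

definition box_max :: "'n set \<Rightarrow> ('n \<Rightarrow> int) set \<Rightarrow> (('n \<Rightarrow> int) \<Rightarrow> real) \<Rightarrow> ('n \<Rightarrow> int) \<Rightarrow> real" where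
  "box_max J B h x = (if x \<in> B then Max (box_average h ` {R \<in> subboxes J B. x \<in> R}) else 0)"

context
  fixes B :: "('n::finite \<Rightarrow> int) set"
  assumes B: "finite B"
begin

lemma box_max_ge: "R \<in> subboxes J B \<Longrightarrow> x \<in> R \<Longrightarrow> box_average h R \<le> box_max J B h x"
  unfolding box_max_def using subboxesD(1)[of R J B] finite_subboxes[OF B, of J]
  by (auto intro!: Max_ge)

lemma box_max_attained:
  assumes "x \<in> B"
  obtains R where "R \<in> subboxes J B" "x \<in> R" "box_max J B h x = box_average h R"
proof -
  have "{R \<in> subboxes J B. x \<in> R} \<noteq> {}" using singleton_subboxes[OF assms] by blast
  then have "box_max J B h x \<in> box_average h ` {R \<in> subboxes J B. x \<in> R}"
    using assms finite_subboxes[OF B, of J] unfolding box_max_def by (auto intro!: Max_in)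
  then show ?thesis using that by auto
qed

lemma box_max_nonneg:
  assumes "\<And>x. 0 \<le> h x"
  shows "0 \<le> box_max J B h x"
proof (cases "x \<in> B")
  case True
  then obtain R where "R \<in> subboxes J B" "box_max J B h x = box_average h R" by (rule box_max_attained)
  then show ?thesis using assms by (simp add: box_average_def sum_nonneg)
qed (simp add: box_max_def)

text \<open>The twofold covering gives the weak type bound with factor 2, the layer-cake lemma the
  factor q/(q-1). Young's inequality then reproduces (q-1)/q of the left side, which can be absorbed
  because the sums are finite.\<close>

lemma box_max_segment_bound:
  assumes q: "1 < q" and h: "\<And>x. 0 \<le> h x"
  shows "(\<Sum>x\<in>B. box_max {j} B h x powr q) \<le> (2 * q / (q - 1)) powr q * (\<Sum>x\<in>B. h x powr q)"
proof -
  let ?M = "box_max {j} B h"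
  have weak: "\<alpha> * (\<Sum>x | x \<in> B \<and> \<alpha> \<le> ?M x. 1) \<le> (\<Sum>x | x \<in> B \<and> \<alpha> \<le> ?M x. 2 * h x)" if "0 < \<alpha>" for \<alpha>
  proof -
    define F where "F = {I \<in> subboxes {j} B. \<alpha> \<le> box_average h I}"
    have "{x. x \<in> B \<and> \<alpha> \<le> ?M x} = \<Union>F"
    proof (intro equalityI subsetI)
      fix x assume "x \<in> {x. x \<in> B \<and> \<alpha> \<le> ?M x}"
      moreover from this obtain R where "R \<in> subboxes {j} B" "x \<in> R" "?M x = box_average h R"
        using box_max_attained by blast
      ultimately show "x \<in> \<Union>F" by (auto simp: F_def)
    next
      fix x assume "x \<in> \<Union>F"
      then obtain I where "I \<in> subboxes {j} B" "\<alpha> \<le> box_average h I" "x \<in> I" by (auto simp: F_def)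
      then show "x \<in> {x. x \<in> B \<and> \<alpha> \<le> ?M x}"
        using box_max_ge[of I "{j}" x h] subboxesD(1)[of I "{j}" B] by auto
    qed
    moreover have "sum (\<lambda>_. \<alpha>) (\<Union>F) \<le> 2 * sum h (\<Union>F)"
    proof (rule segment_covering[of F j B])
      show "finite F" unfolding F_def using finite_subboxes[OF B] by simp
      show "sum (\<lambda>_. \<alpha>) I \<le> sum h I" if "I \<in> F" for I
        using that subboxesD(4)[of I "{j}" B] by (auto simp: F_def box_average_def field_simps)
    qed (use that h in \<open>auto simp: F_def\<close>)
    ultimately show ?thesis by (simp add: sum_distrib_left mult.commute)
  qed
  let ?c = "2 * q / (q - 1)"
  have M0: "0 \<le> ?M x" for x using box_max_nonneg[OF h] .
  have "(\<Sum>x\<in>B. 1 * ?M x powr q) \<le> q / (q - 1) * (\<Sum>x\<in>B. 2 * h x * ?M x powr (q - 1))"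
    by (rule weak_type_imp_powr_sum_le[OF B B q _ _ _ _ weak]) (use h M0 in auto)
  also have "\<dots> = (\<Sum>x\<in>B. ?c * h x * ?M x powr (q - 1))"
    by (simp add: sum_distrib_left algebra_simps)
  also have "\<dots> \<le> (\<Sum>x\<in>B. (?c powr q * h x powr q) / q + ?M x powr q / (q / (q - 1)))"
  proof (rule sum_mono)
    fix x
    have "?c * h x * ?M x powr (q - 1) \<le> (?c * h x) powr q / q + (?M x powr (q - 1)) powr (q / (q - 1)) / (q / (q - 1))"
      using q h[of x] by (intro Youngs_inequality) (auto simp: field_simps)
    also have "(?M x powr (q - 1)) powr (q / (q - 1)) = ?M x powr q"
      using q by (simp add: powr_powr)
    also have "(?c * h x) powr q = ?c powr q * h x powr q"
      by (rule powr_mult)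
    finally show "?c * h x * ?M x powr (q - 1) \<le> (?c powr q * h x powr q) / q + ?M x powr q / (q / (q - 1))" .
  qed
  also have "\<dots> = (?c powr q * (\<Sum>x\<in>B. h x powr q)) / q + (\<Sum>x\<in>B. ?M x powr q) / (q / (q - 1))"
    by (simp add: sum.distrib sum_divide_distrib[symmetric] sum_distrib_left[symmetric] sum_distrib_right[symmetric])
  finally show ?thesis using q by (simp add: field_simps)
qed

end

lemma sum_segment:
  fixes g :: "('n::finite \<Rightarrow> int) \<Rightarrow> 'b::comm_monoid_add"
  shows "sum g {y(j:=s)..y(j:=e)} = (\<Sum>t\<in>{s..e}. g (y(j:=t)))"
  using sum_int_box_split[of g "y(j:=s)" "y(j:=e)" j 0] by simp

text \<open>A box through \<open>x\<close> is fibred by segments in direction \<open>j\<close> over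
  its slice at height \<open>x j\<close>; each segment is represented by the point where it meets
  the slice.\<close>

lemma slice_subboxes:
  fixes a b x :: "'n::finite \<Rightarrow> int"
  assumes "{a..b} \<in> subboxes (insert j J) B" "x \<in> {a..b}"
  shows "{a(j:=x j)..b(j:=x j)} \<in> subboxes J B" "x \<in> {a(j:=x j)..b(j:=x j)}"
    and "\<And>y. y \<in> {a(j:=x j)..b(j:=x j)} \<Longrightarrow> {y(j:=a j)..y(j:=b j)} \<in> subboxes {j} B
      \<and> y \<in> {y(j:=a j)..y(j:=b j)}"
proof -
  obtain a' b' where "{a..b} = {a'..b'}" "a' \<le> b'" "{a'..b'} \<subseteq> B" "\<And>i. i \<notin> insert j J \<Longrightarrow> a' i = b' i"
    using assms(1) by (rule subboxesE) blast
  then have ab: "a \<le> b" "{a..b} \<subseteq> B" "\<And>i. i \<notin> insert j J \<Longrightarrow> a i = b i"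
    by (auto simp: Icc_eq_Icc)
  have ij: "a j \<le> x j" "x j \<le> b j" using assms(2) by (auto simp: le_fun_def)
  have sub: "{a(j:=x j)..b(j:=x j)} \<subseteq> {a..b}"
    using ij by (auto simp: le_fun_def)
  show "{a(j:=x j)..b(j:=x j)} \<in> subboxes J B"
    using ab(1,3) by (intro subboxesI order_trans[OF sub ab(2)]) (auto simp: le_fun_def)
  show "x \<in> {a(j:=x j)..b(j:=x j)}" using assms(2) by (auto simp: le_fun_def)
  fix y assume y: "y \<in> {a(j:=x j)..b(j:=x j)}"
  then have yi: "\<And>i. i \<noteq> j \<Longrightarrow> a i \<le> y i \<and> y i \<le> b i" "y j = x j"
  proof -
    have "(a(j:=x j)) i \<le> y i" "y i \<le> (b(j:=x j)) i" for i
      using y unfolding atLeastAtMost_iff le_fun_def by blast+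
    note * = this
    show "a i \<le> y i \<and> y i \<le> b i" if "i \<noteq> j" for i using *[of i] that by simp
    show "y j = x j" using *[of j] by simp
  qed
  have sub: "{y(j:=a j)..y(j:=b j)} \<subseteq> {a..b}"
  proof
    fix z assume "z \<in> {y(j:=a j)..y(j:=b j)}"
    then have z: "(y(j:=a j)) i \<le> z i" "z i \<le> (y(j:=b j)) i" for i by (auto simp: le_fun_def)
    have "a i \<le> z i \<and> z i \<le> b i" for i
      using z[of i] yi(1)[of i] by (cases "i = j") auto
    then show "z \<in> {a..b}" by (simp add: le_fun_def)
  qed
  have "{y(j:=a j)..y(j:=b j)} \<in> subboxes {j} B"
    using ab(1) by (intro subboxesI order_trans[OF sub ab(2)]) (auto simp: le_fun_def)
  moreover have "y \<in> {y(j:=a j)..y(j:=b j)}" using yi ij by (auto simp: le_fun_def)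
  ultimately show "{y(j:=a j)..y(j:=b j)} \<in> subboxes {j} B \<and> y \<in> {y(j:=a j)..y(j:=b j)}" ..
qed

text \<open>The mean over a box is the mean over a slice of the means over segments, and the latter
  are at most the one-directional maximal function at the point where the segment meets the slice.
  The slice through \<open>x\<close> no longer extends in direction \<open>j\<close>.\<close>

lemma box_max_insert_le:
  fixes B :: "('n::finite \<Rightarrow> int) set"
  assumes B: "finite B" and h: "\<And>x. 0 \<le> h x"
  shows "box_max (insert j J) B h x \<le> box_max J B (box_max {j} B h) x"
proof (cases "x \<in> B")
  case True
  obtain R where R: "R \<in> subboxes (insert j J) B" "x \<in> R" "box_max (insert j J) B h x = box_average h R"
    using box_max_attained[OF B True] .
  then obtain a b where ab: "R = {a..b}" by (auto elim: subboxesE)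
  let ?S = "{a(j:=x j)..b(j:=x j)}" and ?T = "{a j..b j}"
  note slice = slice_subboxes[OF R(1,2)[unfolded ab]]
  have cT: "card R = card ?S * card ?T" unfolding ab by (rule card_int_box_split)
  have "0 < card R" using subboxesD(4)[OF R(1)] .
  then have cpos: "real (card ?T) \<noteq> 0" unfolding cT by (metis mult_0_right of_nat_eq_0_iff less_irrefl)
  have "sum h R = (\<Sum>y\<in>?S. \<Sum>t\<in>?T. h (y(j:=t)))"
    unfolding ab by (rule sum_int_box_split)
  also have "\<dots> \<le> (\<Sum>y\<in>?S. box_max {j} B h y * real (card ?T))"
  proof (rule sum_mono)
    fix y assume y: "y \<in> ?S"
    let ?I = "{y(j:=a j)..y(j:=b j)}"
    have I: "?I \<in> subboxes {j} B" "y \<in> ?I" using slice(3)[OF y] by auto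
    have "card ?I = card ?T" using sum_segment[of "\<lambda>_. 1::nat" y j "a j" "b j"] by simp
    moreover have "sum h ?I = (\<Sum>t\<in>?T. h (y(j:=t)))" by (rule sum_segment)
    moreover have "sum h ?I \<le> box_max {j} B h y * card ?I"
      using box_max_ge[OF B I, of h] subboxesD(4)[OF I(1)] by (simp add: box_average_def field_simps)
    ultimately show "(\<Sum>t\<in>?T. h (y(j:=t))) \<le> box_max {j} B h y * real (card ?T)" by simp
  qed
  also have "\<dots> = sum (box_max {j} B h) ?S * real (card ?T)"
    by (simp add: sum_distrib_right)
  finally have "sum h R / real (card R) \<le> sum (box_max {j} B h) ?S * real (card ?T) / (real (card ?S) * real (card ?T))"
    unfolding cT of_nat_mult by (rule divide_right_mono) auto
  also have "\<dots> = sum (box_max {j} B h) ?S / real (card ?S)"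
    using cpos by (rule nonzero_mult_divide_mult_cancel_right)
  finally have "box_average h R \<le> box_average (box_max {j} B h) ?S"
    unfolding box_average_def .
  also have "\<dots> \<le> box_max J B (box_max {j} B h) x"
    by (rule box_max_ge[OF B slice(1,2)])
  finally show ?thesis using R(3) by simp
qed (simp add: box_max_def)

text \<open>Iteration of the segment bound, each direction contributing the same factor. The
  constant precedes \<open>B\<close> and \<open>h\<close>, so it serves for every mesh.\<close>

lemma strong_maximal_discrete:
  fixes J :: "'n::finite set"
  assumes q: "1 < q" and "finite J"
  shows "\<exists>C\<ge>0. \<forall>B h. finite B \<longrightarrow> (\<forall>x. 0 \<le> h x) \<longrightarrow>
    (\<Sum>x\<in>B. box_max J B h x powr q) \<le> C * (\<Sum>x\<in>B. h x powr q)"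
  using \<open>finite J\<close>
proof (induction J)
  case empty
  have "box_max {} B h x = h x" if x: "x \<in> B" and fB: "finite B" for B h and x :: "'n \<Rightarrow> int"
  proof -
    obtain R where R: "R \<in> subboxes {} B" "x \<in> R" "box_max {} B h x = box_average h R"
      using box_max_attained[OF fB x] .
    then have "R = {x}" by (auto elim!: subboxesE intro!: antisym simp: fun_eq_iff[symmetric])
    then show ?thesis using R(3) by (simp add: box_average_def)
  qed
  then show ?case by (intro exI[of _ 1]) (simp cong: sum.cong)
next
  case (insert j J)
  then obtain C where C: "0 \<le> C" "\<And>B h. finite B \<Longrightarrow> (\<And>x. 0 \<le> h x) \<Longrightarrow>
    (\<Sum>x\<in>B. box_max J B h x powr q) \<le> C * (\<Sum>x\<in>B. h x powr q)" by blast
  let ?c = "(2 * q / (q - 1)) powr q"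
  have "(\<Sum>x\<in>B. box_max (insert j J) B h x powr q) \<le> C * ?c * (\<Sum>x\<in>B. h x powr q)"
    if B: "finite B" and h: "\<And>x. 0 \<le> h x" for B and h :: "('n \<Rightarrow> int) \<Rightarrow> real"
  proof -
    have h1: "0 \<le> box_max {j} B h x" for x by (rule box_max_nonneg[OF B h])
    have "(\<Sum>x\<in>B. box_max (insert j J) B h x powr q) \<le> (\<Sum>x\<in>B. box_max J B (box_max {j} B h) x powr q)"
      using q by (intro sum_mono powr_mono2 box_max_insert_le box_max_nonneg B h) auto
    also have "\<dots> \<le> C * (\<Sum>x\<in>B. box_max {j} B h x powr q)"
      by (rule C(2)[OF B h1])
    also have "\<dots> \<le> C * (?c * (\<Sum>x\<in>B. h x powr q))"
      by (intro mult_left_mono box_max_segment_bound B q h C)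
    finally show ?thesis by (simp add: mult.assoc)
  qed
  then show ?case using C(1) by (intro exI[of _ "C * ?c"]) auto
qed

text \<open>An A-infinity condition for boxes of all shapes: a set that fills the proportion
  \<open>l\<close> of a box carries a fixed share of its weight. The modulus \<open>D\<close> is a
  separate argument so that later constants can be chosen before \<open>B\<close> and
  \<open>w\<close>.\<close>

definition uniform_A_infinity ::
    "(real \<Rightarrow> real) \<Rightarrow> ('n \<Rightarrow> int) set \<Rightarrow> (('n \<Rightarrow> int) \<Rightarrow> real) \<Rightarrow> bool" where
  "uniform_A_infinity D B w \<longleftrightarrow> finite B \<and> (\<forall>x. 0 \<le> w x) \<and> (\<forall>l>0. 0 \<le> D l \<and>
     (\<forall>R\<in>subboxes UNIV B. \<forall>A\<subseteq>R. l * card R \<le> card A \<longrightarrow> sum w R \<le> D l * sum w A))"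

lemma subboxes_mono: "R \<in> subboxes J B \<Longrightarrow> J \<subseteq> J' \<Longrightarrow> B \<subseteq> B' \<Longrightarrow> R \<in> subboxes J' B'"
  unfolding subboxes_def by blast

text \<open>If a box meets \<open>E\<close> in a large proportion, then so do many of its segments in direction \<open>j\<close>;
  hence the directions can be treated one after the other.\<close>

lemma uniform_A_infinity_restricted_weak_type:
  fixes J :: "'n::finite set" and l :: real
  assumes "finite J" "0 < l"
  shows "\<exists>C\<ge>0. \<forall>B w E. uniform_A_infinity D B w \<longrightarrow> E \<subseteq> B \<longrightarrow>
    sum w (\<Union>{R \<in> subboxes J B. l * card R \<le> card (R \<inter> E)}) \<le> C * sum w E"
  using assms
proof (induction J arbitrary: l)
  case empty
  have "\<Union>{R \<in> subboxes {} B. l * card R \<le> card (R \<inter> E)} \<subseteq> E" for B and E :: "('n \<Rightarrow> int) set"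
  proof
    fix x assume "x \<in> \<Union>{R \<in> subboxes {} B. l * card R \<le> card (R \<inter> E)}"
    then obtain R where R: "R \<in> subboxes {} B" "l * card R \<le> card (R \<inter> E)" "x \<in> R" by auto
    then have "R = {x}" by (auto elim!: subboxesE intro!: antisym simp: fun_eq_iff[symmetric])
    then show "x \<in> E" using R(2) empty by (cases "x \<in> E") auto
  qed
  then have "sum w (\<Union>{R \<in> subboxes {} B. l * card R \<le> card (R \<inter> E)}) \<le> 1 * sum w E"
    if "uniform_A_infinity D B w" "E \<subseteq> B" for B w and E :: "('n \<Rightarrow> int) set"
    using that finite_subset[of E B] unfolding uniform_A_infinity_def by (auto intro!: sum_mono2)
  then show ?case by (intro exI[of _ 1]) auto
next
  case (insert j J)
  have l2: "0 < l / 2" using insert.prems by simp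
  obtain C where C: "0 \<le> C" "\<And>B w E. uniform_A_infinity D B w \<Longrightarrow> E \<subseteq> B \<Longrightarrow>
    sum w (\<Union>{R \<in> subboxes J B. l / 2 * card R \<le> card (R \<inter> E)}) \<le> C * sum w E"
    using insert.IH[OF l2] by blast
  have main: "sum w (\<Union>{R \<in> subboxes (insert j J) B. l * card R \<le> card (R \<inter> E)}) \<le> C * (2 * \<bar>D (l / 2)\<bar>) * sum w E"
    if Ai: "uniform_A_infinity D B w" and E: "E \<subseteq> B" for B w E
  proof -
    have B: "finite B" and w: "\<And>x. 0 \<le> w x" and D: "0 \<le> D (l / 2)"
      and cmp: "\<And>R A. R \<in> subboxes UNIV B \<Longrightarrow> A \<subseteq> R \<Longrightarrow> l / 2 * card R \<le> card A \<Longrightarrow> sum w R \<le> D (l / 2) * sum w A"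
      using Ai l2 unfolding uniform_A_infinity_def by blast+
    have finE: "finite E" using B E finite_subset by blast
    \<comment> \<open>The segments filled by \<open>E\<close> at least to the proportion
      \<open>l / 2\<close>; their union \<open>E1\<close> plays the role of \<open>E\<close> for the
      remaining directions.\<close>
    define F where "F = {I \<in> subboxes {j} B. l / 2 * card I \<le> card (I \<inter> E)}"
    define E1 where "E1 = \<Union>F"
    have E1B: "E1 \<subseteq> B" unfolding E1_def F_def using subboxesD(1) by blast
    have finE1: "finite E1" using B E1B finite_subset by blast
    \<comment> \<open>The covering lemma is applied to \<open>w\<close> and to
      \<open>D (l / 2) * w\<close> restricted to \<open>E\<close>; on a segment of \<open>F\<close>
      the comparison \<open>cmp\<close> says that the latter has at least the mass of the
      former.\<close>
    have "sum w E1 \<le> 2 * sum (\<lambda>x. D (l / 2) * (if x \<in> E then w x else 0)) E1"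
      unfolding E1_def
    proof (rule segment_covering[of F j B])
      show "finite F" unfolding F_def using finite_subboxes[OF B] by simp
      show "F \<subseteq> subboxes {j} B" unfolding F_def by blast
      fix I assume I: "I \<in> F"
      then have "sum w I \<le> D (l / 2) * sum w (I \<inter> E)"
        using cmp[of I "I \<inter> E"] subboxes_mono[of I "{j}" B UNIV B] by (auto simp: F_def)
      moreover have "finite I" using I subboxesD(2) unfolding F_def by blast
      ultimately show "sum w I \<le> sum (\<lambda>x. D (l / 2) * (if x \<in> E then w x else 0)) I"
        by (simp add: sum_distrib_left[symmetric] sum.inter_restrict)
    qed (use w D in auto)
    also have "\<dots> = 2 * D (l / 2) * sum w (E1 \<inter> E)"
      using finE1 by (simp add: sum_distrib_left[symmetric] sum.inter_restrict)
    also have "\<dots> \<le> 2 * D (l / 2) * sum w E"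
      using D w finE by (intro mult_left_mono sum_mono2) auto
    finally have E1w: "sum w E1 \<le> 2 * D (l / 2) * sum w E" .
    have "\<Union>{R \<in> subboxes (insert j J) B. l * card R \<le> card (R \<inter> E)}
        \<subseteq> \<Union>{R \<in> subboxes J B. l / 2 * card R \<le> card (R \<inter> E1)}"
    proof
      fix x assume "x \<in> \<Union>{R \<in> subboxes (insert j J) B. l * card R \<le> card (R \<inter> E)}"
      then obtain R where R: "R \<in> subboxes (insert j J) B" "x \<in> R" and lR: "l * card R \<le> card (R \<inter> E)" by auto
      then obtain a b where ab: "R = {a..b}" by (auto elim: subboxesE)
      let ?S = "{a(j:=x j)..b(j:=x j)}" and ?T = "{a j..b j}"
      note slice = slice_subboxes[OF R(1,2)[unfolded ab]]
      have cR: "card R = card ?S * card ?T" unfolding ab by (rule card_int_box_split)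
      have cpos: "0 < card ?T" using subboxesD(4)[OF R(1)] cR by auto
      have cint: "real (card (X \<inter> Y)) = (\<Sum>x\<in>X. if x \<in> Y then 1 else 0)" if "finite X" for X Y :: "('n \<Rightarrow> int) set"
        using sum.inter_restrict[OF that, of "\<lambda>_. 1::real" Y] by simp
      have "real (card (R \<inter> E)) = (\<Sum>y\<in>?S. \<Sum>t\<in>?T. if y(j:=t) \<in> E then 1 else 0)"
        unfolding ab cint[OF finite_int_box] by (rule sum_int_box_split)
      \<comment> \<open>A segment over a point of \<open>E1\<close> is counted as full, any other
        contributes less than \<open>l / 2\<close> of its length. Of the proportion
        \<open>l\<close>, one half thus remains for the slice.\<close>
      also have "\<dots> \<le> (\<Sum>y\<in>?S. (if y \<in> E1 then 1 else 0 :: real) * card ?T + l / 2 * card ?T)"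
      proof (rule sum_mono)
        fix y assume y: "y \<in> ?S"
        let ?I = "{y(j:=a j)..y(j:=b j)}"
        have I: "?I \<in> subboxes {j} B" "y \<in> ?I" using slice(3)[OF y] by auto
        have cI: "card ?I = card ?T" using sum_segment[of "\<lambda>_. 1::nat" y j "a j" "b j"] by simp
        have eq: "(\<Sum>t\<in>?T. if y(j:=t) \<in> E then 1 else 0) = real (card (?I \<inter> E))"
          unfolding cint[OF finite_int_box] by (rule sum_segment[symmetric])
        have "real (card (?I \<inter> E)) \<le> card ?I" by (intro of_nat_mono card_mono) auto
        moreover have "0 \<le> l / 2 * card ?T" using l2 by simp
        moreover have "real (card (?I \<inter> E)) < l / 2 * card ?I" if "y \<notin> E1"
          using that I unfolding E1_def F_def by force
        ultimately show "(\<Sum>t\<in>?T. if y(j:=t) \<in> E then 1 else 0)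
            \<le> (if y \<in> E1 then 1 else 0 :: real) * card ?T + l / 2 * card ?T"
          unfolding eq cI by (cases "y \<in> E1") (simp_all del: card_atLeastAtMost_int)
      qed
      also have "\<dots> = card ?T * (card (?S \<inter> E1) + l / 2 * card ?S)"
        unfolding cint[OF finite_int_box] by (simp add: sum.distrib sum_distrib_left algebra_simps)
      finally have "l * card R \<le> card ?T * (card (?S \<inter> E1) + l / 2 * card ?S)"
        using lR by linarith
      then have "card ?T * (l * card ?S) \<le> card ?T * (card (?S \<inter> E1) + l / 2 * card ?S)"
        unfolding cR by (simp add: algebra_simps)
      then have "l * card ?S \<le> card (?S \<inter> E1) + l / 2 * card ?S"
        using cpos by (simp only: mult_le_cancel_left_pos of_nat_0_less_iff)
      then have "l / 2 * card ?S \<le> card (?S \<inter> E1)" by simp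
      then show "x \<in> \<Union>{R \<in> subboxes J B. l / 2 * card R \<le> card (R \<inter> E1)}"
        using slice(1,2) by blast
    qed
    moreover have "finite (\<Union>{R \<in> subboxes J B. l / 2 * card R \<le> card (R \<inter> E1)})"
      by (rule finite_subset[OF _ B]) (use subboxesD(1) in blast)
    ultimately have "sum w (\<Union>{R \<in> subboxes (insert j J) B. l * card R \<le> card (R \<inter> E)})
        \<le> sum w (\<Union>{R \<in> subboxes J B. l / 2 * card R \<le> card (R \<inter> E1)})"
      using w by (intro sum_mono2) auto
    also have "\<dots> \<le> C * sum w E1" by (rule C(2)[OF Ai E1B])
    also have "\<dots> \<le> C * (2 * D (l / 2) * sum w E)" using E1w C(1) by (rule mult_left_mono)
    finally show ?thesis using D by (simp add: mult.assoc)
  qed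
  \<comment> \<open>The absolute value makes the constant nonnegative before a weight is given that
    would supply \<open>0 \<le> D (l / 2)\<close>.\<close>
  show ?case
    by (rule exI[of _ "C * (2 * \<bar>D (l / 2)\<bar>)"]) (use C(1) main in auto)
qed

section \<open>Reverse Hoelder inequality and sparse families\<close>

lemma box_average_half_le:
  assumes "finite R" "R' \<subseteq> R" "R' \<noteq> {}" "card R \<le> 3 * card R'" "\<And>x. 0 \<le> w x"
  shows "box_average w R' \<le> 3 * box_average w R"
proof -
  have fin: "finite R'" using assms finite_subset by blast
  then have pos: "0 < card R'" "0 < card R" using assms by (auto simp: card_gt_0_iff)
  have "sum w R' \<le> sum w R" using assms by (intro sum_mono2) auto
  then have "box_average w R' \<le> sum w R / card R'"
    unfolding box_average_def by (intro divide_right_mono) auto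
  also have "\<dots> \<le> 3 * (sum w R / card R)"
  proof -
    have "real (card R) \<le> 3 * card R'" using assms(4) by linarith
    then have "sum w R * card R \<le> sum w R * (3 * card R')"
      using assms by (intro mult_left_mono sum_nonneg) auto
    then show ?thesis using pos by (simp add: field_simps)
  qed
  finally show ?thesis by (simp add: box_average_def)
qed

text \<open>An edge of 2 k + 1 points with k at least 1 is cut into k + 1 and k points. The worst
  case is an edge of 3 points, whose smaller part is one third; hence the factor 3 of the
  stopping-time argument.\<close>

lemma bisect_box:
  fixes a b :: "'n::finite \<Rightarrow> int"
  assumes "a \<le> b" "a \<noteq> b"
  obtains a' b' where "a \<le> b'" "a' \<le> b" "{a..b'} \<union> {a'..b} = {a..b}" "{a..b'} \<inter> {a'..b} = {}"
    "card {a..b} \<le> 3 * card {a..b'}" "card {a..b} \<le> 3 * card {a'..b}"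
proof -
  obtain j where "a j \<noteq> b j" using assms(2) by auto
  then have j: "a j < b j" using assms(1) by (metis le_fun_def order_le_imp_less_or_eq)
  define c where "c = (a j + b j) div 2"
  have c: "a j \<le> c" "c < b j" "b j - a j + 1 \<le> 3 * (c - a j + 1)" "b j - a j + 1 \<le> 3 * (b j - c)"
    using j unfolding c_def by presburger+
  let ?b = "b(j:=c)" and ?a = "a(j:=c+1)"
  show thesis
  proof (rule that[of ?b ?a])
    show "a \<le> ?b" "?a \<le> b" using assms(1) c by (auto simp: le_fun_def)
    show "{a..?b} \<union> {?a..b} = {a..b}"
    proof (intro equalityI subsetI)
      fix x assume "x \<in> {a..?b} \<union> {?a..b}"
      then have "(\<forall>i. a i \<le> x i \<and> x i \<le> ?b i) \<or> (\<forall>i. ?a i \<le> x i \<and> x i \<le> b i)"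
        unfolding Un_iff atLeastAtMost_iff le_fun_def by blast
      then have "a i \<le> x i \<and> x i \<le> b i" for i
        using c by (cases "i = j") (auto dest: spec[of _ i])
      then show "x \<in> {a..b}" by (simp add: le_fun_def)
    next
      fix x assume "x \<in> {a..b}"
      then show "x \<in> {a..?b} \<union> {?a..b}" by (cases "x j \<le> c") (auto simp: le_fun_def)
    qed
    show "{a..?b} \<inter> {?a..b} = {}"
    proof (rule ccontr)
      assume "{a..?b} \<inter> {?a..b} \<noteq> {}"
      then obtain x where "x \<le> ?b" "?a \<le> x" by auto
      then have "x j \<le> ?b j" "?a j \<le> x j" by (auto simp only: le_fun_def)
      then show False by simp
    qed
    have "card {a j..b j} \<le> 3 * card {a j..c}" "card {a j..b j} \<le> 3 * card {c + 1..b j}"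
      using c by auto
    then have *: "k * card {a j..b j} \<le> 3 * (k * card {a j..c})" "k * card {a j..b j} \<le> 3 * (k * card {c + 1..b j})" for k
      by (metis mult.left_commute mult_le_mono2)+
    have s: "card {a..b} = card {a(j:=0)..b(j:=0)} * card {a j..b j}"
      "card {a..?b} = card {a(j:=0)..b(j:=0)} * card {a j..c}"
      "card {?a..b} = card {a(j:=0)..b(j:=0)} * card {c + 1..b j}"
      using card_int_box_split[of a b j 0] card_int_box_split[of a ?b j 0] card_int_box_split[of ?a b j 0] by simp_all
    show "card {a..b} \<le> 3 * card {a..?b}" "card {a..b} \<le> 3 * card {?a..b}"
      unfolding s by (rule *)+
  qed
qed

text \<open>The boxes of a Calderon-Zygmund family arise by repeated bisection, stopping as soon as
  the average exceeds \<open>t\<close>.\<close>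

lemma calderon_zygmund_boxes:
  fixes w :: "('n::finite \<Rightarrow> int) \<Rightarrow> real"
  assumes w: "\<And>x. 0 \<le> w x" and "R \<in> subboxes UNIV B" "box_average w R \<le> t"
  shows "\<exists>Q. finite Q \<and> Q \<subseteq> subboxes UNIV R \<and> disjoint Q
    \<and> (\<forall>S\<in>Q. t < box_average w S \<and> box_average w S \<le> 3 * t) \<and> (\<forall>x\<in>R - \<Union>Q. w x \<le> t)"
  using assms(2,3)
proof (induction "card R" arbitrary: R rule: less_induct)
  case less
  obtain a b where ab: "R = {a..b}" "a \<le> b" using less.prems(1) by (rule subboxesE) blast
  show ?case
  proof (cases "a = b")
    case True
    then show ?thesis using less.prems(2) ab(1)
      by (intro exI[of _ "{}"]) (auto simp: box_average_def)
  next
    case False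
    obtain a' b' where h: "a \<le> b'" "a' \<le> b" "{a..b'} \<union> {a'..b} = {a..b}" "{a..b'} \<inter> {a'..b} = {}"
      "card {a..b} \<le> 3 * card {a..b'}" "card {a..b} \<le> 3 * card {a'..b}"
      using bisect_box[OF ab(2) False] .
    have half: "\<exists>Q. finite Q \<and> Q \<subseteq> subboxes UNIV R' \<and> disjoint Q
      \<and> (\<forall>S\<in>Q. t < box_average w S \<and> box_average w S \<le> 3 * t) \<and> (\<forall>x\<in>R' - \<Union>Q. w x \<le> t)"
      if R': "R' \<in> subboxes UNIV R" "R' \<subset> R" "card R \<le> 3 * card R'" for R'
    proof (cases "box_average w R' \<le> t")
      case True
      have "finite R" using ab by simp
      then have "card R' < card R" using R'(2) by (rule psubset_card_mono)
      moreover have "R' \<in> subboxes UNIV B"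
        using R'(1) subboxes_mono[of R' UNIV R UNIV B] subboxesD(1)[OF less.prems(1)] by blast
      ultimately show ?thesis using less.hyps True by blast
    next
      case False
      \<comment> \<open>The half exceeds the level and is selected as a whole; the mean over its
        parent was still at most \<open>t\<close>, which bounds the overshoot.\<close>
      have "box_average w R' \<le> 3 * box_average w R"
        using R' subboxesD[OF R'(1)] subboxesD[OF less.prems(1)] w by (intro box_average_half_le) auto
      then have "box_average w R' \<le> 3 * t" using less.prems(2) by linarith
      moreover have "R' \<in> subboxes UNIV R'" using R'(1) unfolding subboxes_def by blast
      ultimately show ?thesis using False by (intro exI[of _ "{R'}"]) (auto simp: disjoint_def)
    qed
    have R1: "{a..b'} \<in> subboxes UNIV R" and R2: "{a'..b} \<in> subboxes UNIV R"
      using h(1-3) ab(1) by (auto intro!: subboxesI)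
    then have ne: "{a..b'} \<noteq> {}" "{a'..b} \<noteq> {}" by (auto dest: subboxesD(3))
    then have ss: "{a..b'} \<subset> R" "{a'..b} \<subset> R" using h(3,4) unfolding ab(1) by blast+
    obtain Q1 where Q1: "finite Q1" "Q1 \<subseteq> subboxes UNIV {a..b'}" "disjoint Q1"
      "\<forall>S\<in>Q1. t < box_average w S \<and> box_average w S \<le> 3 * t" "\<forall>x\<in>{a..b'} - \<Union>Q1. w x \<le> t"
      using half[OF R1 ss(1)] h(5) ab(1) by blast
    obtain Q2 where Q2: "finite Q2" "Q2 \<subseteq> subboxes UNIV {a'..b}" "disjoint Q2"
      "\<forall>S\<in>Q2. t < box_average w S \<and> box_average w S \<le> 3 * t" "\<forall>x\<in>{a'..b} - \<Union>Q2. w x \<le> t"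
      using half[OF R2 ss(2)] h(6) ab(1) by blast
    have s1: "\<And>S. S \<in> Q1 \<Longrightarrow> S \<subseteq> {a..b'}" and s2: "\<And>S. S \<in> Q2 \<Longrightarrow> S \<subseteq> {a'..b}"
      using Q1(2) Q2(2) subboxesD(1) by blast+
    have "disjoint (Q1 \<union> Q2)"
      using s1 s2 h(4) by (intro disjoint_union Q1 Q2) blast
    moreover have "Q1 \<union> Q2 \<subseteq> subboxes UNIV R"
      using Q1(2) Q2(2) subboxes_mono[of _ UNIV "{a..b'}" UNIV R] subboxes_mono[of _ UNIV "{a'..b}" UNIV R] ss by auto
    moreover have "\<forall>x\<in>R - \<Union>(Q1 \<union> Q2). w x \<le> t"
      using Q1(5) Q2(5) h(3) unfolding ab(1) by blast
    ultimately show ?thesis using Q1(1,4) Q2(1,4) by (intro exI[of _ "Q1 \<union> Q2"]) auto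
  qed
qed

text \<open>Let \<open>a\<close> be the mean over \<open>R\<close>. Off the stopping boxes of level
  \<open>2 * a\<close> the weight is at most \<open>2 * a\<close>. The stopping boxes fill at most
  half of \<open>R\<close>, so they carry at most the share \<open>\<beta>\<close> of its weight,
  and induction applies to each of them with mean at most \<open>6 * a\<close>. The constant solves
  \<open>C = 2 powr \<epsilon> + C * (6 powr \<epsilon> * \<beta>)\<close>.\<close>

lemma reverse_hoelder:
  fixes w :: "('n::finite \<Rightarrow> int) \<Rightarrow> real"
  assumes w: "\<And>x. 0 \<le> w x"
    and small: "\<And>R A. R \<in> subboxes UNIV B \<Longrightarrow> A \<subseteq> R \<Longrightarrow> 2 * card A \<le> card R \<Longrightarrow> sum w A \<le> \<beta> * sum w R"
    and \<epsilon>: "0 < \<epsilon>" "6 powr \<epsilon> * \<beta> < 1"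
    and R: "R \<in> subboxes UNIV B"
  shows "(\<Sum>x\<in>R. w x * w x powr \<epsilon>) \<le> 2 powr \<epsilon> / (1 - 6 powr \<epsilon> * \<beta>) * (sum w R * box_average w R powr \<epsilon>)"
  using R
proof (induction "card R" arbitrary: R rule: less_induct)
  case (less R)
  define C where "C = 2 powr \<epsilon> / (1 - 6 powr \<epsilon> * \<beta>)"
  have C: "0 \<le> C" "2 powr \<epsilon> + C * (6 powr \<epsilon> * \<beta>) = C"
    using \<epsilon> unfolding C_def by (auto simp: field_simps)
  note R = subboxesD[OF less.prems]
  define a where "a = box_average w R"
  have a0: "0 \<le> a" unfolding a_def box_average_def by (simp add: sum_nonneg w)
  have sum_eq: "sum w R = a * card R" unfolding a_def box_average_def using R(4) by simp
  show ?case
  proof (cases "a = 0")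
    case True
    then have "\<And>x. x \<in> R \<Longrightarrow> w x = 0" using sum_eq sum_nonneg_eq_0_iff[OF R(2), of w] w by auto
    then show ?thesis by simp
  next
    case False
    then have apos: "0 < a" using a0 by simp
    obtain Q where Q: "finite Q" "Q \<subseteq> subboxes UNIV R" "disjoint Q"
      "\<And>S. S \<in> Q \<Longrightarrow> 2 * a < box_average w S" "\<And>S. S \<in> Q \<Longrightarrow> box_average w S \<le> 3 * (2 * a)"
      "\<And>x. x \<in> R - \<Union>Q \<Longrightarrow> w x \<le> 2 * a"
      using calderon_zygmund_boxes[where w = w and t = "2 * a", OF w less.prems] apos unfolding a_def by auto
    define A where "A = \<Union>Q"
    have SR: "\<And>S. S \<in> Q \<Longrightarrow> S \<subseteq> R" using Q(2) subboxesD(1) by blast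
    then have AR: "A \<subseteq> R" unfolding A_def by blast
    have finS: "\<And>S. S \<in> Q \<Longrightarrow> finite S" using SR R(2) finite_subset by blast
    have sumA: "sum g A = (\<Sum>S\<in>Q. sum g S)" for g :: "('n \<Rightarrow> int) \<Rightarrow> real"
      unfolding A_def using Q(1,3) finS by (subst sum.Union_disjoint) (auto simp: disjoint_def)
    have "2 * a * card A = (\<Sum>S\<in>Q. 2 * a * card S)"
      using sumA[of "\<lambda>_. 2 * a"] by (simp add: mult.commute)
    also have "\<dots> \<le> (\<Sum>S\<in>Q. sum w S)"
    proof (rule sum_mono)
      fix S assume S: "S \<in> Q"
      then have "0 < card S" using Q(2) subboxesD(4) by blast
      then show "2 * a * card S \<le> sum w S"
        using Q(4)[OF S] by (simp add: box_average_def field_simps)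
    qed
    also have "\<dots> = sum w A" using sumA by simp
    also have "\<dots> \<le> a * card R"
      unfolding sum_eq[symmetric] using AR R(2) w by (intro sum_mono2) auto
    finally have "a * (2 * card A) \<le> a * card R" by (simp add: mult_ac)
    then have "real (2 * card A) \<le> real (card R)" using apos by (simp only: mult_le_cancel_left_pos)
    then have "2 * card A \<le> card R" by linarith
    then have sA: "sum w A \<le> \<beta> * sum w R" by (rule small[OF less.prems AR])
    have "(\<Sum>x\<in>A. w x * w x powr \<epsilon>) = (\<Sum>S\<in>Q. \<Sum>x\<in>S. w x * w x powr \<epsilon>)" by (rule sumA)
    also have "\<dots> \<le> (\<Sum>S\<in>Q. C * (sum w S * (6 * a) powr \<epsilon>))"
    proof (rule sum_mono)
      fix S assume S: "S \<in> Q"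
      \<comment> \<open>The level \<open>2 * a\<close> lies strictly above the mean over
        \<open>R\<close>, so every stopping box is a proper part and the induction on cardinality
        applies.\<close>
      have "S \<noteq> R" using Q(4)[OF S] apos unfolding a_def by auto
      then have "card S < card R" using SR[OF S] R(2) by (intro psubset_card_mono) auto
      moreover have "S \<in> subboxes UNIV B"
        using Q(2) S R(1) subboxes_mono[of S UNIV R UNIV B] by blast
      ultimately have "(\<Sum>x\<in>S. w x * w x powr \<epsilon>) \<le> C * (sum w S * box_average w S powr \<epsilon>)"
        using less.hyps unfolding C_def by blast
      also have "\<dots> \<le> C * (sum w S * (6 * a) powr \<epsilon>)"
        using Q(4,5)[OF S] apos \<epsilon> C(1) w by (intro mult_left_mono powr_mono2 sum_nonneg) auto
      finally show "(\<Sum>x\<in>S. w x * w x powr \<epsilon>) \<le> C * (sum w S * (6 * a) powr \<epsilon>)" .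
    qed
    also have "\<dots> = C * (6 * a) powr \<epsilon> * sum w A"
      unfolding sumA by (subst sum_distrib_left) (simp add: mult_ac)
    also have "\<dots> \<le> C * (6 * a) powr \<epsilon> * (\<beta> * sum w R)"
      using C(1) sA by (intro mult_left_mono) auto
    finally have 1: "(\<Sum>x\<in>A. w x * w x powr \<epsilon>) \<le> C * (6 * a) powr \<epsilon> * (\<beta> * sum w R)" .
    have "(\<Sum>x\<in>R - A. w x * w x powr \<epsilon>) \<le> (\<Sum>x\<in>R - A. w x * (2 * a) powr \<epsilon>)"
      using Q(6) w \<epsilon> unfolding A_def by (intro sum_mono mult_left_mono powr_mono2) auto
    also have "\<dots> \<le> (\<Sum>x\<in>R. w x * (2 * a) powr \<epsilon>)"
      using R(2) w by (intro sum_mono2) auto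
    also have "\<dots> = (2 * a) powr \<epsilon> * sum w R" by (simp add: sum_distrib_right[symmetric] mult.commute)
    finally have 2: "(\<Sum>x\<in>R - A. w x * w x powr \<epsilon>) \<le> (2 * a) powr \<epsilon> * sum w R" .
    have "(\<Sum>x\<in>R. w x * w x powr \<epsilon>) \<le> (2 * a) powr \<epsilon> * sum w R + C * (6 * a) powr \<epsilon> * (\<beta> * sum w R)"
      using 1 2 sum.subset_diff[OF AR R(2), of "\<lambda>x. w x * w x powr \<epsilon>"] by linarith
    also have "\<dots> = (2 powr \<epsilon> + C * (6 powr \<epsilon> * \<beta>)) * (sum w R * a powr \<epsilon>)"
      using powr_mult[of 2 a \<epsilon>] powr_mult[of 6 a \<epsilon>] by (simp add: algebra_simps)
    finally show ?thesis unfolding C(2) unfolding C_def a_def .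
  qed
qed

text \<open>Greedy choice in decreasing order of \<open>V\<close>, obtained from the ranking by
  \<open>- V\<close>. A set is selected if more than half of it is not covered by the earlier
  selected ones; \<open>E R\<close> is that uncovered part, so these parts are disjoint. A rejected
  set is at least half covered by selected sets with no smaller \<open>V\<close>.\<close>

lemma sparse_selection:
  fixes V :: "'a set \<Rightarrow> real"
  assumes "finite F" "\<And>R. R \<in> F \<Longrightarrow> finite R"
  shows "\<exists>S E. S \<subseteq> F \<and> (\<forall>R\<in>S. E R \<subseteq> R \<and> card R \<le> 2 * card (E R)) \<and> disjoint_family_on E S
    \<and> (\<forall>R\<in>F. card R \<le> 2 * card (R \<inter> \<Union>{T\<in>S. V R \<le> V T}))"
  using assms
proof (induction F rule: finite_ranking_induct[where f = "\<lambda>R. - V R"])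
  case empty
  show ?case by (intro exI[of _ "{}"]) (auto simp: disjoint_family_on_def)
next
  case (insert R F)
  have low: "V R \<le> V T" if "T \<in> F" for T using insert.hyps(2)[OF that] by simp
  obtain S E where S: "S \<subseteq> F" "\<forall>R\<in>S. E R \<subseteq> R \<and> card R \<le> 2 * card (E R)" "disjoint_family_on E S"
    "\<forall>R\<in>F. card R \<le> 2 * card (R \<inter> \<Union>{T\<in>S. V R \<le> V T})"
    using insert.IH[OF insert.prems[OF insertI2]] by blast
  have finR: "finite R" using insert.prems by simp
  have "{T\<in>S. V R \<le> V T} = S" using low S(1) by blast
  show ?case
  proof (cases "R \<in> F \<or> card R \<le> 2 * card (R \<inter> \<Union>S)")
    case True
    have "\<forall>R'\<in>insert R F. card R' \<le> 2 * card (R' \<inter> \<Union>{T\<in>S. V R' \<le> V T})"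
      using S(4) True \<open>{T\<in>S. V R \<le> V T} = S\<close> by auto
    then show ?thesis using S by (intro exI[of _ S] exI[of _ E]) auto
  next
    case False
    let ?S = "insert R S" and ?E = "E(R := R - \<Union>S)"
    have RS: "R \<notin> S" using False S(1) by blast
    have "card R = card (R \<inter> \<Union>S) + card (R - \<Union>S)"
      using finR by (metis card_Int_Diff)
    then have "card R \<le> 2 * card (R - \<Union>S)" using False by linarith
    then have "\<forall>R'\<in>?S. ?E R' \<subseteq> R' \<and> card R' \<le> 2 * card (?E R')" using S(2) by auto
    moreover have "disjoint_family_on ?E ?S"
      using S(2,3) RS unfolding disjoint_family_on_def by (simp add: disjoint_iff) blast
    moreover have "\<forall>R'\<in>insert R F. card R' \<le> 2 * card (R' \<inter> \<Union>{T\<in>?S. V R' \<le> V T})"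
    proof
      fix R' assume R': "R' \<in> insert R F"
      show "card R' \<le> 2 * card (R' \<inter> \<Union>{T\<in>?S. V R' \<le> V T})"
      proof (cases "R' = R")
        case True
        then have "R' \<inter> \<Union>{T\<in>?S. V R' \<le> V T} = R'" by blast
        then show ?thesis by simp
      next
        case neq: False
        then have "card R' \<le> 2 * card (R' \<inter> \<Union>{T\<in>S. V R' \<le> V T})" using R' S(4) by blast
        also have "\<dots> \<le> 2 * card (R' \<inter> \<Union>{T\<in>?S. V R' \<le> V T})"
          using R' insert.prems by (intro mult_le_mono card_mono) auto
        finally show ?thesis .
      qed
    qed
    moreover have "?S \<subseteq> insert R F" using S(1) by blast
    ultimately show ?thesis by (intro exI[of _ ?S] exI[of _ ?E] conjI)
  qed
qed

section \<open>Hoelder's inequality for finite sums, and the power bump\<close>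

lemma weighted_arith_geo_mean:
  fixes g \<theta> :: "'i \<Rightarrow> real"
  assumes I: "finite I" and \<theta>: "\<And>i. i \<in> I \<Longrightarrow> 0 < \<theta> i" "sum \<theta> I = 1" and g: "\<And>i. i \<in> I \<Longrightarrow> 0 \<le> g i"
  shows "(\<Prod>i\<in>I. g i powr \<theta> i) \<le> (\<Sum>i\<in>I. \<theta> i * g i)"
proof (cases "\<exists>i\<in>I. g i = 0")
  case True
  then have "(\<Prod>i\<in>I. g i powr \<theta> i) = 0" using I by (intro prod_zero) auto
  then show ?thesis using \<theta>(1) g by (auto intro!: sum_nonneg mult_nonneg_nonneg simp: less_imp_le)
next
  case False
  then have gpos: "\<And>i. i \<in> I \<Longrightarrow> 0 < g i" using g by (metis order_le_less)
  have "(\<Prod>i\<in>I. g i powr \<theta> i) = (\<Prod>i\<in>I. exp (\<theta> i * ln (g i)))"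
    by (intro prod.cong) (auto simp: powr_def dest: gpos)
  also have "\<dots> = exp (\<Sum>i\<in>I. \<theta> i *\<^sub>R ln (g i))"
    using I by (simp add: exp_sum)
  also have "\<dots> \<le> (\<Sum>i\<in>I. \<theta> i * exp (ln (g i)))"
    using I \<theta> exp_convex by (intro convex_on_sum[where C = UNIV]) (auto simp: less_imp_le)
  also have "\<dots> = (\<Sum>i\<in>I. \<theta> i * g i)" using gpos by (intro sum.cong) auto
  finally show ?thesis .
qed

text \<open>Each function is normalised to sum 1 and the weighted arithmetic-geometric mean
  inequality is summed over \<open>X\<close>. A function with sum 0 vanishes on \<open>X\<close> and
  is treated separately.\<close>

lemma hoelder_sum:
  fixes g :: "'i \<Rightarrow> 'a \<Rightarrow> real" and \<theta> :: "'i \<Rightarrow> real"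
  assumes I: "finite I" and X: "finite X" and \<theta>: "\<And>i. i \<in> I \<Longrightarrow> 0 < \<theta> i" "sum \<theta> I = 1"
    and g: "\<And>i x. i \<in> I \<Longrightarrow> x \<in> X \<Longrightarrow> 0 \<le> g i x"
  shows "(\<Sum>x\<in>X. \<Prod>i\<in>I. g i x powr \<theta> i) \<le> (\<Prod>i\<in>I. (\<Sum>x\<in>X. g i x) powr \<theta> i)"
proof (cases "\<exists>i\<in>I. (\<Sum>x\<in>X. g i x) = 0")
  case True
  then obtain i where i: "i \<in> I" "(\<Sum>x\<in>X. g i x) = 0" by auto
  then have "\<And>x. x \<in> X \<Longrightarrow> g i x = 0" using X g sum_nonneg_eq_0_iff[of X "g i"] by auto
  then have "(\<Sum>x\<in>X. \<Prod>i\<in>I. g i x powr \<theta> i) = 0"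
    using I i(1) by (intro sum.neutral ballI prod_zero) auto
  then show ?thesis by (auto intro: prod_nonneg)
next
  case False
  let ?G = "\<lambda>i. \<Sum>x\<in>X. g i x"
  have G: "0 < ?G i" if "i \<in> I" for i
    using False g that by (metis order_le_less sum_nonneg)
  have "(\<Sum>x\<in>X. \<Prod>i\<in>I. g i x powr \<theta> i) = (\<Sum>x\<in>X. (\<Prod>i\<in>I. ?G i powr \<theta> i) * (\<Prod>i\<in>I. (g i x / ?G i) powr \<theta> i))"
    unfolding prod.distrib[symmetric]
  proof (intro sum.cong prod.cong refl)
    fix x i assume "i \<in> I"
    then have "g i x = ?G i * (g i x / ?G i)" using G by (metis less_irrefl nonzero_mult_div_cancel_left times_divide_eq_right)
    then show "g i x powr \<theta> i = ?G i powr \<theta> i * (g i x / ?G i) powr \<theta> i" by (metis powr_mult)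
  qed
  also have "\<dots> \<le> (\<Sum>x\<in>X. (\<Prod>i\<in>I. ?G i powr \<theta> i) * (\<Sum>i\<in>I. \<theta> i * (g i x / ?G i)))"
    using G g \<theta> I by (intro sum_mono mult_left_mono weighted_arith_geo_mean prod_nonneg divide_nonneg_pos) auto
  also have "\<dots> = (\<Prod>i\<in>I. ?G i powr \<theta> i) * (\<Sum>x\<in>X. \<Sum>i\<in>I. \<theta> i * (g i x / ?G i))"
    by (rule sum_distrib_left[symmetric])
  also have "(\<Sum>x\<in>X. \<Sum>i\<in>I. \<theta> i * (g i x / ?G i)) = (\<Sum>i\<in>I. \<theta> i * (?G i / ?G i))"
    by (subst sum.swap) (simp only: sum_distrib_left[symmetric] sum_divide_distrib[symmetric])
  also have "(\<Sum>i\<in>I. \<theta> i * (?G i / ?G i)) = 1"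
    unfolding \<theta>(2)[symmetric] using G by (intro sum.cong) (auto simp: less_imp_neq[symmetric])
  finally show ?thesis by simp
qed

lemma hoelder_sum2:
  fixes a b :: "'a \<Rightarrow> real"
  assumes "finite X" "0 < u" "u < 1" "\<And>x. x \<in> X \<Longrightarrow> 0 \<le> a x" "\<And>x. x \<in> X \<Longrightarrow> 0 \<le> b x"
  shows "(\<Sum>x\<in>X. a x powr u * b x powr (1 - u)) \<le> (\<Sum>x\<in>X. a x) powr u * (\<Sum>x\<in>X. b x) powr (1 - u)"
  using hoelder_sum[of UNIV X "\<lambda>i. if i then u else 1 - u" "\<lambda>i. if i then a else b"] assms
  by (auto simp: UNIV_bool mult.commute)

text \<open>The modulus is applied at proportion 1/2 to complements: if \<open>A\<close> fills at
  most half of \<open>R\<close>, then \<open>R - A\<close> carries at least the share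
  \<open>1 / D'\<close> of the weight, leaving at most \<open>\<beta>\<close> for
  \<open>A\<close>.\<close>

lemma reverse_hoelder_uniform:
  "\<exists>\<epsilon>>0. \<exists>C\<ge>0. \<forall>B (w :: ('n::finite \<Rightarrow> int) \<Rightarrow> real). uniform_A_infinity D B w \<longrightarrow>
    (\<forall>R\<in>subboxes UNIV B. (\<Sum>x\<in>R. w x * w x powr \<epsilon>) \<le> C * (sum w R * box_average w R powr \<epsilon>))"
proof -
  define D' where "D' = max 1 (D (1/2))"
  define \<beta> where "\<beta> = 1 - 1 / D'"
  have D': "1 \<le> D'" by (simp add: D'_def)
  have \<beta>: "0 \<le> \<beta>" "\<beta> < 1" using D' by (auto simp: \<beta>_def)
  \<comment> \<open>With this choice \<open>6 powr \<epsilon> * \<beta>\<close> equals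
    \<open>2 * \<beta> / (1 + \<beta>)\<close>, which is less than 1 because \<open>\<beta>\<close>
    is; 6 is the base occurring in \<open>reverse_hoelder\<close>.\<close>
  define \<epsilon> where "\<epsilon> = log 6 (2 / (1 + \<beta>))"
  have \<epsilon>: "0 < \<epsilon>" using \<beta> by (simp add: \<epsilon>_def)
  have "6 powr \<epsilon> = 2 / (1 + \<beta>)" using \<beta> by (simp add: \<epsilon>_def)
  then have "6 powr \<epsilon> * \<beta> = 2 * \<beta> / (1 + \<beta>)" by simp
  then have \<epsilon>\<beta>: "6 powr \<epsilon> * \<beta> < 1" using \<beta> by simp
  have "(\<Sum>x\<in>R. w x * w x powr \<epsilon>) \<le> 2 powr \<epsilon> / (1 - 6 powr \<epsilon> * \<beta>) * (sum w R * box_average w R powr \<epsilon>)"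
    if Ai: "uniform_A_infinity D B w" and R: "R \<in> subboxes UNIV B" for B and w :: "('n \<Rightarrow> int) \<Rightarrow> real" and R
  proof (rule reverse_hoelder[OF _ _ \<epsilon> \<epsilon>\<beta> R])
    show w: "\<And>x. 0 \<le> w x" using Ai unfolding uniform_A_infinity_def by blast
    fix R A assume R: "R \<in> subboxes UNIV B" and A: "A \<subseteq> R" "2 * card A \<le> card R"
    have fin: "finite R" using subboxesD(2)[OF R] .
    have "card (R - A) = card R - card A" using A fin by (meson card_Diff_subset finite_subset)
    then have "(1/2) * real (card R) \<le> real (card (R - A))" using A(2) by linarith
    then have "sum w R \<le> D (1/2) * sum w (R - A)"
      using Ai R unfolding uniform_A_infinity_def by (meson Diff_subset half_gt_zero_iff zero_less_one)
    also have "\<dots> \<le> D' * sum w (R - A)"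
      using w by (intro mult_right_mono sum_nonneg) (auto simp: D'_def)
    also have "sum w (R - A) = sum w R - sum w A" using A fin by (simp add: sum_diff)
    finally have "D' * sum w A \<le> D' * (\<beta> * sum w R)"
      using D' by (simp add: \<beta>_def algebra_simps)
    then show "sum w A \<le> \<beta> * sum w R" using D' by simp
  qed
  moreover have "0 \<le> 2 powr \<epsilon> / (1 - 6 powr \<epsilon> * \<beta>)" using \<epsilon>\<beta> by simp
  ultimately show ?thesis using \<epsilon> by blast
qed

text \<open>The reverse Hoelder inequality lets the exponent \<open>s\<close> on \<open>h\<close> be strictly smaller than \<open>P\<close>.\<close>

lemma box_average_bump:
  assumes P: "1 < (P::real)"
  shows "\<exists>s C. 1 < s \<and> s < P \<and> 0 \<le> C \<and> (\<forall>B (w :: ('n::finite \<Rightarrow> int) \<Rightarrow> real) f h. uniform_A_infinity D B w \<longrightarrow>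
    (\<forall>x. 0 \<le> h x) \<longrightarrow> (\<forall>x. f x \<le> h x * w x powr (1 - 1 / P)) \<longrightarrow>
    (\<forall>R\<in>subboxes UNIV B. box_average f R \<le>
       C * (box_average (\<lambda>x. h x powr s) R powr (1 / s) * box_average w R powr (1 - 1 / P))))"
proof -
  obtain \<epsilon> C where \<epsilon>: "0 < \<epsilon>" and C: "0 \<le> C"
    and *: "\<forall>B (w :: ('n \<Rightarrow> int) \<Rightarrow> real). uniform_A_infinity D B w \<longrightarrow>
      (\<forall>R\<in>subboxes UNIV B. (\<Sum>x\<in>R. w x * w x powr \<epsilon>) \<le> C * (sum w R * box_average w R powr \<epsilon>))"
    using reverse_hoelder_uniform[where D = D and 'n = 'n] by (elim exE conjE)
  note RH = *[rule_format]
  define r where "r = 1 - 1 / P"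
  \<comment> \<open>Determined by \<open>(1 + \<epsilon>) * (1 - u) = r\<close>: Hoelder's
    inequality with weights \<open>u\<close> and \<open>1 - u\<close> then meets \<open>w\<close>
    exactly in the power \<open>1 + \<epsilon>\<close> that the reverse inequality controls. Since
    \<open>\<epsilon>\<close> is positive, \<open>u\<close> exceeds \<open>1 / P\<close>, so
    \<open>s = 1 / u\<close> is below \<open>P\<close>.\<close>
  define u where "u = 1 - r / (1 + \<epsilon>)"
  have r: "0 < r" "r < 1" using P by (auto simp: r_def)
  have "0 < r / (1 + \<epsilon>)" "r / (1 + \<epsilon>) < r" using r \<epsilon> by (auto simp: divide_less_eq)
  then have u: "0 < u" "u < 1" "1 / P < u" using r(2) unfolding u_def r_def by linarith+
  have u4: "(1 + \<epsilon>) * (1 - u) = r" using \<epsilon> by (simp add: u_def)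
  have "box_average f R \<le> C powr (1 - u) * (box_average (\<lambda>x. h x powr (1 / u)) R powr u * box_average w R powr r)"
    if Ai: "uniform_A_infinity D B w" and h: "\<And>x. 0 \<le> h x" and f: "\<And>x. f x \<le> h x * w x powr r"
      and R: "R \<in> subboxes UNIV B" for B R and w f h :: "('n \<Rightarrow> int) \<Rightarrow> real"
  proof -
    have w: "\<And>x. 0 \<le> w x" using Ai unfolding uniform_A_infinity_def by blast
    have c: "0 < real (card R)" using subboxesD(4)[OF R] by simp
    have "sum f R \<le> (\<Sum>x\<in>R. (h x powr (1 / u)) powr u * (w x * w x powr \<epsilon>) powr (1 - u))"
    proof (rule sum_mono)
      fix x
      have "(w x * w x powr \<epsilon>) = w x powr (1 + \<epsilon>)" using w[of x] by (simp add: powr_add powr_one)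
      then have "(w x * w x powr \<epsilon>) powr (1 - u) = w x powr r"
        by (simp add: powr_powr u4)
      moreover have "(h x powr (1 / u)) powr u = h x" using h[of x] u by (simp add: powr_powr)
      ultimately show "f x \<le> (h x powr (1 / u)) powr u * (w x * w x powr \<epsilon>) powr (1 - u)" using f[of x] by simp
    qed
    also have "\<dots> \<le> (\<Sum>x\<in>R. h x powr (1 / u)) powr u * (\<Sum>x\<in>R. w x * w x powr \<epsilon>) powr (1 - u)"
      using u w subboxesD(2)[OF R] by (intro hoelder_sum2) auto
    also have "\<dots> \<le> (\<Sum>x\<in>R. h x powr (1 / u)) powr u * (C * (sum w R * box_average w R powr \<epsilon>)) powr (1 - u)"
      using u w RH[OF Ai R] by (intro mult_left_mono powr_mono2 sum_nonneg) auto
    also have "(\<Sum>x\<in>R. h x powr (1 / u)) = real (card R) * box_average (\<lambda>x. h x powr (1 / u)) R"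
      using c by (simp add: box_average_def)
    also have "sum w R * box_average w R powr \<epsilon> = real (card R) * box_average w R powr (1 + \<epsilon>)"
    proof -
      have "0 \<le> box_average w R" using w by (simp add: box_average_def sum_nonneg)
      moreover have "sum w R = real (card R) * box_average w R" using c by (simp add: box_average_def)
      ultimately show ?thesis by (simp add: powr_add powr_one)
    qed
    also have "(real (card R) * box_average (\<lambda>x. h x powr (1 / u)) R) powr u * (C * (real (card R) * box_average w R powr (1 + \<epsilon>))) powr (1 - u)
      = (real (card R) powr u * real (card R) powr (1 - u)) * (C powr (1 - u) * (box_average (\<lambda>x. h x powr (1 / u)) R powr u * box_average w R powr r))"
      by (simp add: powr_mult powr_powr u4)
    also have "real (card R) powr u * real (card R) powr (1 - u) = real (card R)"
      using c by (simp flip: powr_add)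
    finally show ?thesis using c by (simp add: box_average_def[of f] field_simps)
  qed
  then show ?thesis unfolding r_def
    using u P by (intro exI[of _ "1 / u"] exI[of _ "C powr (1 - u)"]) (auto simp: field_simps)
qed

section \<open>The discrete theorem\<close>

text \<open>All factors other than the i-th grow from \<open>A\<close> to \<open>R\<close>.
  Combining the lower bound on \<open>A\<close> with the upper bound on \<open>R\<close> therefore
  leaves an inequality between the i-th factors, and the cardinalities cancel up to
  \<open>(1 / l) powr q\<close>.\<close>

lemma uniform_A_infinity_of_product:
  fixes \<tau> :: "'i \<Rightarrow> ('n::finite \<Rightarrow> int) \<Rightarrow> real" and a :: "'i \<Rightarrow> real"
  assumes I: "finite I" "i \<in> I" and a: "\<And>j. j \<in> I \<Longrightarrow> 0 < a j"
    and \<tau>: "\<And>j x. j \<in> I \<Longrightarrow> 0 \<le> \<tau> j x" and B: "finite B" and K: "0 \<le> K" and q: "0 \<le> q"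
    and upper: "\<And>R. R \<in> subboxes UNIV B \<Longrightarrow> (\<Prod>j\<in>I. sum (\<tau> j) R powr a j) \<le> K * real (card R) powr q"
    and lower: "\<And>A. A \<subseteq> B \<Longrightarrow> real (card A) powr q \<le> (\<Prod>j\<in>I. sum (\<tau> j) A powr a j)"
  shows "uniform_A_infinity (\<lambda>l. (K * (1 / l) powr q) powr (1 / a i)) B (\<tau> i)"
  unfolding uniform_A_infinity_def
proof (intro conjI allI ballI impI)
  fix l :: real and R A assume l: "0 < l" and R: "R \<in> subboxes UNIV B" and A: "A \<subseteq> R"
    and lA: "l * real (card R) \<le> real (card A)"
  note R' = subboxesD[OF R]
  have "A \<subseteq> B" using A R' by blast
  have cA: "0 < real (card A)" using lA l R'(4) by (meson less_le_trans mult_pos_pos of_nat_0_less_iff)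
  let ?s = "\<lambda>j X. sum (\<tau> j) X powr a j"
  let ?\<pi> = "\<lambda>X. \<Prod>j\<in>I - {i}. ?s j X"
  have split: "(\<Prod>j\<in>I. ?s j X) = ?s i X * ?\<pi> X" for X
    using I by (rule prod.remove)
  have mono: "?\<pi> A \<le> ?\<pi> R"
    using A R'(2) \<tau> a
    by (intro prod_mono conjI powr_mono2 sum_mono2 sum_nonneg) (auto simp: less_imp_le)
  have "?s i R * real (card A) powr q \<le> ?s i R * (?s i A * ?\<pi> A)"
    using lower[OF \<open>A \<subseteq> B\<close>] unfolding split by (intro mult_left_mono) auto
  also have "\<dots> \<le> ?s i R * (?s i A * ?\<pi> R)"
    using mono by (intro mult_left_mono) auto
  also have "\<dots> = ?s i A * (?s i R * ?\<pi> R)" by simp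
  also have "\<dots> \<le> ?s i A * (K * real (card R) powr q)"
    using upper[OF R] unfolding split by (intro mult_left_mono) auto
  also have "\<dots> \<le> ?s i A * (K * (1 / l * real (card A)) powr q)"
    using lA l K q by (intro mult_left_mono powr_mono2) (auto simp: field_simps)
  also have "\<dots> = (K * (1 / l) powr q * ?s i A) * real (card A) powr q"
    by (simp only: powr_mult mult_ac)
  finally have "?s i R \<le> K * (1 / l) powr q * ?s i A"
    by (rule mult_right_le_imp_le) (use cA in simp)
  then have "(?s i R) powr (1 / a i) \<le> (K * (1 / l) powr q * ?s i A) powr (1 / a i)"
    using a[OF I(2)] by (intro powr_mono2) auto
  moreover have "(?s i X) powr (1 / a i) = sum (\<tau> i) X" for X
    using a[OF I(2)] \<tau>[OF I(2)] by (simp add: powr_powr sum_nonneg)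
  ultimately show "sum (\<tau> i) R \<le> (K * (1 / l) powr q) powr (1 / a i) * sum (\<tau> i) A"
    by (simp only: powr_mult)
qed (use B \<tau>[OF I(2)] in auto)

text \<open>No formula ties \<open>\<nu>\<close> to the \<open>\<sigma> j\<close>, only
  \<open>upper\<close> and \<open>lower\<close> do. Both are stated for sums instead of means: the
  exponents 1 and \<open>p * (1 - 1 / P j)\<close> add up to \<open>m * p\<close>, the power of the
  cardinality on the other side.\<close>

locale discrete_multiple_weight =
  fixes m :: nat and p K :: real and P :: "nat \<Rightarrow> real"
    and B :: "('n::finite \<Rightarrow> int) set" and \<nu> :: "('n \<Rightarrow> int) \<Rightarrow> real"
    and \<sigma> :: "nat \<Rightarrow> ('n \<Rightarrow> int) \<Rightarrow> real"
  assumes p: "0 < p" "1 / p = (\<Sum>j=1..m. 1 / P j)"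
    and P: "\<And>j. j \<in> {1..m} \<Longrightarrow> 1 < P j"
    and K: "0 \<le> K"
    and B: "finite B"
    and \<nu>: "\<And>x. 0 \<le> \<nu> x" and \<sigma>: "\<And>j x. j \<in> {1..m} \<Longrightarrow> 0 \<le> \<sigma> j x"
    and upper: "\<And>R. R \<in> subboxes UNIV B \<Longrightarrow>
      sum \<nu> R * (\<Prod>j=1..m. sum (\<sigma> j) R powr (p * (1 - 1 / P j))) \<le> K * real (card R) powr (m * p)"
    and lower: "\<And>A. A \<subseteq> B \<Longrightarrow>
      real (card A) powr (m * p) \<le> sum \<nu> A * (\<Prod>j=1..m. sum (\<sigma> j) A powr (p * (1 - 1 / P j)))"
begin

lemma exponent_pos: "j \<in> {1..m} \<Longrightarrow> 0 < p * (1 - 1 / P j)"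
  using p P[of j] by simp

lemma sum_exponents: "(\<Sum>j=1..m. p * (1 - 1 / P j)) = m * p - 1"
proof -
  have "(\<Sum>j=1..m. p * (1 - 1 / P j)) = m * p - p * (\<Sum>j=1..m. 1 / P j)"
    by (simp add: algebra_simps sum_subtractf sum_distrib_left)
  then show ?thesis unfolding p(2)[symmetric] using p(1) by simp
qed

text \<open>The index 0 carries \<open>\<nu>\<close> with exponent 1, so that all m + 1 weights are
  covered by one product.\<close>

lemma uniform_A_infinity_weights:
  assumes "i \<in> {0..m}"
  shows "uniform_A_infinity (\<lambda>l. (K * (1 / l) powr (m * p)) powr (1 / (if i = 0 then 1 else p * (1 - 1 / P i)))) B
    (if i = 0 then \<nu> else \<sigma> i)"
proof -
  let ?a = "\<lambda>i. if i = 0 then 1 else p * (1 - 1 / P i)" and ?\<tau> = "\<lambda>i. if i = 0 then \<nu> else \<sigma> i"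
  have I: "{0..m} = insert 0 {1..m}" by auto
  have eq: "(\<Prod>j\<in>{0..m}. sum (?\<tau> j) X powr ?a j) = sum \<nu> X * (\<Prod>j=1..m. sum (\<sigma> j) X powr (p * (1 - 1 / P j)))" for X
    unfolding I using \<nu> by (simp add: sum_nonneg)
  show ?thesis
  proof (rule uniform_A_infinity_of_product[where I = "{0..m}" and a = ?a and \<tau> = ?\<tau>])
    show "0 < ?a j" if "j \<in> {0..m}" for j using that exponent_pos[of j] by auto
    show "0 \<le> ?\<tau> j x" if "j \<in> {0..m}" for j x using that \<nu> \<sigma>[of j] by auto
    show "(\<Prod>j\<in>{0..m}. sum (?\<tau> j) R powr ?a j) \<le> K * real (card R) powr (m * p)"
      if "R \<in> subboxes UNIV B" for R using upper[OF that] unfolding eq .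
    show "real (card A) powr (m * p) \<le> (\<Prod>j\<in>{0..m}. sum (?\<tau> j) A powr ?a j)"
      if "A \<subseteq> B" for A using lower[OF that] unfolding eq .
  qed (use assms B K p in auto)
qed

text \<open>The map \<open>r\<close> linearises the maximal function by naming one box per point. If
  \<open>V (r x) \<ge> t\<close>, then \<open>r x\<close> is at least half covered by selected boxes
  with \<open>V\<close> at least \<open>t\<close>, so the restricted weak type hypothesis bounds
  every level set by the sparse family.\<close>

lemma strong_sum_le_sparse_sum:
  assumes C: "0 \<le> C" and rw: "\<And>E. E \<subseteq> B \<Longrightarrow>
      sum \<nu> (\<Union>{R \<in> subboxes UNIV B. 1/2 * card R \<le> card (R \<inter> E)}) \<le> C * sum \<nu> E"
    and V: "\<And>R. R \<in> subboxes UNIV B \<Longrightarrow> 0 \<le> V R"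
    and r: "\<And>x. x \<in> B \<Longrightarrow> r x \<in> subboxes UNIV B \<and> x \<in> r x"
  obtains S E where "S \<subseteq> subboxes UNIV B"
    and "\<And>R. R \<in> S \<Longrightarrow> E R \<subseteq> R \<and> card R \<le> 2 * card (E R)" and "disjoint_family_on E S"
    and "(\<Sum>x\<in>B. \<nu> x * V (r x) powr p) \<le> 2 * C * (\<Sum>R\<in>S. sum \<nu> R * V R powr p)"
proof -
  let ?F = "subboxes UNIV B"
  have finF: "finite ?F" using finite_subboxes[OF B] .
  have finR: "finite R" if "R \<in> ?F" for R using subboxesD(2)[OF that] .
  obtain S E where S: "S \<subseteq> ?F" "\<forall>R\<in>S. E R \<subseteq> R \<and> card R \<le> 2 * card (E R)" "disjoint_family_on E S"
    "\<forall>R\<in>?F. card R \<le> 2 * card (R \<inter> \<Union>{T\<in>S. V R \<le> V T})"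
  proof -
    have "\<exists>S E. S \<subseteq> ?F \<and> (\<forall>R\<in>S. E R \<subseteq> R \<and> card R \<le> 2 * card (E R)) \<and> disjoint_family_on E S
      \<and> (\<forall>R\<in>?F. card R \<le> 2 * card (R \<inter> \<Union>{T\<in>S. V R \<le> V T}))"
      by (rule sparse_selection[OF finF finR])
    then show thesis by (elim exE conjE) (rule that)
  qed
  have finS: "finite S" using S(1) finF finite_subset by blast
  have \<nu>0: "0 \<le> sum \<nu> X" for X using \<nu> by (simp add: sum_nonneg)
  have level: "sum \<nu> {x \<in> B. t \<le> V (r x)} \<le> C * (\<Sum>T | T \<in> S \<and> t \<le> V T. sum \<nu> T)" for t
  proof -
    let ?E = "\<Union>{T\<in>S. t \<le> V T}"
    have EB: "?E \<subseteq> B" using S(1) subboxesD(1) by blast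
    let ?U = "\<Union>{R \<in> ?F. 1/2 * card R \<le> card (R \<inter> ?E)}"
    have "{x \<in> B. t \<le> V (r x)} \<subseteq> ?U"
    proof
      fix x assume x: "x \<in> {x \<in> B. t \<le> V (r x)}"
      then have rx: "r x \<in> ?F" "x \<in> r x" using r by auto
      have "card (r x) \<le> 2 * card (r x \<inter> \<Union>{T\<in>S. V (r x) \<le> V T})" using S(4) rx by blast
      also have "\<dots> \<le> 2 * card (r x \<inter> ?E)"
        using x subboxesD(2)[OF rx(1)] by (intro mult_le_mono card_mono) auto
      finally have "1/2 * real (card (r x)) \<le> card (r x \<inter> ?E)" by linarith
      then show "x \<in> ?U" using rx by blast
    qed
    moreover have "?U \<subseteq> B" using subboxesD(1) by blast
    then have "finite ?U" by (rule finite_subset[OF _ B])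
    ultimately have "sum \<nu> {x \<in> B. t \<le> V (r x)} \<le> sum \<nu> ?U"
      using \<nu> by (intro sum_mono2) auto
    also have "\<dots> \<le> C * sum \<nu> ?E" by (rule rw[OF EB])
    also have "\<dots> \<le> C * (\<Sum>T | T \<in> S \<and> t \<le> V T. sum \<nu> T)"
    proof (intro mult_left_mono sum_Union_le C \<nu>)
      show "finite I" if "I \<in> {T \<in> S. t \<le> V T}" for I using that S(1) finR by blast
    qed (use finS in simp)
    finally show ?thesis .
  qed
  have half: "V R powr (p/2) * V R powr (p/2) = V R powr p" for R by (simp flip: powr_add)
  \<comment> \<open>The layer-cake lemma requires an exponent above 1, which \<open>p\<close> may
    fail to be; it is applied to \<open>V powr (p/2)\<close> with exponent 2, whence the factor
    \<open>2 / (2 - 1)\<close>.\<close>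
  have "(\<Sum>x\<in>B. \<nu> x * (V (r x) powr (p/2)) powr 2)
      \<le> 2 / (2 - 1) * (\<Sum>R\<in>S. (C * (sum \<nu> R * V R powr (p/2))) * (V R powr (p/2)) powr (2 - 1))"
  proof (rule weak_type_imp_powr_sum_le[OF B finS])
    fix \<alpha> :: real assume \<alpha>: "0 < \<alpha>"
    have iff: "\<alpha> \<le> v powr (p/2) \<longleftrightarrow> \<alpha> powr (2/p) \<le> v" if "0 \<le> v" for v
    proof
      assume "\<alpha> \<le> v powr (p/2)"
      then have "\<alpha> powr (2/p) \<le> (v powr (p/2)) powr (2/p)" using \<alpha> p by (intro powr_mono2) auto
      then show "\<alpha> powr (2/p) \<le> v" using that p by (simp add: powr_powr)
    next
      assume "\<alpha> powr (2/p) \<le> v"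
      then have "(\<alpha> powr (2/p)) powr (p/2) \<le> v powr (p/2)" using \<alpha> p by (intro powr_mono2) auto
      then show "\<alpha> \<le> v powr (p/2)" using \<alpha> p by (simp add: powr_powr)
    qed
    let ?t = "\<alpha> powr (2/p)"
    have 1: "{x. x \<in> B \<and> \<alpha> \<le> V (r x) powr (p/2)} = {x \<in> B. ?t \<le> V (r x)}"
      using iff V r by blast
    have 2: "{R. R \<in> S \<and> \<alpha> \<le> V R powr (p/2)} = {R. R \<in> S \<and> ?t \<le> V R}"
      using iff V S(1) by blast
    have "\<alpha> * sum \<nu> {x \<in> B. ?t \<le> V (r x)} \<le> \<alpha> * (C * (\<Sum>T | T \<in> S \<and> ?t \<le> V T. sum \<nu> T))"
      using level \<alpha> by (intro mult_left_mono) auto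
    also have "\<dots> = (\<Sum>T | T \<in> S \<and> ?t \<le> V T. C * (sum \<nu> T * \<alpha>))"
      by (simp add: sum_distrib_left mult_ac)
    \<comment> \<open>On the index set \<open>\<alpha>\<close> is at most
      \<open>V T powr (p/2)\<close>, so it can be moved into the weights of the sparse sum.\<close>
    also have "\<dots> \<le> (\<Sum>T | T \<in> S \<and> ?t \<le> V T. C * (sum \<nu> T * V T powr (p/2)))"
      using C \<nu>0 2 by (intro sum_mono mult_left_mono) auto
    finally show "\<alpha> * (\<Sum>x | x \<in> B \<and> \<alpha> \<le> V (r x) powr (p/2). \<nu> x)
        \<le> (\<Sum>R | R \<in> S \<and> \<alpha> \<le> V R powr (p/2). C * (sum \<nu> R * V R powr (p/2)))"
      unfolding 1 2 .
  qed (use \<nu> \<nu>0 C in auto)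
  also have "(\<Sum>x\<in>B. \<nu> x * (V (r x) powr (p/2)) powr 2) = (\<Sum>x\<in>B. \<nu> x * V (r x) powr p)"
    by (simp add: powr_powr)
  also have "2 / (2 - 1) * (\<Sum>R\<in>S. (C * (sum \<nu> R * V R powr (p/2))) * (V R powr (p/2)) powr (2 - 1))
      = 2 * C * (\<Sum>R\<in>S. sum \<nu> R * V R powr p)"
    by (simp add: sum_distrib_left mult.assoc half powr_one)
  finally show ?thesis using that[of S E] S(1-3) by blast
qed

text \<open>By the A_P bound, \<open>\<nu>\<close> and the means of the \<open>\<sigma> j\<close>
  combine to at most \<open>K * card R\<close>, hence to \<open>2 * K * card (E R)\<close>. On
  \<open>E R\<close> the means of \<open>h j powr s j\<close> are at most their maximal functions;
  disjointness of the \<open>E R\<close> and Hoelder's inequality with weights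
  \<open>p / P j\<close> leave these in the powers \<open>P j / s j\<close>.\<close>

lemma sparse_sum_le:
  assumes S: "S \<subseteq> subboxes UNIV B"
    and E: "\<And>R. R \<in> S \<Longrightarrow> E R \<subseteq> R \<and> card R \<le> 2 * card (E R)" "disjoint_family_on E S"
    and s: "\<And>j. j \<in> {1..m} \<Longrightarrow> 1 < s j \<and> 0 \<le> C j"
    and h: "\<And>j x. j \<in> {1..m} \<Longrightarrow> 0 \<le> h j x"
    and f: "\<And>j x. j \<in> {1..m} \<Longrightarrow> 0 \<le> f j x"
    and bump: "\<And>j R. j \<in> {1..m} \<Longrightarrow> R \<in> subboxes UNIV B \<Longrightarrow> box_average (f j) R \<le>
      C j * (box_average (\<lambda>x. h j x powr s j) R powr (1 / s j) * box_average (\<sigma> j) R powr (1 - 1 / P j))"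
  shows "(\<Sum>R\<in>S. sum \<nu> R * (\<Prod>j=1..m. box_average (f j) R) powr p)
    \<le> 2 * K * (\<Prod>j=1..m. C j powr p) * (\<Prod>j=1..m. (\<Sum>x\<in>B. box_max UNIV B (\<lambda>x. h j x powr s j) x powr (P j / s j)) powr (p / P j))"
proof -
  define M where "M = (\<lambda>j x. box_max UNIV B (\<lambda>x. h j x powr s j) x)"
  have M0: "0 \<le> M j x" for j x unfolding M_def by (rule box_max_nonneg[OF B]) simp
  let ?c = "\<Prod>j=1..m. C j powr p"
  have c0: "0 \<le> ?c" by (intro prod_nonneg) auto
  have term_le: "sum \<nu> R * (\<Prod>j=1..m. box_average (f j) R) powr p
      \<le> 2 * K * ?c * (\<Sum>x\<in>E R. \<Prod>j=1..m. M j x powr (p / s j))" if R: "R \<in> S" for R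
  proof -
    have RF: "R \<in> subboxes UNIV B" using R S by blast
    have cR: "0 < real (card R)" using subboxesD(4)[OF RF] by simp
    let ?u = "\<lambda>j. box_average (\<lambda>x. h j x powr s j) R" and ?a = "\<lambda>j. box_average (\<sigma> j) R"
    let ?e = "\<lambda>j. p * (1 - 1 / P j)"
    have f0: "0 \<le> box_average (f j) R" if "j \<in> {1..m}" for j
      using f[OF that] by (simp add: box_average_def sum_nonneg)
    have A: "sum \<nu> R * (\<Prod>j=1..m. ?a j powr ?e j) \<le> K * real (card R)"
    proof -
      have "(\<Prod>j=1..m. ?a j powr ?e j) = (\<Prod>j=1..m. sum (\<sigma> j) R powr ?e j) / (\<Prod>j=1..m. real (card R) powr ?e j)"
        unfolding box_average_def by (simp add: powr_divide prod_dividef)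
      also have "(\<Prod>j=1..m. real (card R) powr ?e j) = real (card R) powr (m * p - 1)"
        using powr_sum[of "real (card R)" ?e "{1..m}"] cR unfolding sum_exponents by simp
      finally have "sum \<nu> R * (\<Prod>j=1..m. ?a j powr ?e j)
          = sum \<nu> R * (\<Prod>j=1..m. sum (\<sigma> j) R powr ?e j) / real (card R) powr (m * p - 1)" by simp
      also have "\<dots> \<le> K * real (card R) powr (m * p) / real (card R) powr (m * p - 1)"
        using upper[OF RF] by (intro divide_right_mono) auto
      also have "\<dots> = K * real (card R)" using cR by (simp add: powr_diff)
      finally show ?thesis .
    qed
    have "(\<Prod>j=1..m. box_average (f j) R) powr p
        = (\<Prod>j=1..m. box_average (f j) R powr p)"
      by (induction m) (auto simp: powr_mult)
    also have "\<dots> \<le> (\<Prod>j=1..m. C j powr p * (?u j powr (p / s j) * ?a j powr ?e j))"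
    proof (rule prod_mono)
      fix j assume j: "j \<in> {1..m}"
      have "box_average (f j) R powr p \<le> (C j * (?u j powr (1 / s j) * ?a j powr (1 - 1 / P j))) powr p"
        using bump[OF j RF] f0[OF j] p by (intro powr_mono2) auto
      also have "\<dots> = C j powr p * (?u j powr (p / s j) * ?a j powr ?e j)"
        by (simp add: powr_mult powr_powr mult.commute)
      finally show "0 \<le> box_average (f j) R powr p \<and> box_average (f j) R powr p \<le> C j powr p * (?u j powr (p / s j) * ?a j powr ?e j)"
        by simp
    qed
    also have "\<dots> = ?c * (\<Prod>j=1..m. ?u j powr (p / s j)) * (\<Prod>j=1..m. ?a j powr ?e j)"
      by (simp add: prod.distrib mult.assoc)
    finally have "sum \<nu> R * (\<Prod>j=1..m. box_average (f j) R) powr p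
        \<le> sum \<nu> R * (?c * (\<Prod>j=1..m. ?u j powr (p / s j)) * (\<Prod>j=1..m. ?a j powr ?e j))"
      using \<nu> by (intro mult_left_mono sum_nonneg) auto
    also have "\<dots> = ?c * (\<Prod>j=1..m. ?u j powr (p / s j)) * (sum \<nu> R * (\<Prod>j=1..m. ?a j powr ?e j))"
      by (simp add: mult_ac)
    also have "\<dots> \<le> ?c * (\<Prod>j=1..m. ?u j powr (p / s j)) * (K * (2 * real (card (E R))))"
    proof (rule mult_left_mono)
      have "K * real (card R) \<le> K * (2 * real (card (E R)))" using E(1)[OF R] K by (intro mult_left_mono) auto
      with A show "sum \<nu> R * (\<Prod>j=1..m. ?a j powr ?e j) \<le> K * (2 * real (card (E R)))" by linarith
    qed (use c0 in \<open>auto intro!: mult_nonneg_nonneg prod_nonneg\<close>)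
    also have "\<dots> = 2 * K * ?c * (\<Sum>x\<in>E R. \<Prod>j=1..m. ?u j powr (p / s j))" by simp
    also have "\<dots> \<le> 2 * K * ?c * (\<Sum>x\<in>E R. \<Prod>j=1..m. M j x powr (p / s j))"
    proof (intro mult_left_mono sum_mono prod_mono conjI)
      fix x j assume x: "x \<in> E R" and j: "j \<in> {1..m}"
      have "?u j \<le> M j x" unfolding M_def by (rule box_max_ge[OF B RF]) (use x E(1)[OF R] in auto)
      moreover have "0 \<le> ?u j" by (simp add: box_average_def sum_nonneg)
      ultimately show "?u j powr (p / s j) \<le> M j x powr (p / s j)"
        using p s[OF j] by (intro powr_mono2) auto
    qed (use K c0 in auto)
    finally show ?thesis .
  qed
  have finS: "finite S" using S finite_subboxes[OF B] finite_subset by blast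
  have EB: "E R \<subseteq> B" if "R \<in> S" for R using that E(1) S subboxesD(1) by blast
  have "(\<Sum>R\<in>S. sum \<nu> R * (\<Prod>j=1..m. box_average (f j) R) powr p)
      \<le> (\<Sum>R\<in>S. 2 * K * ?c * (\<Sum>x\<in>E R. \<Prod>j=1..m. M j x powr (p / s j)))"
    by (intro sum_mono term_le)
  also have "\<dots> = 2 * K * ?c * (\<Sum>x\<in>(\<Union>R\<in>S. E R). \<Prod>j=1..m. M j x powr (p / s j))"
    unfolding sum_distrib_left[symmetric]
    using finS E(2) EB finite_subset[OF _ B] by (subst sum.UNION_disjoint) (auto simp: disjoint_family_on_def)
  also have "\<dots> \<le> 2 * K * ?c * (\<Sum>x\<in>B. \<Prod>j=1..m. M j x powr (p / s j))"
    using B EB K c0 by (intro mult_left_mono sum_mono2 prod_nonneg) auto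
  also have "(\<Sum>x\<in>B. \<Prod>j=1..m. M j x powr (p / s j)) = (\<Sum>x\<in>B. \<Prod>j=1..m. (M j x powr (P j / s j)) powr (p / P j))"
  proof (intro sum.cong prod.cong refl)
    fix x j assume j: "j \<in> {1..m}"
    show "M j x powr (p / s j) = (M j x powr (P j / s j)) powr (p / P j)"
      using P[OF j] by (simp add: powr_powr)
  qed
  also have "\<dots> \<le> (\<Prod>j=1..m. (\<Sum>x\<in>B. M j x powr (P j / s j)) powr (p / P j))"
  proof (rule hoelder_sum)
    have "(\<Sum>j=1..m. p / P j) = p * (\<Sum>j=1..m. 1 / P j)" by (simp add: sum_distrib_left)
    then show "(\<Sum>j=1..m. p / P j) = 1"
      unfolding p(2)[symmetric] using p(1) by simp
    show "0 < p / P j" if "j \<in> {1..m}" for j using p P[OF that] by simp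
  qed (use B in auto)
  finally show ?thesis unfolding M_def using K c0 by (auto intro: mult_left_mono)
qed

end

text \<open>The order of the quantifiers matters: \<open>C\<close> is found before \<open>B\<close>
  and the weights, from moduli that are functions of \<open>K\<close>, \<open>m\<close>,
  \<open>p\<close> and \<open>P\<close>. The function \<open>h j\<close> stands for
  \<open>f j\<close> divided by a power of \<open>\<sigma> j\<close>, stated as a bound so that
  zeros of \<open>\<sigma> j\<close> cause no division.\<close>

theorem discrete_strong_maximal_bound:
  fixes m :: nat and p K :: real and P :: "nat \<Rightarrow> real"
  assumes P: "\<And>j. j \<in> {1..m} \<Longrightarrow> 1 < P j"
  shows "\<exists>C\<ge>0. \<forall>(B :: ('n::finite \<Rightarrow> int) set) \<nu> \<sigma> f h r.
    discrete_multiple_weight m p K P B \<nu> \<sigma> \<longrightarrow>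
    (\<forall>j\<in>{1..m}. \<forall>x. 0 \<le> f j x \<and> 0 \<le> h j x \<and> f j x \<le> h j x * \<sigma> j x powr (1 - 1 / P j)) \<longrightarrow>
    (\<forall>x\<in>B. r x \<in> subboxes UNIV B \<and> x \<in> r x) \<longrightarrow>
    (\<Sum>x\<in>B. \<nu> x * (\<Prod>j=1..m. box_average (f j) (r x)) powr p)
      \<le> C * (\<Prod>j=1..m. (\<Sum>x\<in>B. h j x powr P j) powr (p / P j))"
proof -
  define D\<nu> where "D\<nu> = (\<lambda>l. (K * (1 / l) powr (m * p)) powr 1)"
  define D\<sigma> where "D\<sigma> = (\<lambda>i l. (K * (1 / l) powr (m * p)) powr (1 / (p * (1 - 1 / P i))))"
  have "\<exists>C\<ge>0. \<forall>B w E. uniform_A_infinity D\<nu> B w \<longrightarrow> E \<subseteq> B \<longrightarrow>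
    sum w (\<Union>{R \<in> subboxes (UNIV :: 'n set) B. 1/2 * card R \<le> card (R \<inter> E)}) \<le> C * sum w E"
    by (rule uniform_A_infinity_restricted_weak_type) auto
  then obtain C0 where C0: "0 \<le> C0" "\<forall>B w E. uniform_A_infinity D\<nu> B w \<longrightarrow> E \<subseteq> B \<longrightarrow>
    sum w (\<Union>{R \<in> subboxes (UNIV :: 'n set) B. 1/2 * card R \<le> card (R \<inter> E)}) \<le> C0 * sum w E"
    by (elim exE conjE)
  have "\<forall>j\<in>{1..m}. \<exists>s C. 1 < s \<and> s < P j \<and> 0 \<le> C \<and> (\<forall>B (w :: ('n \<Rightarrow> int) \<Rightarrow> real) f h. uniform_A_infinity (D\<sigma> j) B w \<longrightarrow>
    (\<forall>x. 0 \<le> h x) \<longrightarrow> (\<forall>x. f x \<le> h x * w x powr (1 - 1 / P j)) \<longrightarrow>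
    (\<forall>R\<in>subboxes UNIV B. box_average f R \<le>
       C * (box_average (\<lambda>x. h x powr s) R powr (1 / s) * box_average w R powr (1 - 1 / P j))))"
    using box_average_bump[OF P] by blast
  then obtain s C where sC: "\<forall>j\<in>{1..m}. 1 < s j \<and> s j < P j \<and> 0 \<le> C j \<and> (\<forall>B (w :: ('n \<Rightarrow> int) \<Rightarrow> real) f h. uniform_A_infinity (D\<sigma> j) B w \<longrightarrow>
    (\<forall>x. 0 \<le> h x) \<longrightarrow> (\<forall>x. f x \<le> h x * w x powr (1 - 1 / P j)) \<longrightarrow>
    (\<forall>R\<in>subboxes UNIV B. box_average f R \<le>
       C j * (box_average (\<lambda>x. h x powr s j) R powr (1 / s j) * box_average w R powr (1 - 1 / P j))))"
    unfolding bchoice_iff by (elim exE)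
  have sC1: "1 < s j" "s j < P j" "0 \<le> C j" if "j \<in> {1..m}" for j
    using sC[rule_format, OF that] by auto
  \<comment> \<open>The bump gave \<open>s j < P j\<close>; hence \<open>P j / s j\<close> exceeds
    1, as the unweighted theorem demands.\<close>
  have cm: "\<forall>j\<in>{1..m}. \<exists>C\<ge>0. \<forall>B h. finite B \<longrightarrow> (\<forall>x. 0 \<le> h x) \<longrightarrow>
    (\<Sum>x\<in>B. box_max (UNIV :: 'n set) B h x powr (P j / s j)) \<le> C * (\<Sum>x\<in>B. h x powr (P j / s j))"
  proof (intro ballI strong_maximal_discrete)
    show "1 < P j / s j" if "j \<in> {1..m}" for j using sC1(1,2)[OF that] by simp
  qed simp
  obtain Cm where Cm: "\<forall>j\<in>{1..m}. 0 \<le> Cm j \<and> (\<forall>B h. finite B \<longrightarrow> (\<forall>x. 0 \<le> h x) \<longrightarrow>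
    (\<Sum>x\<in>B. box_max (UNIV :: 'n set) B h x powr (P j / s j)) \<le> Cm j * (\<Sum>x\<in>B. h x powr (P j / s j)))"
    using bchoice[OF cm] by (elim exE)
  \<comment> \<open>The absolute value of \<open>K\<close> serves because \<open>0 \<le> K\<close>
    is known only once a discrete weight is given.\<close>
  define Ct where "Ct = 2 * C0 * (2 * \<bar>K\<bar> * (\<Prod>j=1..m. C j powr p) * (\<Prod>j=1..m. Cm j powr (p / P j)))"
  have "(\<Sum>x\<in>B. \<nu> x * (\<Prod>j=1..m. box_average (f j) (r x)) powr p)
      \<le> Ct * (\<Prod>j=1..m. (\<Sum>x\<in>B. h j x powr P j) powr (p / P j))"
    if dw: "discrete_multiple_weight m p K P B \<nu> \<sigma>"
      and fh: "\<And>j x. j \<in> {1..m} \<Longrightarrow> 0 \<le> f j x \<and> 0 \<le> h j x \<and> f j x \<le> h j x * \<sigma> j x powr (1 - 1 / P j)"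
      and r: "\<And>x. x \<in> B \<Longrightarrow> r x \<in> subboxes UNIV B \<and> x \<in> r x"
    for B :: "('n \<Rightarrow> int) set" and \<nu> \<sigma> f h r
  proof -
    interpret discrete_multiple_weight m p K P B \<nu> \<sigma> by (rule dw)
    have bump: "box_average (f j) R \<le>
        C j * (box_average (\<lambda>x. h j x powr s j) R powr (1 / s j) * box_average (\<sigma> j) R powr (1 - 1 / P j))"
      if j: "j \<in> {1..m}" and R: "R \<in> subboxes UNIV B" for j R
    proof -
      have "uniform_A_infinity (D\<sigma> j) B (\<sigma> j)"
        using uniform_A_infinity_weights[of j] j unfolding D\<sigma>_def by simp
      then show ?thesis using sC[rule_format, OF j] fh[OF j] R by blast
    qed
    have V0: "0 \<le> (\<Prod>j=1..m. box_average (f j) R)" for R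
      using fh by (intro prod_nonneg) (auto simp: box_average_def intro!: divide_nonneg_nonneg sum_nonneg)
    have rw: "sum \<nu> (\<Union>{R \<in> subboxes UNIV B. 1/2 * card R \<le> card (R \<inter> E)}) \<le> C0 * sum \<nu> E" if "E \<subseteq> B" for E
    proof -
      have "uniform_A_infinity D\<nu> B \<nu>"
        using uniform_A_infinity_weights[of 0] unfolding D\<nu>_def by simp
      then show ?thesis by (rule C0(2)[rule_format, OF _ that])
    qed
    obtain S E where SE: "S \<subseteq> subboxes UNIV B"
      "\<And>R. R \<in> S \<Longrightarrow> E R \<subseteq> R \<and> card R \<le> 2 * card (E R)" "disjoint_family_on E S"
      and le: "(\<Sum>x\<in>B. \<nu> x * (\<Prod>j=1..m. box_average (f j) (r x)) powr p)
        \<le> 2 * C0 * (\<Sum>R\<in>S. sum \<nu> R * (\<Prod>j=1..m. box_average (f j) R) powr p)"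
      by (rule strong_sum_le_sparse_sum[of C0 "\<lambda>R. \<Prod>j=1..m. box_average (f j) R" r, OF C0(1) rw V0 r]) (assumption | blast intro: that)+
    note le
    also have "2 * C0 * (\<Sum>R\<in>S. sum \<nu> R * (\<Prod>j=1..m. box_average (f j) R) powr p)
        \<le> 2 * C0 * (2 * K * (\<Prod>j=1..m. C j powr p) * (\<Prod>j=1..m. (\<Sum>x\<in>B. box_max UNIV B (\<lambda>x. h j x powr s j) x powr (P j / s j)) powr (p / P j)))"
      using C0(1) sC1 fh by (intro mult_left_mono sparse_sum_le[OF SE _ _ _ bump]) auto
    also have "\<dots> \<le> 2 * C0 * (2 * K * (\<Prod>j=1..m. C j powr p) * (\<Prod>j=1..m. Cm j powr (p / P j) * (\<Sum>x\<in>B. h j x powr P j) powr (p / P j)))"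
    proof (intro mult_left_mono prod_mono conjI)
      fix j assume j: "j \<in> {1..m}"
      have "(\<Sum>x\<in>B. box_max UNIV B (\<lambda>x. h j x powr s j) x powr (P j / s j))
          \<le> Cm j * (\<Sum>x\<in>B. (h j x powr s j) powr (P j / s j))"
        using Cm j B by auto
      also have "\<dots> = Cm j * (\<Sum>x\<in>B. h j x powr P j)"
        using sC1[OF j] by (simp add: powr_powr)
      finally have "(\<Sum>x\<in>B. box_max UNIV B (\<lambda>x. h j x powr s j) x powr (P j / s j)) powr (p / P j)
          \<le> (Cm j * (\<Sum>x\<in>B. h j x powr P j)) powr (p / P j)"
        using p P[OF j] by (intro powr_mono2) (auto intro: sum_nonneg)
      then show "(\<Sum>x\<in>B. box_max UNIV B (\<lambda>x. h j x powr s j) x powr (P j / s j)) powr (p / P j)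
          \<le> Cm j powr (p / P j) * (\<Sum>x\<in>B. h j x powr P j) powr (p / P j)"
        by (simp only: powr_mult)
    qed (use K C0(1) in \<open>auto intro!: mult_nonneg_nonneg prod_nonneg\<close>)
    also have "\<dots> = Ct * (\<Prod>j=1..m. (\<Sum>x\<in>B. h j x powr P j) powr (p / P j))"
      using K unfolding Ct_def prod.distrib by (simp add: mult_ac)
    finally show ?thesis .
  qed
  moreover have "0 \<le> Ct" unfolding Ct_def using C0(1) by (auto intro!: mult_nonneg_nonneg prod_nonneg)
  ultimately show ?thesis by (intro exI[of _ Ct]) blast
qed

section \<open>Extended powers\<close>

lemma epowr_ennreal: "0 < x \<or> 0 \<le> x \<and> 0 < a \<Longrightarrow> ennreal x epowr a = ennreal (x powr a)"
  by (auto simp: ennpowr_def)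

lemma epowr_0_left [simp]: "0 < a \<Longrightarrow> 0 epowr a = 0"
  and epowr_top_left [simp]: "0 < a \<Longrightarrow> top epowr a = top"
  by (auto simp: ennpowr_def)

lemma epowr_1_right [simp]: "x epowr 1 = x"
  by (cases x) (auto simp: ennpowr_def)

lemma epowr_mono:
  assumes "0 < a" "x \<le> y"
  shows "x epowr a \<le> y epowr a"
proof (cases y)
  case (real s)
  then obtain r where "x = ennreal r" "0 \<le> r" using assms(2) by (cases x) (auto simp: top_unique)
  then show ?thesis using real assms by (auto simp: epowr_ennreal intro!: powr_mono2)
qed (use assms in simp)

lemma epowr_epowr: "0 < a \<Longrightarrow> 0 < b \<Longrightarrow> (x epowr a) epowr b = x epowr (a * b)"
  by (cases x) (auto simp: epowr_ennreal powr_powr)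

lemma epowr_eq_0_iff: "0 < a \<Longrightarrow> x epowr a = 0 \<longleftrightarrow> x = 0"
  by (cases x) (auto simp: epowr_ennreal ennreal_eq_0_iff)

lemma epowr_eq_top_iff: "0 < a \<Longrightarrow> x epowr a = top \<longleftrightarrow> x = top"
  by (auto simp: ennpowr_def)

text \<open>Positive powers fix 0 and \<infinity>, so the identity is compatible with 0 *
  \<infinity> = 0; a negative power exchanges the two values and would break it.\<close>

lemma epowr_mult:
  assumes "0 < a"
  shows "(x * y) epowr a = x epowr a * y epowr a"
proof (cases "x = top \<or> y = top")
  case True
  then show ?thesis
    using assms epowr_eq_0_iff[OF assms, of x] epowr_eq_0_iff[OF assms, of y]
    by (cases "x = 0"; cases "y = 0") (auto simp: ennreal_mult_eq_top_iff ennreal_top_mult ennreal_mult_top)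
next
  case False
  then obtain r s where "x = ennreal r" "0 \<le> r" "y = ennreal s" "0 \<le> s" by (cases x; cases y) auto
  then show ?thesis using assms by (simp add: ennreal_mult[symmetric] epowr_ennreal powr_mult)
qed

lemma epowr_1_left [simp]: "1 epowr a = 1"
  using epowr_ennreal[of 1 a] by simp

lemma epowr_prod: "0 < a \<Longrightarrow> (\<Prod>i\<in>I. f i) epowr a = (\<Prod>i\<in>I. f i epowr a)"
  by (induction I rule: infinite_finite_induct) (auto simp: epowr_mult)

lemma epowr_add: "0 < a \<Longrightarrow> 0 < b \<Longrightarrow> x epowr (a + b) = x epowr a * x epowr b"
  by (cases x) (auto simp: epowr_ennreal powr_add ennreal_mult)

lemma prod_epowr:
  assumes "finite I" "I \<noteq> {}" "\<And>i. i \<in> I \<Longrightarrow> 0 < a i"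
  shows "(\<Prod>i\<in>I. x epowr a i) = x epowr (\<Sum>i\<in>I. a i)"
  using assms
proof (induction I rule: finite_ne_induct)
  case (insert i I)
  then show ?case by (simp add: epowr_add sum_pos)
qed simp

lemma epowr_measurable [measurable]:
  assumes [measurable]: "f \<in> borel_measurable M"
  shows "(\<lambda>x. f x epowr a) \<in> borel_measurable M"
  unfolding ennpowr_def by measurable

text \<open>A positive power is an increasing bijection whose inverse is the power
  \<open>1 / a\<close>, so it commutes with suprema.\<close>

lemma SUP_epowr:
  assumes "0 < a" "I \<noteq> {}"
  shows "(SUP k\<in>I. f k) epowr a = (SUP k\<in>I. f k epowr a)"
proof (rule antisym)
  have "f k \<le> (SUP k\<in>I. f k epowr a) epowr (1 / a)" if "k \<in> I" for k
  proof -
    have "(f k epowr a) epowr (1 / a) \<le> (SUP k\<in>I. f k epowr a) epowr (1 / a)"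
      using assms that by (intro epowr_mono SUP_upper) auto
    then show ?thesis using assms by (simp add: epowr_epowr)
  qed
  then have "(SUP k\<in>I. f k) epowr a \<le> ((SUP k\<in>I. f k epowr a) epowr (1 / a)) epowr a"
    using assms by (intro epowr_mono SUP_least) auto
  then show "(SUP k\<in>I. f k) epowr a \<le> (SUP k\<in>I. f k epowr a)"
    using assms by (simp add: epowr_epowr)
  show "(SUP k\<in>I. f k epowr a) \<le> (SUP k\<in>I. f k) epowr a"
    using assms by (intro SUP_least epowr_mono SUP_upper) auto
qed

lemma SUP_mult_incseq:
  fixes f g :: "nat \<Rightarrow> ennreal"
  assumes "incseq f" "incseq g"
  shows "(SUP k. f k) * (SUP k. g k) = (SUP k. f k * g k)"
proof (rule antisym)
  have "f i * g j \<le> (SUP k. f k * g k)" for i j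
    using assms by (intro SUP_upper2[of "max i j"] mult_mono) (auto simp: incseq_def)
  then show "(SUP k. f k) * (SUP k. g k) \<le> (SUP k. f k * g k)"
    unfolding SUP_mult_left_ennreal SUP_mult_right_ennreal by (intro SUP_least)
  show "(SUP k. f k * g k) \<le> (SUP k. f k) * (SUP k. g k)"
    by (intro SUP_least mult_mono SUP_upper) auto
qed

lemma prod_mono_ennreal:
  fixes f g :: "'i \<Rightarrow> ennreal"
  shows "(\<And>i. i \<in> I \<Longrightarrow> f i \<le> g i) \<Longrightarrow> prod f I \<le> prod g I"
  by (induction I rule: infinite_finite_induct) (auto intro: mult_mono)

lemma SUP_prod_incseq:
  fixes f :: "'i \<Rightarrow> nat \<Rightarrow> ennreal"
  assumes "\<And>i. i \<in> I \<Longrightarrow> incseq (f i)"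
  shows "(\<Prod>i\<in>I. SUP k. f i k) = (SUP k. \<Prod>i\<in>I. f i k)"
  using assms
proof (induction I rule: infinite_finite_induct)
  case (insert i I)
  then have "incseq (\<lambda>k. \<Prod>i\<in>I. f i k)" by (auto simp: incseq_def intro!: prod_mono_ennreal)
  then show ?case using insert by (simp add: SUP_mult_incseq)
qed auto

lemma weighted_arith_geo_mean_ennreal:
  fixes g :: "'i \<Rightarrow> ennreal"
  assumes I: "finite I" and \<theta>: "\<And>i. i \<in> I \<Longrightarrow> 0 < \<theta> i" "sum \<theta> I = 1"
  shows "(\<Prod>i\<in>I. g i epowr \<theta> i) \<le> (\<Sum>i\<in>I. ennreal (\<theta> i) * g i)"
proof (cases "\<exists>i\<in>I. g i = top")
  case True
  then obtain i where i: "i \<in> I" "g i = top" by auto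
  then have "ennreal (\<theta> i) * g i = top" using \<theta>(1)[OF i(1)] by (simp add: ennreal_mult_eq_top_iff)
  then have "(\<Sum>i\<in>I. ennreal (\<theta> i) * g i) = top"
    unfolding ennreal_sum_eq_top[OF I] using i(1) by blast
  then show ?thesis by simp
next
  case False
  define r where "r = (\<lambda>i. enn2real (g i))"
  have r: "g i = ennreal (r i) \<and> 0 \<le> r i" if "i \<in> I" for i
    using False that by (auto simp: r_def less_top)
  have "(\<Prod>i\<in>I. g i epowr \<theta> i) = (\<Prod>i\<in>I. ennreal (r i powr \<theta> i))"
    using r \<theta>(1) by (intro prod.cong) (auto simp: epowr_ennreal)
  also have "\<dots> = ennreal (\<Prod>i\<in>I. r i powr \<theta> i)" by (simp add: prod_ennreal)
  also have "\<dots> \<le> ennreal (\<Sum>i\<in>I. \<theta> i * r i)"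
    using I \<theta> r by (intro ennreal_leI weighted_arith_geo_mean) auto
  also have "\<dots> = (\<Sum>i\<in>I. ennreal (\<theta> i) * g i)"
    using r \<theta>(1) by (subst sum_ennreal[symmetric]) (auto simp: ennreal_mult less_imp_le intro!: sum.cong)
  finally show ?thesis .
qed

text \<open>Normalising needs integrals different from 0 and \<infinity>. A zero integral makes the
  left side 0; an infinite one makes the right side \<infinity> once zero integrals have been
  excluded, hence the order of the cases.\<close>

lemma nn_integral_hoelder:
  fixes g :: "'i \<Rightarrow> 'a \<Rightarrow> ennreal"
  assumes I: "finite I" and \<theta>: "\<And>i. i \<in> I \<Longrightarrow> 0 < \<theta> i" "sum \<theta> I = 1"
    and g [measurable]: "\<And>i. i \<in> I \<Longrightarrow> g i \<in> borel_measurable M"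
  shows "(\<integral>\<^sup>+x. (\<Prod>i\<in>I. g i x epowr \<theta> i) \<partial>M) \<le> (\<Prod>i\<in>I. (\<integral>\<^sup>+x. g i x \<partial>M) epowr \<theta> i)"
proof -
  let ?G = "\<lambda>i. \<integral>\<^sup>+x. g i x \<partial>M"
  consider (zero) i where "i \<in> I" "?G i = 0"
    | (top) i where "i \<in> I" "?G i = top" "\<forall>i\<in>I. ?G i \<noteq> 0"
    | (fin) "\<forall>i\<in>I. ?G i \<noteq> 0 \<and> ?G i \<noteq> top" by auto
  then show ?thesis
  proof cases
    case zero
    then have "AE x in M. g i x = 0" by (subst (asm) nn_integral_0_iff_AE) auto
    then have "AE x in M. (\<Prod>i\<in>I. g i x epowr \<theta> i) = 0"
      by eventually_elim (use I zero(1) \<theta>(1) in \<open>auto intro!: prod_zero bexI[of _ i]\<close>)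
    then have "(\<integral>\<^sup>+x. (\<Prod>i\<in>I. g i x epowr \<theta> i) \<partial>M) = (\<integral>\<^sup>+x. 0 \<partial>M)"
      by (rule nn_integral_cong_AE)
    then show ?thesis by simp
  next
    case top
    have "(\<Prod>j\<in>I. ?G j epowr \<theta> j) = ?G i epowr \<theta> i * (\<Prod>j\<in>I - {i}. ?G j epowr \<theta> j)"
      using I top(1) by (rule prod.remove)
    moreover have "(\<Prod>j\<in>I - {i}. ?G j epowr \<theta> j) \<noteq> 0"
      using I top(3) \<theta>(1) by (auto simp: epowr_eq_0_iff)
    ultimately have "(\<Prod>j\<in>I. ?G j epowr \<theta> j) = top"
      using top \<theta>(1) by (auto simp: ennreal_top_mult)
    then show ?thesis by simp
  next
    case fin
    let ?c = "\<Prod>i\<in>I. ?G i epowr \<theta> i"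
    have "(\<Prod>i\<in>I. g i x epowr \<theta> i) \<le> ?c * (\<Sum>i\<in>I. ennreal (\<theta> i) * (g i x / ?G i))" for x
    proof -
      have "(\<Prod>i\<in>I. g i x epowr \<theta> i) = (\<Prod>i\<in>I. ?G i epowr \<theta> i * (g i x / ?G i) epowr \<theta> i)"
      proof (rule prod.cong[OF refl])
        fix i assume i: "i \<in> I"
        have "g i x = ?G i * (g i x / ?G i)"
          using fin i by (simp add: ennreal_times_divide ennreal_mult_divide_eq mult.commute)
        then show "g i x epowr \<theta> i = ?G i epowr \<theta> i * (g i x / ?G i) epowr \<theta> i"
          using epowr_mult[OF \<theta>(1)[OF i]] by metis
      qed
      also have "\<dots> = ?c * (\<Prod>i\<in>I. (g i x / ?G i) epowr \<theta> i)" by (rule prod.distrib)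
      also have "\<dots> \<le> ?c * (\<Sum>i\<in>I. ennreal (\<theta> i) * (g i x / ?G i))"
        using I \<theta> by (intro mult_left_mono weighted_arith_geo_mean_ennreal) auto
      finally show ?thesis .
    qed
    then have "(\<integral>\<^sup>+x. (\<Prod>i\<in>I. g i x epowr \<theta> i) \<partial>M)
        \<le> (\<integral>\<^sup>+x. ?c * (\<Sum>i\<in>I. ennreal (\<theta> i) * (g i x / ?G i)) \<partial>M)"
      by (rule nn_integral_mono)
    also have "\<dots> = ?c * (\<Sum>i\<in>I. ennreal (\<theta> i) * (?G i / ?G i))"
      by (simp add: nn_integral_cmult nn_integral_sum nn_integral_divide)
    also have "(\<Sum>i\<in>I. ennreal (\<theta> i) * (?G i / ?G i)) = (\<Sum>i\<in>I. ennreal (\<theta> i))"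
      using fin by (intro sum.cong) (auto simp: ennreal_divide_self less_top)
    also have "\<dots> = 1" using \<theta> by (subst sum_ennreal) (auto simp: less_imp_le)
    finally show ?thesis by simp
  qed
qed

section \<open>Conjugate exponents, rectangles and regularised weights\<close>

lemma conj_exponent_gt_0: "1 < q \<Longrightarrow> 0 < conj_exponent q"
  by (simp add: conj_exponent_def)

lemma inverse_conj_exponent: "1 < q \<Longrightarrow> 1 / conj_exponent q = 1 - 1 / q"
  using conj_exponent[of q] by simp

lemma one_minus_conj_exponent: "1 < q \<Longrightarrow> 1 - conj_exponent q = - (1 / (q - 1))"
  by (simp add: conj_exponent_def field_simps)

lemma emeasure_open_rectangle:
  assumes "R \<in> open_rectangles"
  shows "emeasure lebesgue R \<noteq> 0" "emeasure lebesgue R \<noteq> \<infinity>" "R \<in> sets lebesgue" "open R" "bounded R"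
proof -
  from assms obtain a b where R: "R = box a b" "\<forall>k. a $ k < b $ k" by (auto simp: open_rectangles_def)
  show "R \<in> sets lebesgue" "open R" "bounded R" using R(1) by auto
  have "R \<noteq> {}" using R by (auto simp: interval_ne_empty_cart)
  then have "\<not> negligible R" using \<open>open R\<close> open_not_negligible by blast
  then show "emeasure lebesgue R \<noteq> 0"
    using \<open>R \<in> sets lebesgue\<close> by (auto simp: negligible_iff_null_sets null_sets_def)
  show "emeasure lebesgue R \<noteq> \<infinity>"
    using \<open>bounded R\<close> \<open>R \<in> sets lebesgue\<close> R(1) by (simp add: emeasure_lborel_box_eq)
qed

lemma harmonic_exponent:
  fixes P :: "nat \<Rightarrow> real"
  assumes m: "1 \<le> m" and P: "\<And>j. j \<in> {1..m} \<Longrightarrow> 1 < P j" and p: "1 / p = (\<Sum>j=1..m. 1 / P j)"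
  shows "0 < p" "(\<Sum>j=1..m. p / P j) = 1"
proof -
  have "0 < (\<Sum>j=1..m. 1 / P j)" using m P by (intro sum_pos) (auto intro: less_trans[OF zero_less_one])
  then show "0 < p" unfolding p[symmetric] by simp
  have "(\<Sum>j=1..m. p / P j) = p * (\<Sum>j=1..m. 1 / P j)" by (simp add: sum_distrib_left)
  then show "(\<Sum>j=1..m. p / P j) = 1" unfolding p[symmetric] using \<open>0 < p\<close> by simp
qed

text \<open>A countable exhaustion of the space by open rectangles; \<open>Suc k\<close> keeps the
  cube nonempty for k = 0.\<close>

definition centered_cube :: "nat \<Rightarrow> (real ^ 'n) set" where
  "centered_cube k = box (\<chi> i. - real (Suc k)) (\<chi> i. real (Suc k))"

lemma mem_centered_cube: "x \<in> centered_cube k \<longleftrightarrow> (\<forall>i. - real (Suc k) < x $ i \<and> x $ i < real (Suc k))"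
  unfolding centered_cube_def mem_box_cart vec_lambda_beta ..

lemma centered_cube_open_rectangle: "centered_cube k \<in> open_rectangles"
  unfolding centered_cube_def open_rectangles_def mem_Collect_eq by (intro exI conjI, rule refl) simp

lemma centered_cubeI:
  assumes "norm x < real (Suc k)"
  shows "x \<in> centered_cube k"
proof -
  have "- real (Suc k) < x $ i \<and> x $ i < real (Suc k)" for i
    using component_le_norm_cart[of x i] assms by auto
  then show ?thesis unfolding mem_centered_cube by blast
qed

lemma centered_cube_mono:
  assumes "k \<le> l"
  shows "centered_cube k \<subseteq> centered_cube l"
proof
  fix x :: "real ^ 'n" assume x: "x \<in> centered_cube k"
  have "real (Suc k) \<le> real (Suc l)" using assms by simp
  then have "- real (Suc l) < x $ i \<and> x $ i < real (Suc l)" for i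
    using x[unfolded mem_centered_cube, rule_format, of i] by linarith
  then show "x \<in> centered_cube l" unfolding mem_centered_cube by blast
qed

lemma centered_cube_cover:
  fixes x :: "real ^ 'n"
  obtains k where "x \<in> centered_cube k"
proof -
  obtain k where "norm x < real k" using reals_Archimedean2 by blast
  then have "x \<in> centered_cube k" by (intro centered_cubeI) simp
  then show thesis by (rule that)
qed

lemma product_weight_measurable:
  assumes "\<And>j. j \<in> {1..m} \<Longrightarrow> weight (w j)"
  shows "product_weight m p P w \<in> borel_measurable lebesgue"
proof -
  have [measurable]: "w j \<in> borel_measurable lebesgue" if "j \<in> {1..m}" for j
    using assms[OF that] by (simp add: weight_def)
  show ?thesis unfolding product_weight_def by measurable
qed

text \<open>The shift by \<open>1 / Suc k\<close> keeps the base away from 0. As it decreases, the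
  negative power increases to the extended one, including the value \<infinity> at
  \<open>t = 0\<close>.\<close>

lemma SUP_regularised_weight:
  fixes t \<gamma> :: real
  assumes "0 \<le> t" "\<gamma> < 0"
  shows "incseq (\<lambda>k. ennreal ((t + 1 / Suc k) powr \<gamma>))"
    and "(SUP k. ennreal ((t + 1 / Suc k) powr \<gamma>)) = ennreal t epowr \<gamma>"
proof -
  have "(t + 1 / Suc k) powr \<gamma> \<le> (t + 1 / Suc l) powr \<gamma>" if "k \<le> l" for k l
  proof (rule powr_mono2')
    show "t + 1 / Suc l \<le> t + 1 / Suc k" using that by (simp add: field_simps)
    show "0 < t + 1 / real (Suc l)" using assms by (simp add: add_nonneg_pos)
  qed (use assms in simp)
  then show inc: "incseq (\<lambda>k. ennreal ((t + 1 / Suc k) powr \<gamma>))"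
    by (auto simp: incseq_def intro!: ennreal_leI)
  have lim: "(\<lambda>k. t + 1 / Suc k) \<longlonglongrightarrow> t"
    using tendsto_add[OF tendsto_const LIMSEQ_inverse_real_of_nat, of t] by (simp add: inverse_eq_divide)
  have "(\<lambda>k. ennreal ((t + 1 / Suc k) powr \<gamma>)) \<longlonglongrightarrow> ennreal t epowr \<gamma>"
  proof (cases "t = 0")
    case True
    have "filterlim (\<lambda>k. real (Suc k) powr (- \<gamma>)) at_top sequentially"
      using assms by real_asymp
    moreover have "real (Suc k) powr (- \<gamma>) = (t + 1 / Suc k) powr \<gamma>" for k
      using True by (simp add: powr_minus powr_divide field_simps)
    ultimately have "filterlim (\<lambda>k. (t + 1 / Suc k) powr \<gamma>) at_top sequentially" by simp
    then have "(\<lambda>k. ennreal ((t + 1 / Suc k) powr \<gamma>)) \<longlonglongrightarrow> top"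
      by (simp add: ennreal_tendsto_top_eq_at_top)
    then show ?thesis using True assms by (simp add: ennpowr_def)
  next
    case False
    then have "(\<lambda>k. (t + 1 / Suc k) powr \<gamma>) \<longlonglongrightarrow> t powr \<gamma>"
      by (intro tendsto_powr lim tendsto_const)
    then show ?thesis using False assms by (simp add: epowr_ennreal)
  qed
  then show "(SUP k. ennreal ((t + 1 / Suc k) powr \<gamma>)) = ennreal t epowr \<gamma>"
    using LIMSEQ_SUP[OF inc] LIMSEQ_unique by blast
qed

section \<open>Necessity\<close>

lemma average_cong: "(\<And>x. x \<in> R \<Longrightarrow> f x = g x) \<Longrightarrow> average R f = average R g"
  unfolding average_def by (auto intro!: arg_cong2[where f = "(/)"] nn_integral_cong split: split_indicator)

lemma nn_integral_eq_average:
  assumes "emeasure lebesgue R \<noteq> 0" "emeasure lebesgue R \<noteq> \<infinity>"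
  shows "(\<integral>\<^sup>+y\<in>R. g y \<partial>lebesgue) = emeasure lebesgue R * average R g"
  unfolding average_def ennreal_times_divide mult.commute[of "emeasure lebesgue R"]
  by (rule mult_divide_eq_ennreal[symmetric]) (use assms in auto)

lemma average_nonzero:
  assumes R: "R \<in> open_rectangles" and g: "g \<in> borel_measurable lebesgue" and nz: "\<And>x. g x \<noteq> 0"
  shows "average R g \<noteq> 0"
proof
  note Rf = emeasure_open_rectangle[OF R]
  note [measurable] = Rf(3) g
  assume "average R g = 0"
  then have "(\<integral>\<^sup>+x\<in>R. g x \<partial>lebesgue) = 0"
    unfolding nn_integral_eq_average[OF Rf(1,2)] by simp
  then have "AE x in lebesgue. g x * indicator R x = 0"
    by (subst (asm) nn_integral_0_iff_AE) auto
  then have "AE x in lebesgue. x \<notin> R"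
    by eventually_elim (use nz in \<open>auto simp: indicator_def\<close>)
  then show False using Rf by (auto simp: AE_iff_measurable[OF Rf(3)])
qed

text \<open>A negative power of a finite number is never 0. This keeps the dual factors from
  annihilating an infinite one in the A_P product.\<close>

lemma average_dual_weight_nonzero:
  assumes R: "R \<in> open_rectangles" and w: "weight w" and q: "1 < q"
  shows "average R (\<lambda>x. ennreal (w x) epowr (1 - conj_exponent q)) \<noteq> 0"
proof (rule average_nonzero[OF R])
  note [measurable] = w[unfolded weight_def, THEN conjunct1]
  show "(\<lambda>x. ennreal (w x) epowr (1 - conj_exponent q)) \<in> borel_measurable lebesgue" by measurable
  show "ennreal (w x) epowr (1 - conj_exponent q) \<noteq> 0" for x
    using w one_minus_conj_exponent[OF q] q by (auto simp: ennpowr_def weight_def ennreal_eq_0_iff)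
qed

text \<open>The condition is tested on the functions \<open>(w i + 1/k) powr (1 - P i')\<close>, which, unlike
  \<open>w i powr (1 - P i')\<close>, are bounded.\<close>

lemma strong_maximal_bounded_imp_multiple_A:
  fixes w :: "nat \<Rightarrow> real ^ 'n \<Rightarrow> real"
  assumes m: "1 \<le> m"
    and P: "\<And>j. j \<in> {1..m} \<Longrightarrow> 1 < P j"
    and p: "1 / p = (\<Sum>j=1..m. 1 / P j)"
    and w: "\<And>j. j \<in> {1..m} \<Longrightarrow> weight (w j)"
    and bdd: "strong_maximal_bounded m P w p (product_weight m p P w)"
  shows "multiple_A m p P w"
proof -
  have pP: "0 < p" "(\<Sum>j=1..m. p / P j) = 1"
    using harmonic_exponent[where m = m and P = P and p = p] m P p by blast+
  obtain C where C: "0 \<le> C" and bd: "\<And>f. (\<And>i. i \<in> {1..m} \<Longrightarrow> locally_integrable (f i) \<and> in_Lspace (P i) (w i) (f i)) \<Longrightarrow>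
      Lnorm p (product_weight m p P w) (strong_maximal m f)
        \<le> ennreal C * (\<Prod>i=1..m. Lnorm (P i) (w i) (\<lambda>x. ennreal \<bar>f i x\<bar>))"
    using bdd unfolding strong_maximal_bounded_def by blast
  let ?\<nu> = "product_weight m p P w"
  have wm [measurable]: "w j \<in> borel_measurable lebesgue" and w0: "\<And>x. 0 \<le> w j x" if "j \<in> {1..m}" for j
    using w[OF that] by (auto simp: weight_def)
  have \<nu>m [measurable]: "?\<nu> \<in> borel_measurable lebesgue" by (rule product_weight_measurable[OF w])
  have \<nu>0: "0 \<le> ?\<nu> x" for x unfolding product_weight_def by (intro prod_nonneg) auto
  \<comment> \<open>This exponent equals -1/(P - 1) and satisfies
    \<open>\<gamma> j * P j + 1 = \<gamma> j\<close>: up to regularisation, the P-th power of the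
    test function times the weight is the test function again.\<close>
  define \<gamma> where "\<gamma> = (\<lambda>j. 1 - conj_exponent (P j))"
  have \<gamma>: "\<gamma> j < 0" "\<gamma> j * P j + 1 = \<gamma> j" if "j \<in> {1..m}" for j
    using P[OF that] unfolding \<gamma>_def one_minus_conj_exponent[OF P[OF that]] by (auto simp: field_simps)
  have e_pos: "0 < p / conj_exponent (P j)" if "j \<in> {1..m}" for j
    using pP conj_exponent_gt_0[OF P[OF that]] by simp
  have pP_pos: "0 < p / P j" if "j \<in> {1..m}" for j
    using pP P[OF that] by simp
  have "average R (\<lambda>x. ennreal (?\<nu> x)) *
      (\<Prod>j=1..m. average R (\<lambda>x. ennreal (w j x) epowr \<gamma> j) epowr (p / conj_exponent (P j))) \<le> ennreal C epowr p"
    if R: "R \<in> open_rectangles" for R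
  proof -
    note Rf = emeasure_open_rectangle[OF R]
    note [measurable] = Rf(3)
    let ?r = "emeasure lebesgue R"
    define F where "F = (\<lambda>k j y. (w j y + 1 / Suc k) powr \<gamma> j)"
    define T where "T = (\<lambda>k j. average R (\<lambda>y. ennreal (F k j y)))"
    have Fm [measurable]: "F k j \<in> borel_measurable lebesgue" if "j \<in> {1..m}" for k j
      unfolding F_def using that by measurable
    have wpos: "0 < w j y + 1 / Suc k" if "j \<in> {1..m}" for j k y
      using w0[OF that, of y] by (simp add: add_nonneg_pos)
    have Fpos: "0 < F k j y" if "j \<in> {1..m}" for k j y
      unfolding F_def using wpos[OF that, of y k] by simp
    have Fbound: "F k j y \<le> (1 / Suc k) powr \<gamma> j" if "j \<in> {1..m}" for k j y
      unfolding F_def using \<gamma>[OF that] w0[OF that, of y] by (intro powr_mono2') auto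
    have Tint: "(\<integral>\<^sup>+y\<in>R. ennreal (F k j y) \<partial>lebesgue) = ?r * T k j" for k j
      unfolding T_def by (rule nn_integral_eq_average[OF Rf(1,2)])
    have T_fin: "T k j \<noteq> top" "T k j \<noteq> 0" if j: "j \<in> {1..m}" for k j
    proof -
      have "(\<integral>\<^sup>+y\<in>R. ennreal (F k j y) \<partial>lebesgue) \<le> (\<integral>\<^sup>+y\<in>R. ennreal ((1 / Suc k) powr \<gamma> j) \<partial>lebesgue)"
        using Fbound[OF j] by (intro nn_integral_mono mult_right_mono ennreal_leI) auto
      also have "\<dots> < top" using Rf by (simp add: nn_integral_cmult_indicator ennreal_mult_less_top less_top)
      finally show "T k j \<noteq> top" unfolding Tint using Rf by (auto simp: ennreal_mult_top)
      show "T k j \<noteq> 0"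
        unfolding T_def using Fm[OF j, of k] Fpos[OF j, of k]
        by (intro average_nonzero R) (auto simp: ennreal_eq_0_iff not_le)
    qed
    have key: "average R (\<lambda>x. ennreal (?\<nu> x)) * (\<Prod>j=1..m. T k j epowr (p / conj_exponent (P j))) \<le> ennreal C epowr p" for k
    proof -
      define f where "f = (\<lambda>j y. F k j y * indicator R y :: real)"
      have fm [measurable]: "f j \<in> borel_measurable lebesgue" if "j \<in> {1..m}" for j
        unfolding f_def using that by measurable
      have f0: "0 \<le> f j y" if "j \<in> {1..m}" for j y
        unfolding f_def using Fpos[OF that] by (simp add: less_imp_le)
      have loc: "locally_integrable (f j)" if j: "j \<in> {1..m}" for j
        unfolding locally_integrable_def set_integrable_def
      proof (intro allI impI)
        fix K :: "(real ^ 'n) set" assume "compact K"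
        then have "emeasure lborel K < \<infinity>" "K \<in> sets borel"
          using emeasure_bounded_finite[OF compact_imp_bounded] borel_compact by auto
        then show "integrable lebesgue (\<lambda>x. indicat_real K x *\<^sub>R f j x)"
          using Fbound[OF j, of k] Fpos[OF j, of k] j
          by (intro integrableI_bounded_set_indicator[where B = "(1 / Suc k) powr \<gamma> j"])
            (auto simp: f_def indicator_def less_imp_le)
      qed
      have norm_f: "Lnorm (P j) (w j) (\<lambda>x. ennreal \<bar>f j x\<bar>) \<le> (?r * T k j) epowr (1 / P j)" if j: "j \<in> {1..m}" for j
        unfolding Lnorm_def Tint[symmetric]
      proof (intro epowr_mono nn_integral_mono)
        show "0 < 1 / P j" using P[OF j] by simp
        fix x
        show "ennreal \<bar>f j x\<bar> epowr P j * ennreal (w j x) \<le> ennreal (F k j x) * indicator R x"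
        proof (cases "x \<in> R")
          case True
          let ?v = "w j x + 1 / Suc k"
          have "ennreal \<bar>f j x\<bar> epowr P j * ennreal (w j x) = ennreal (F k j x powr P j * w j x)"
            using True Fpos[OF j, of k x] w0[OF j, of x]
            by (simp add: f_def epowr_ennreal ennreal_mult)
          \<comment> \<open>The weight is raised to its regularised value, after which the powers
            combine exactly.\<close>
          also have "F k j x powr P j * w j x \<le> F k j x powr P j * ?v"
            by (intro mult_left_mono) auto
          also have "\<dots> = ?v powr (\<gamma> j * P j + 1)"
            unfolding F_def using wpos[OF j, of x k] by (simp add: powr_powr powr_add)
          also have "\<dots> = F k j x" unfolding \<gamma>(2)[OF j] F_def ..
          finally show ?thesis using True by (simp add: ennreal_leI)
        qed (use P[OF j] in \<open>simp add: f_def\<close>)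
      qed
      have Lsp: "in_Lspace (P j) (w j) (f j)" if j: "j \<in> {1..m}" for j
      proof -
        have "(?r * T k j) epowr (1 / P j) < top"
          using P[OF j] T_fin[OF j] Rf by (simp add: less_top[symmetric] epowr_eq_top_iff ennreal_mult_eq_top_iff)
        then show ?thesis unfolding in_Lspace_def using norm_f[OF j] fm[OF j] by (auto intro: le_less_trans)
      qed
      have avg_f: "average R (\<lambda>y. ennreal \<bar>f j y\<bar>) = T k j" if "j \<in> {1..m}" for j
        unfolding T_def by (rule average_cong) (use Fpos[OF that] in \<open>simp add: f_def less_imp_le\<close>)
      have Mf: "(\<Prod>j=1..m. T k j) \<le> strong_maximal m f x" if "x \<in> R" for x
      proof -
        have "(\<Prod>j=1..m. T k j) = (\<Prod>j=1..m. average R (\<lambda>y. ennreal \<bar>f j y\<bar>))"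
          using avg_f by (intro prod.cong) auto
        also have "\<dots> \<le> strong_maximal m f x"
          unfolding strong_maximal_def using R that by (intro SUP_upper) auto
        finally show ?thesis .
      qed
      let ?N = "\<integral>\<^sup>+x\<in>R. ennreal (?\<nu> x) \<partial>lebesgue"
      have "(\<Prod>j=1..m. T k j) epowr p * ?N
          = (\<integral>\<^sup>+x. (\<Prod>j=1..m. T k j) epowr p * (ennreal (?\<nu> x) * indicator R x) \<partial>lebesgue)"
        by (simp add: nn_integral_cmult)
      also have "\<dots> \<le> (\<integral>\<^sup>+x. strong_maximal m f x epowr p * ennreal (?\<nu> x) \<partial>lebesgue)"
        using Mf pP(1) by (intro nn_integral_mono) (auto simp: indicator_def intro!: mult_right_mono epowr_mono)
      finally have "((\<Prod>j=1..m. T k j) epowr p * ?N) epowr (1 / p) \<le> Lnorm p ?\<nu> (strong_maximal m f)"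
        unfolding Lnorm_def using pP(1) by (intro epowr_mono) auto
      also have "\<dots> \<le> ennreal C * (\<Prod>i=1..m. Lnorm (P i) (w i) (\<lambda>x. ennreal \<bar>f i x\<bar>))"
        using loc Lsp by (intro bd) auto
      also have "\<dots> \<le> ennreal C * (\<Prod>i=1..m. (?r * T k i) epowr (1 / P i))"
        using norm_f by (intro mult_left_mono prod_mono_ennreal) auto
      finally have "(((\<Prod>j=1..m. T k j) epowr p * ?N) epowr (1 / p)) epowr p
          \<le> (ennreal C * (\<Prod>i=1..m. (?r * T k i) epowr (1 / P i))) epowr p"
        using pP(1) by (intro epowr_mono)
      also have "(((\<Prod>j=1..m. T k j) epowr p * ?N) epowr (1 / p)) epowr p = (\<Prod>j=1..m. T k j) epowr p * ?N"
        using pP(1) by (simp add: epowr_epowr)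
      also have "(ennreal C * (\<Prod>i=1..m. (?r * T k i) epowr (1 / P i))) epowr p
          = ennreal C epowr p * (\<Prod>i=1..m. (?r * T k i) epowr (p / P i))"
      proof -
        have "((?r * T k i) epowr (1 / P i)) epowr p = (?r * T k i) epowr (p / P i)" if "i \<in> {1..m}" for i
          using P[OF that] pP(1) by (simp add: epowr_epowr)
        then show ?thesis using pP(1) by (simp add: epowr_mult epowr_prod)
      qed
      also have "(\<Prod>i=1..m. (?r * T k i) epowr (p / P i)) = (\<Prod>i=1..m. ?r epowr (p / P i) * T k i epowr (p / P i))"
        using pP_pos by (intro prod.cong refl epowr_mult) auto
      also have "\<dots> = ?r * (\<Prod>i=1..m. T k i epowr (p / P i))"
        unfolding prod.distrib using m pP pP_pos by (subst prod_epowr) auto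
      finally have 1: "(\<Prod>j=1..m. T k j) epowr p * ?N \<le> ?r * (ennreal C epowr p * (\<Prod>i=1..m. T k i epowr (p / P i)))"
        by (simp add: mult_ac)
      have "(\<Prod>j=1..m. T k j) epowr p = (\<Prod>j=1..m. T k j epowr (p / P j) * T k j epowr (p / conj_exponent (P j)))"
        unfolding epowr_prod[OF pP(1)]
      proof (rule prod.cong[OF refl])
        fix j assume j: "j \<in> {1..m}"
        have "p = p / P j + p / conj_exponent (P j)"
          using conj_exponent[OF P[OF j]] by (metis distrib_left mult.right_neutral times_divide_eq_right)
        then show "T k j epowr p = T k j epowr (p / P j) * T k j epowr (p / conj_exponent (P j))"
          using epowr_add[OF pP_pos[OF j] e_pos[OF j]] by metis
      qed
      also have "\<dots> = (\<Prod>j=1..m. T k j epowr (p / P j)) * (\<Prod>j=1..m. T k j epowr (p / conj_exponent (P j)))"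
        by (rule prod.distrib)
      finally have 2: "(\<Prod>j=1..m. T k j) epowr p = \<dots>" .
      have N: "?N = ?r * average R (\<lambda>x. ennreal (?\<nu> x))"
        by (rule nn_integral_eq_average[OF Rf(1,2)])
      let ?Q = "\<Prod>j=1..m. T k j epowr (p / P j)"
      \<comment> \<open>The test functions are bounded and positive, so \<open>?r * ?Q\<close> is
        finite and nonzero and can be cancelled.\<close>
      have Q: "?Q \<noteq> 0" "?Q \<noteq> top"
        using T_fin pP_pos by (auto simp: epowr_eq_0_iff epowr_eq_top_iff ennreal_prod_eq_top)
      have "(?r * ?Q) * (average R (\<lambda>x. ennreal (?\<nu> x)) * (\<Prod>j=1..m. T k j epowr (p / conj_exponent (P j))))
          \<le> (?r * ?Q) * (ennreal C epowr p)"
        using 1 unfolding 2 N by (simp only: mult_ac)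
      then show ?thesis
        using Q Rf by (subst (asm) ennreal_mult_le_mult_iff) (auto simp: ennreal_mult_eq_top_iff)
    qed
    \<comment> \<open>The bound obtained for each \<open>k\<close> has a constant free of
      \<open>k\<close>, so monotone convergence removes the regularisation.\<close>
    have incT: "incseq (\<lambda>k. T k j)" if j: "j \<in> {1..m}" for j
      unfolding T_def average_def F_def incseq_def
      using SUP_regularised_weight(1)[OF w0[OF j] \<gamma>(1)[OF j]]
      by (auto intro!: divide_right_mono_ennreal nn_integral_mono mult_right_mono simp: incseq_def)
    have supT: "average R (\<lambda>x. ennreal (w j x) epowr \<gamma> j) = (SUP k. T k j)" if j: "j \<in> {1..m}" for j
    proof -
      have "(\<integral>\<^sup>+x\<in>R. ennreal (w j x) epowr \<gamma> j \<partial>lebesgue)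
          = (\<integral>\<^sup>+x. (SUP k. ennreal (F k j x) * indicator R x) \<partial>lebesgue)"
        unfolding F_def SUP_mult_right_ennreal[symmetric]
        using SUP_regularised_weight(2)[OF w0[OF j] \<gamma>(1)[OF j]] by simp
      also have "\<dots> = (SUP k. \<integral>\<^sup>+x\<in>R. ennreal (F k j x) \<partial>lebesgue)"
      proof (rule nn_integral_monotone_convergence_SUP)
        show "incseq (\<lambda>k x. ennreal (F k j x) * indicator R x)"
          using SUP_regularised_weight(1)[OF w0[OF j] \<gamma>(1)[OF j]]
          by (auto simp: incseq_def le_fun_def F_def intro!: mult_right_mono)
        show "(\<lambda>x. ennreal (F k j x) * indicator R x) \<in> borel_measurable lebesgue" for k
          using j by measurable
      qed
      finally show ?thesis unfolding T_def average_def by (simp add: SUP_divide_ennreal)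
    qed
    have "average R (\<lambda>x. ennreal (?\<nu> x)) *
        (\<Prod>j=1..m. average R (\<lambda>x. ennreal (w j x) epowr \<gamma> j) epowr (p / conj_exponent (P j)))
      = average R (\<lambda>x. ennreal (?\<nu> x)) * (\<Prod>j=1..m. SUP k. T k j epowr (p / conj_exponent (P j)))"
      using supT e_pos by (simp add: SUP_epowr)
    also have "\<dots> = average R (\<lambda>x. ennreal (?\<nu> x)) * (SUP k. \<Prod>j=1..m. T k j epowr (p / conj_exponent (P j)))"
      using incT e_pos by (subst SUP_prod_incseq) (auto simp: incseq_def intro!: epowr_mono)
    also have "\<dots> \<le> ennreal C epowr p"
      unfolding SUP_mult_left_ennreal by (intro SUP_least key)
    finally show ?thesis .
  qed
  then have "(SUP R\<in>open_rectangles. average R (\<lambda>x. ennreal (?\<nu> x)) *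
      (\<Prod>j=1..m. average R (\<lambda>x. ennreal (w j x) epowr (1 - conj_exponent (P j))) epowr (p / conj_exponent (P j))))
      \<le> ennreal C epowr p"
    unfolding \<gamma>_def by (rule SUP_least)
  also have "\<dots> < \<infinity>" using pP(1) by (simp add: less_top[symmetric] epowr_eq_top_iff)
  finally show ?thesis unfolding multiple_A_def .
qed

section \<open>Lattice rectangles\<close>

definition lattice_point :: "real \<Rightarrow> real ^ 'n \<Rightarrow> 'n \<Rightarrow> int" where
  "lattice_point s x = (\<lambda>i. \<lfloor>s * x $ i\<rfloor>)"

text \<open>The mesh is \<open>1 / s\<close>. A cell consists of the points with a given floor and
  thus ends one unit further, which explains \<open>b i + 1\<close>. The open version is chosen
  because it belongs to \<open>open_rectangles\<close>.\<close>

definition lattice_rectangle :: "real \<Rightarrow> ('n \<Rightarrow> int) \<Rightarrow> ('n \<Rightarrow> int) \<Rightarrow> (real ^ 'n) set" where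
  "lattice_rectangle s a b = box (\<chi> i. a i / s) (\<chi> i. (b i + 1) / s)"

lemma lattice_point_Icc:
  "lattice_point s x \<in> {a..b} \<longleftrightarrow> (\<forall>i. a i \<le> s * x $ i \<and> s * x $ i < b i + 1)"
  unfolding lattice_point_def atLeastAtMost_iff le_fun_def le_floor_iff floor_le_iff by blast

lemma sets_lattice_preimage:
  assumes "finite S"
  shows "lattice_point s -` S \<in> sets (lebesgue :: (real ^ 'n::finite) measure)"
proof -
  have "lattice_point s -` {z} \<in> sets (borel :: (real ^ 'n) measure)" for z
  proof -
    have [measurable]: "(\<lambda>x :: real ^ 'n. x $ i) \<in> borel_measurable borel" for i
      by (intro borel_measurable_continuous_onI continuous_on_component continuous_on_id)
    have "lattice_point s -` {z} = {x \<in> space borel. \<forall>i. z i \<le> s * x $ i \<and> s * x $ i < z i + 1}"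
      using lattice_point_Icc[of s _ z z] by auto
    then show ?thesis by simp
  qed
  moreover have "lattice_point s -` S = (\<Union>z\<in>S. lattice_point s -` {z})" by auto
  ultimately have "lattice_point s -` S \<in> sets (borel :: (real ^ 'n) measure)"
    using assms by (auto intro!: sets.finite_UN)
  then show ?thesis by simp
qed

lemma lattice_corner_less:
  fixes a b :: "'n \<Rightarrow> int" and s :: real
  assumes "0 < s" "a \<le> b"
  shows "real_of_int (a i) / s < (real_of_int (b i) + 1) / s"
proof (rule divide_strict_right_mono[OF _ assms(1)])
  have "a i \<le> b i" using assms(2) by (simp add: le_fun_def)
  then show "real_of_int (a i) < real_of_int (b i) + 1" by linarith
qed

lemma lattice_rectangle_open_rectangle:
  assumes "0 < s" "a \<le> b"
  shows "lattice_rectangle s a b \<in> open_rectangles"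
proof -
  have "(\<chi> i. real_of_int (a i) / s) $ k < (\<chi> i. (real_of_int (b i) + 1) / s) $ k" for k
    unfolding vec_lambda_beta by (rule lattice_corner_less[OF assms])
  then show ?thesis unfolding lattice_rectangle_def open_rectangles_def mem_Collect_eq
    by - (intro exI conjI, rule refl, simp)
qed

lemma emeasure_open_box:
  fixes a b :: "real ^ 'n"
  assumes "\<And>i. a $ i \<le> b $ i"
  shows "emeasure lebesgue (box a b) = ennreal (\<Prod>i\<in>UNIV. b $ i - a $ i)"
proof -
  have ne: "cbox a b \<noteq> {}" using assms by (simp add: interval_ne_empty_cart)
  have "emeasure lebesgue (box a b) = emeasure lborel (cbox a b)"
    by (simp add: emeasure_lborel_box_eq emeasure_lborel_cbox_eq)
  also have "\<dots> = ennreal (measure lborel (cbox a b))"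
    by (intro emeasure_eq_ennreal_measure) (simp add: emeasure_lborel_cbox_eq)
  also have "\<dots> = ennreal (\<Prod>i\<in>UNIV. b $ i - a $ i)"
    using content_cbox_cart[OF ne] by simp
  finally show ?thesis .
qed

text \<open>The half-open union of cells and the open box differ only on the boundary of the closed
  box, a null set.\<close>

lemma nn_integral_lattice_rectangle:
  assumes s: "0 < s"
  shows "(\<integral>\<^sup>+x\<in>lattice_point s -` {a..b}. g x \<partial>lebesgue) = (\<integral>\<^sup>+x\<in>lattice_rectangle s a b. g x \<partial>lebesgue)"
proof (rule nn_integral_cong_AE)
  let ?l = "\<chi> i. a i / s" and ?u = "\<chi> i. (b i + 1) / s"
  have "cbox ?l ?u - box ?l ?u \<in> null_sets lebesgue"
    using negligible_frontier_interval negligible_iff_null_sets by blast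
  then have "AE x in lebesgue. x \<notin> cbox ?l ?u - box ?l ?u" by (rule AE_not_in)
  moreover have "x \<in> lattice_point s -` {a..b} \<longleftrightarrow> x \<in> box ?l ?u" if "x \<notin> cbox ?l ?u - box ?l ?u" for x
  proof -
    have 1: "x \<in> lattice_point s -` {a..b} \<longleftrightarrow> (\<forall>i. a i / s \<le> x $ i \<and> x $ i < (b i + 1) / s)"
      unfolding vimage_eq lattice_point_Icc using s by (simp add: field_simps)
    have "x \<in> box ?l ?u \<Longrightarrow> x \<in> lattice_point s -` {a..b}"
      unfolding 1 mem_box_cart by (auto simp: less_imp_le)
    moreover have "x \<in> lattice_point s -` {a..b} \<Longrightarrow> x \<in> cbox ?l ?u"
      unfolding 1 mem_box_cart by (auto simp: less_imp_le)
    ultimately show ?thesis using that by blast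
  qed
  ultimately show "AE x in lebesgue. g x * indicator (lattice_point s -` {a..b}) x
      = g x * indicator (lattice_rectangle s a b) x"
    unfolding lattice_rectangle_def by (auto elim!: eventually_mono simp: indicator_def)
qed

lemma nn_integral_lattice_sum:
  assumes "finite S" and g: "g \<in> borel_measurable lebesgue"
  shows "(\<integral>\<^sup>+x\<in>lattice_point s -` S. g x \<partial>lebesgue) = (\<Sum>z\<in>S. \<integral>\<^sup>+x\<in>lattice_point s -` {z}. g x \<partial>lebesgue)"
proof -
  have "indicator (lattice_point s -` S) x = (\<Sum>z\<in>S. indicator (lattice_point s -` {z}) x :: ennreal)" for x
    using assms(1) by (simp add: indicator_def sum.delta)
  then have "(\<integral>\<^sup>+x\<in>lattice_point s -` S. g x \<partial>lebesgue)
      = (\<integral>\<^sup>+x. (\<Sum>z\<in>S. g x * indicator (lattice_point s -` {z}) x) \<partial>lebesgue)"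
    by (simp add: sum_distrib_left)
  also have "\<dots> = (\<Sum>z\<in>S. \<integral>\<^sup>+x\<in>lattice_point s -` {z}. g x \<partial>lebesgue)"
    using g by (intro nn_integral_sum borel_measurable_times_ennreal borel_measurable_indicator sets_lattice_preimage) auto
  finally show ?thesis .
qed

text \<open>The \<open>itself\<close> argument passes the dimension, which \<open>s\<close> does not
  determine.\<close>

definition cell_volume :: "real \<Rightarrow> 'n itself \<Rightarrow> real" where
  "cell_volume s _ = (1 / s) ^ CARD('n)"

lemma emeasure_lattice_preimage:
  assumes s: "0 < s" and "finite S"
  shows "emeasure lebesgue (lattice_point s -` S :: (real ^ 'n::finite) set) = ennreal (card S * cell_volume s TYPE('n))"
proof -
  have cell: "emeasure lebesgue (lattice_point s -` {z} :: (real ^ 'n) set) = ennreal (cell_volume s TYPE('n))" for z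
  proof -
    have "emeasure lebesgue (lattice_point s -` {z} :: (real ^ 'n) set) = emeasure lebesgue (lattice_rectangle s z z)"
      using nn_integral_lattice_rectangle[OF s, where a = z and b = z and g = "\<lambda>_. 1"] sets_lattice_preimage[of "{z}" s]
      by (simp add: lattice_rectangle_def)
    also have "\<dots> = ennreal (\<Prod>i\<in>(UNIV :: 'n set). (z i + 1) / s - z i / s)"
      unfolding lattice_rectangle_def using s by (subst emeasure_open_box) (auto simp: divide_right_mono)
    also have "\<dots> = ennreal (cell_volume s TYPE('n))"
      using s by (simp add: cell_volume_def flip: diff_divide_distrib)
    finally show ?thesis .
  qed
  have "emeasure lebesgue (lattice_point s -` S :: (real ^ 'n) set)
      = (\<Sum>z\<in>S. emeasure lebesgue (lattice_point s -` {z} :: (real ^ 'n) set))"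
    using nn_integral_lattice_sum[OF assms(2), of "\<lambda>_. 1" s]
    by (simp add: sets_lattice_preimage[OF assms(2)] sets_lattice_preimage[of "{_}"] del: emeasure_completion)
  also have "\<dots> = ennreal (card S * cell_volume s TYPE('n))"
    unfolding cell using s by (simp add: cell_volume_def ennreal_mult ennreal_of_nat_eq_real_of_nat)
  finally show ?thesis .
qed

lemma average_lattice_rectangle:
  assumes "0 < s"
  shows "average (lattice_rectangle s a b) g = average (lattice_point s -` {a..b}) g"
proof -
  have "emeasure lebesgue (lattice_rectangle s a b) = emeasure lebesgue (lattice_point s -` {a..b})"
    using nn_integral_lattice_rectangle[OF assms, where a = a and b = b and g = "\<lambda>_. 1"] sets_lattice_preimage[of "{a..b}" s]
    by (simp add: lattice_rectangle_def)
  then show ?thesis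
    unfolding average_def using nn_integral_lattice_rectangle[OF assms, where a = a and b = b and g = g] by simp
qed

text \<open>The smallest lattice box around \<open>R\<close> exceeds it by less than one mesh at
  each end. Once every edge of \<open>R\<close> is at least two meshes long, each edge is at most
  doubled, hence \<open>2 ^ CARD('n)\<close>. The windows exhaust the space, but the first suitable
  \<open>N\<close> depends on \<open>R\<close>.\<close>

lemma lattice_approximation:
  fixes R :: "(real ^ 'n) set"
  assumes R: "R \<in> open_rectangles"
  shows "\<forall>\<^sub>F N in sequentially. \<exists>a b. a \<le> b \<and> {a..b} \<subseteq> {(\<lambda>_. - int N * 2 ^ N)..(\<lambda>_. int N * 2 ^ N - 1)}
    \<and> R \<subseteq> lattice_point (2 ^ N) -` {a..b}
    \<and> emeasure lebesgue (lattice_rectangle (2 ^ N) a b) \<le> ennreal (2 ^ CARD('n)) * emeasure lebesgue R"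
proof -
  obtain \<alpha> \<beta> where \<alpha>\<beta>: "R = box \<alpha> \<beta>" "\<And>i. \<alpha> $ i < \<beta> $ i" using R by (auto simp: open_rectangles_def)
  have "\<forall>\<^sub>F N in sequentially. \<bar>\<alpha> $ i\<bar> \<le> real N \<and> \<bar>\<beta> $ i\<bar> \<le> real N \<and> 2 / (\<beta> $ i - \<alpha> $ i) \<le> 2 ^ N" for i
  proof -
    obtain K where K: "\<bar>\<alpha> $ i\<bar> + \<bar>\<beta> $ i\<bar> + 2 / (\<beta> $ i - \<alpha> $ i) \<le> real K" using real_arch_simple by blast
    have "0 < 2 / (\<beta> $ i - \<alpha> $ i)" using \<alpha>\<beta>(2)[of i] by simp
    then have "\<bar>\<alpha> $ i\<bar> \<le> real N \<and> \<bar>\<beta> $ i\<bar> \<le> real N \<and> 2 / (\<beta> $ i - \<alpha> $ i) \<le> 2 ^ N" if "K \<le> N" for N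
      using K that of_nat_less_two_power[of N, where 'a = real] by linarith
    then show ?thesis by (auto simp: eventually_sequentially)
  qed
  then have "\<forall>\<^sub>F N in sequentially. \<forall>i. \<bar>\<alpha> $ i\<bar> \<le> real N \<and> \<bar>\<beta> $ i\<bar> \<le> real N \<and> 2 / (\<beta> $ i - \<alpha> $ i) \<le> 2 ^ N"
    by (simp add: eventually_all_finite)
  then show ?thesis
  proof eventually_elim
    case (elim N)
    define s :: real where "s = 2 ^ N"
    have s: "0 < s" by (simp add: s_def)
    define a where "a = (\<lambda>i. \<lfloor>s * \<alpha> $ i\<rfloor>)"
    \<comment> \<open>One less than the ceiling, because the last cell reaches up to
      \<open>b i + 1\<close>.\<close>
    define b where "b = (\<lambda>i. \<lceil>s * \<beta> $ i\<rceil> - 1)"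
    have lt: "s * \<alpha> $ i < s * \<beta> $ i" for i using \<alpha>\<beta>(2) s by simp
    have ab: "a \<le> b"
      unfolding le_fun_def a_def b_def using lt by (metis floor_less_iff ceiling_le_iff linorder_not_le zle_diff1_eq le_of_int_ceiling order_less_le_trans)
    have bnd: "- int N * 2 ^ N \<le> a i" "b i \<le> int N * 2 ^ N - 1" for i
    proof -
      have "s * (- real N) \<le> s * \<alpha> $ i" using elim[rule_format, of i] s by (intro mult_left_mono) auto
      then show "- int N * 2 ^ N \<le> a i" unfolding a_def le_floor_iff by (simp add: s_def mult.commute)
      have "s * \<beta> $ i \<le> s * real N" using elim[rule_format, of i] s by (intro mult_left_mono) auto
      then have "\<lceil>s * \<beta> $ i\<rceil> \<le> int N * 2 ^ N" unfolding ceiling_le_iff by (simp add: s_def mult.commute)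
      then show "b i \<le> int N * 2 ^ N - 1" by (simp add: b_def)
    qed
    have sub: "{a..b} \<subseteq> {(\<lambda>_. - int N * 2 ^ N)..(\<lambda>_. int N * 2 ^ N - 1)}"
      using bnd by (intro atLeastatMost_subset_iff[THEN iffD2]) (auto simp: le_fun_def)
    have RQ: "R \<subseteq> lattice_point s -` {a..b}"
    proof
      fix x assume "x \<in> R"
      then have x: "s * \<alpha> $ i < s * x $ i" "s * x $ i < s * \<beta> $ i" for i
        using s unfolding \<alpha>\<beta>(1) mem_box_cart by auto
      have "a i \<le> s * x $ i \<and> s * x $ i < b i + 1" for i
        using x[of i] of_int_floor_le[of "s * \<alpha> $ i"] le_of_int_ceiling[of "s * \<beta> $ i"]
        unfolding a_def b_def of_int_diff of_int_1 by linarith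
      then show "x \<in> lattice_point s -` {a..b}" unfolding vimage_eq lattice_point_Icc by simp
    qed
    have "emeasure lebesgue (lattice_rectangle s a b) = ennreal (\<Prod>i\<in>UNIV. (b i + 1) / s - a i / s)"
      unfolding lattice_rectangle_def using lattice_corner_less[OF s ab]
      by (subst emeasure_open_box) (auto simp: less_imp_le)
    also have "\<dots> \<le> ennreal (\<Prod>i\<in>UNIV. 2 * (\<beta> $ i - \<alpha> $ i))"
    proof (intro ennreal_leI prod_mono conjI)
      fix i
      have "real_of_int (a i) \<le> b i" using ab by (simp add: le_fun_def)
      then show "0 \<le> (b i + 1) / s - a i / s" using s by (simp flip: diff_divide_distrib)
      have "(b i + 1) - a i \<le> (s * \<beta> $ i + 1) - (s * \<alpha> $ i - 1)"
        using ceiling_correct[of "s * \<beta> $ i"] floor_correct[of "s * \<alpha> $ i"]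
        unfolding a_def b_def of_int_diff of_int_add of_int_1 by linarith
      also have "\<dots> = s * (\<beta> $ i - \<alpha> $ i) + 2" by (simp add: algebra_simps)
      also have "2 \<le> s * (\<beta> $ i - \<alpha> $ i)"
        using elim[rule_format, of i] \<alpha>\<beta>(2)[of i] by (simp add: s_def field_simps)
      finally have "(b i + 1) - a i \<le> s * (2 * (\<beta> $ i - \<alpha> $ i))" by (simp add: algebra_simps)
      then have "((b i + 1) - a i) / s \<le> s * (2 * (\<beta> $ i - \<alpha> $ i)) / s"
        using s by (intro divide_right_mono) auto
      then have "((b i + 1) - a i) / s \<le> 2 * (\<beta> $ i - \<alpha> $ i)" using s by simp
      then show "(b i + 1) / s - a i / s \<le> 2 * (\<beta> $ i - \<alpha> $ i)"
        by (simp add: diff_divide_distrib)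
    qed
    also have "(\<Prod>i\<in>(UNIV :: 'n set). 2 * (\<beta> $ i - \<alpha> $ i)) = 2 ^ CARD('n) * (\<Prod>i\<in>UNIV. \<beta> $ i - \<alpha> $ i)"
      unfolding prod.distrib prod_constant ..
    also have "ennreal \<dots> = ennreal (2 ^ CARD('n)) * emeasure lebesgue R"
      unfolding \<alpha>\<beta>(1) using \<alpha>\<beta>(2) by (subst emeasure_open_box) (auto simp: less_imp_le intro!: ennreal_mult prod_nonneg)
    finally show ?case using ab sub RQ unfolding s_def by blast
  qed
qed

section \<open>Sufficiency\<close>

text \<open>Real-valued, as the discrete part works in the reals. Since \<open>enn2real\<close>
  sends \<infinity> to 0, the identities for it presuppose finite integrals over the cells.\<close>

definition cell_mean :: "real \<Rightarrow> (real ^ 'n \<Rightarrow> ennreal) \<Rightarrow> ('n \<Rightarrow> int) \<Rightarrow> real" where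
  "cell_mean s g z = enn2real (\<integral>\<^sup>+x\<in>lattice_point s -` {z}. g x \<partial>lebesgue) / cell_volume s TYPE('n)"

lemma cell_volume_pos: "0 < s \<Longrightarrow> 0 < cell_volume s TYPE('n::finite)"
  by (simp add: cell_volume_def)

lemma cell_mean_nonneg: "0 < s \<Longrightarrow> 0 \<le> cell_mean s g z"
  by (simp add: cell_mean_def cell_volume_def)

lemma nn_integral_cell:
  fixes g :: "real ^ 'n::finite \<Rightarrow> ennreal"
  assumes "0 < s" "(\<integral>\<^sup>+x\<in>lattice_point s -` {z}. g x \<partial>lebesgue) \<noteq> top"
  shows "(\<integral>\<^sup>+x\<in>lattice_point s -` {z}. g x \<partial>lebesgue) = ennreal (cell_volume s TYPE('n) * cell_mean s g z)"
  using assms cell_volume_pos[OF assms(1), where 'n = 'n] by (simp add: cell_mean_def less_top)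

lemma nn_integral_lattice_preimage:
  fixes g :: "real ^ 'n::finite \<Rightarrow> ennreal"
  assumes s: "0 < s" and S: "finite S" and g: "g \<in> borel_measurable lebesgue"
    and fin: "\<And>z. z \<in> S \<Longrightarrow> (\<integral>\<^sup>+x\<in>lattice_point s -` {z}. g x \<partial>lebesgue) \<noteq> top"
  shows "(\<integral>\<^sup>+x\<in>lattice_point s -` S. g x \<partial>lebesgue) = ennreal (cell_volume s TYPE('n) * sum (cell_mean s g) S)"
proof -
  have "(\<integral>\<^sup>+x\<in>lattice_point s -` S. g x \<partial>lebesgue) = (\<Sum>z\<in>S. ennreal (cell_volume s TYPE('n) * cell_mean s g z))"
    unfolding nn_integral_lattice_sum[OF S g] using fin by (intro sum.cong refl nn_integral_cell s)
  also have "\<dots> = ennreal (cell_volume s TYPE('n) * sum (cell_mean s g) S)"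
    using cell_mean_nonneg[OF s, of g] cell_volume_pos[OF s, where 'n = 'n]
    by (subst sum_ennreal) (auto simp: sum_distrib_left)
  finally show ?thesis .
qed

lemma average_lattice_preimage:
  fixes g :: "real ^ 'n::finite \<Rightarrow> ennreal"
  assumes s: "0 < s" and S: "finite S" "S \<noteq> {}" and g: "g \<in> borel_measurable lebesgue"
    and fin: "\<And>z. z \<in> S \<Longrightarrow> (\<integral>\<^sup>+x\<in>lattice_point s -` {z}. g x \<partial>lebesgue) \<noteq> top"
  shows "average (lattice_point s -` S) g = ennreal (box_average (cell_mean s g) S)"
proof -
  have c: "0 < real (card S)" using S by (simp add: card_gt_0_iff)
  have "average (lattice_point s -` S) g
      = ennreal (cell_volume s TYPE('n) * sum (cell_mean s g) S) / ennreal (card S * cell_volume s TYPE('n))"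
    unfolding average_def emeasure_lattice_preimage[OF s S(1)]
    using nn_integral_lattice_preimage[OF s S(1) g] fin by simp
  also have "\<dots> = ennreal (cell_volume s TYPE('n) * sum (cell_mean s g) S / (card S * cell_volume s TYPE('n)))"
    using c cell_volume_pos[OF s, where 'n = 'n] cell_mean_nonneg[OF s, of g]
    by (intro divide_ennreal) (auto intro!: mult_nonneg_nonneg sum_nonneg)
  finally show ?thesis
    using cell_volume_pos[OF s, where 'n = 'n] by (simp add: box_average_def)
qed

section \<open>Cell means of weights with locally integrable dual weights\<close>

lemma powr_prod: "(\<Prod>i\<in>I. f i :: real) powr a = (\<Prod>i\<in>I. f i powr a)"
  by (induction I rule: infinite_finite_induct) (auto simp: powr_mult)

text \<open>\<open>A\<close> is the A_P condition with an explicit constant. It alone would admit an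
  infinite integral of a dual weight next to a vanishing mean of the product weight;
  \<open>dual_finite\<close> excludes this.\<close>

locale locally_finite_multiple_weight =
  fixes m :: nat and p K :: real and P :: "nat \<Rightarrow> real" and w :: "nat \<Rightarrow> real ^ 'n \<Rightarrow> real"
  assumes m: "1 \<le> m"
    and P: "\<And>j. j \<in> {1..m} \<Longrightarrow> 1 < P j"
    and p: "1 / p = (\<Sum>j=1..m. 1 / P j)"
    and w: "\<And>j. j \<in> {1..m} \<Longrightarrow> weight (w j)"
    and K: "0 \<le> K"
    and A: "\<And>R. R \<in> open_rectangles \<Longrightarrow> average R (\<lambda>x. ennreal (product_weight m p P w x)) *
        (\<Prod>j=1..m. average R (\<lambda>x. ennreal (w j x) epowr (1 - conj_exponent (P j))) epowr (p / conj_exponent (P j)))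
        \<le> ennreal K"
    and dual_finite: "\<And>R j. R \<in> open_rectangles \<Longrightarrow> j \<in> {1..m} \<Longrightarrow>
        (\<integral>\<^sup>+x\<in>R. ennreal (w j x) epowr (1 - conj_exponent (P j)) \<partial>lebesgue) \<noteq> top"
begin

abbreviation \<nu> :: "real ^ 'n \<Rightarrow> ennreal" where
  "\<nu> x \<equiv> ennreal (product_weight m p P w x)"

abbreviation \<sigma> :: "nat \<Rightarrow> real ^ 'n \<Rightarrow> ennreal" where
  "\<sigma> j x \<equiv> ennreal (w j x) epowr (1 - conj_exponent (P j))"

abbreviation e :: "nat \<Rightarrow> real" where
  "e j \<equiv> p * (1 - 1 / P j)"

lemma p_pos: "0 < p" and sum_p_div_P: "(\<Sum>j=1..m. p / P j) = 1"
  using harmonic_exponent[where m = m and P = P and p = p] m P p by blast+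

lemma p_div_P_pos: "j \<in> {1..m} \<Longrightarrow> 0 < p / P j"
  using p_pos P[of j] by simp

lemma exponent_eq: "j \<in> {1..m} \<Longrightarrow> p / conj_exponent (P j) = e j"
  using inverse_conj_exponent[OF P, of j] by (metis mult.right_neutral times_divide_eq_right)

lemma e_pos: "j \<in> {1..m} \<Longrightarrow> 0 < e j"
  using p_pos P[of j] by simp

lemma sum_e: "(\<Sum>j=1..m. e j) = m * p - 1"
proof -
  have "(\<Sum>j=1..m. e j) = (\<Sum>j=1..m. p - p / P j)" by (simp add: algebra_simps)
  then show ?thesis using sum_p_div_P by (simp add: sum_subtractf)
qed

lemma w_measurable [measurable]: "j \<in> {1..m} \<Longrightarrow> w j \<in> borel_measurable lebesgue"
  and w_nonneg: "j \<in> {1..m} \<Longrightarrow> 0 \<le> w j x"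
  using w by (auto simp: weight_def)

lemma \<nu>_measurable [measurable]: "\<nu> \<in> borel_measurable lebesgue"
  using product_weight_measurable[OF w] by simp

lemma \<sigma>_measurable [measurable]: "j \<in> {1..m} \<Longrightarrow> \<sigma> j \<in> borel_measurable lebesgue"
  by measurable

text \<open>The dual means are nonzero, so a finite A_P product forces a finite mean of the product
  weight.\<close>

lemma \<nu>_finite:
  assumes R: "R \<in> open_rectangles"
  shows "(\<integral>\<^sup>+x\<in>R. \<nu> x \<partial>lebesgue) \<noteq> top"
proof -
  note Rf = emeasure_open_rectangle[OF R]
  have "(\<Prod>j=1..m. average R (\<sigma> j) epowr (p / conj_exponent (P j))) \<noteq> 0"
    using average_dual_weight_nonzero[OF R w P] e_pos exponent_eq by (auto simp: epowr_eq_0_iff)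
  moreover have "average R \<nu> * (\<Prod>j=1..m. average R (\<sigma> j) epowr (p / conj_exponent (P j))) \<noteq> top"
    using A[OF R] by (auto simp: top_unique)
  ultimately have "average R \<nu> \<noteq> top" by (auto simp: ennreal_mult_eq_top_iff)
  then show ?thesis
    unfolding nn_integral_eq_average[OF Rf(1,2)] using Rf(2) by (auto simp: ennreal_mult_eq_top_iff)
qed

text \<open>At a zero of \<open>w j\<close> the dual weight is \<infinity>, but it is integrable
  over each cube of a countable exhaustion and therefore finite almost everywhere.\<close>

lemma AE_w_pos: "AE x in lebesgue. \<forall>j\<in>{1..m}. 0 < w j x"
proof -
  have cube: "(centered_cube k :: (real ^ 'n) set) \<in> sets lebesgue" for k
    by (rule emeasure_open_rectangle(3)[OF centered_cube_open_rectangle])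
  have "AE x in lebesgue. \<sigma> j x * indicator (centered_cube k) x \<noteq> \<infinity>" if j: "j \<in> {1..m}" for j k
    using dual_finite[OF centered_cube_open_rectangle j, of k] j cube[of k]
    by (intro nn_integral_noteq_infinite) auto
  then have "AE x in lebesgue. \<forall>j\<in>{1..m}. \<forall>k. \<sigma> j x * indicator (centered_cube k) x \<noteq> \<infinity>"
    by (intro AE_finite_allI) (auto simp: AE_all_countable)
  then show ?thesis
  proof eventually_elim
    case (elim x)
    show ?case
    proof
      fix j assume j: "j \<in> {1..m}"
      obtain k where "x \<in> centered_cube k" by (rule centered_cube_cover)
      then have "\<sigma> j x \<noteq> \<infinity>" using elim j by (metis indicator_simps(1) mult.right_neutral)
      then have "w j x \<noteq> 0"
        using P[OF j] one_minus_conj_exponent[OF P[OF j]] by (auto simp: ennpowr_def split: if_splits)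
      then show "0 < w j x" using w_nonneg[OF j, of x] by simp
    qed
  qed
qed

lemma \<sigma>_eq: "j \<in> {1..m} \<Longrightarrow> 0 < w j x \<Longrightarrow> \<sigma> j x = ennreal (w j x powr - (1 / (P j - 1)))"
  using one_minus_conj_exponent[OF P, of j] by (simp add: epowr_ennreal)

lemma cell_finite:
  assumes s: "0 < s" and "\<And>R. R \<in> open_rectangles \<Longrightarrow> (\<integral>\<^sup>+x\<in>R. g x \<partial>lebesgue) \<noteq> top"
  shows "(\<integral>\<^sup>+x\<in>lattice_point s -` {z}. g x \<partial>lebesgue) \<noteq> top"
  using assms(2)[OF lattice_rectangle_open_rectangle[OF s order_refl]]
    nn_integral_lattice_rectangle[OF s, where a = z and b = z and g = g] by simp

lemmas cell_\<nu>_finite = cell_finite[OF _ \<nu>_finite]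
lemmas cell_\<sigma>_finite = cell_finite[OF _ dual_finite]

text \<open>The A_P condition on the corresponding lattice rectangle, with means turned into sums:
  the weight \<open>\<nu>\<close> contributes one power of the cardinality, the dual weights
  \<open>m * p - 1\<close>.\<close>

lemma discrete_upper:
  assumes s: "0 < s" and R: "R \<in> subboxes UNIV B"
  shows "sum (cell_mean s \<nu>) R * (\<Prod>j=1..m. sum (cell_mean s (\<sigma> j)) R powr e j) \<le> K * real (card R) powr (m * p)"
proof -
  obtain a b where ab: "R = {a..b}" "a \<le> b" using R by (rule subboxesE) blast
  note R' = subboxesD[OF R]
  let ?L = "lattice_rectangle s a b"
  let ?c = "real (card R)"
  have c: "0 < ?c" using R'(4) by simp
  have L: "?L \<in> open_rectangles" by (rule lattice_rectangle_open_rectangle[OF s ab(2)])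
  have avg: "average ?L g = ennreal (box_average (cell_mean s g) R)"
    if "g \<in> borel_measurable lebesgue" "\<And>z. (\<integral>\<^sup>+x\<in>lattice_point s -` {z}. g x \<partial>lebesgue) \<noteq> top" for g
    unfolding average_lattice_rectangle[OF s] ab(1)[symmetric]
    using that by (intro average_lattice_preimage s R'(2,3))
  have b0: "0 \<le> box_average (cell_mean s g) R" for g :: "real ^ 'n \<Rightarrow> ennreal"
    unfolding box_average_def using cell_mean_nonneg[OF s] by (intro divide_nonneg_nonneg sum_nonneg) auto
  have "ennreal (box_average (cell_mean s \<nu>) R * (\<Prod>j=1..m. box_average (cell_mean s (\<sigma> j)) R powr e j))
      = average ?L \<nu> * (\<Prod>j=1..m. average ?L (\<sigma> j) epowr (p / conj_exponent (P j)))"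
  proof -
    have "average ?L (\<sigma> j) epowr (p / conj_exponent (P j)) = ennreal (box_average (cell_mean s (\<sigma> j)) R powr e j)"
      if j: "j \<in> {1..m}" for j
      unfolding exponent_eq[OF j] using avg[OF \<sigma>_measurable[OF j] cell_\<sigma>_finite[OF s _ j]] b0 e_pos[OF j]
      by (simp add: epowr_ennreal)
    then show ?thesis
      using avg[OF \<nu>_measurable cell_\<nu>_finite[OF s]] b0 by (simp add: ennreal_mult prod_nonneg prod_ennreal)
  qed
  then have "ennreal (box_average (cell_mean s \<nu>) R * (\<Prod>j=1..m. box_average (cell_mean s (\<sigma> j)) R powr e j)) \<le> ennreal K"
    using A[OF L] by simp
  then have "box_average (cell_mean s \<nu>) R * (\<Prod>j=1..m. box_average (cell_mean s (\<sigma> j)) R powr e j) \<le> K"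
    using K by simp
  moreover have "(\<Prod>j=1..m. box_average (cell_mean s (\<sigma> j)) R powr e j)
      = (\<Prod>j=1..m. sum (cell_mean s (\<sigma> j)) R powr e j) / ?c powr (m * p - 1)"
  proof -
    have "(\<Prod>j=1..m. ?c powr e j) = ?c powr (m * p - 1)"
      using powr_sum[of ?c e "{1..m}"] c unfolding sum_e by simp
    then show ?thesis unfolding box_average_def by (simp add: powr_divide prod_dividef)
  qed
  ultimately have "sum (cell_mean s \<nu>) R * (\<Prod>j=1..m. sum (cell_mean s (\<sigma> j)) R powr e j) / (?c * ?c powr (m * p - 1)) \<le> K"
    unfolding box_average_def by (simp add: mult.commute)
  moreover have "?c * ?c powr (m * p - 1) = ?c powr (m * p)" using c by (simp add: powr_mult_base)
  ultimately show ?thesis using c by (simp add: divide_le_eq)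
qed

text \<open>Almost everywhere \<open>\<nu>\<close> times the product of the
  \<open>\<sigma> j\<close> in the powers \<open>e j\<close> equals 1, since the powers of each
  \<open>w j\<close> cancel. Hoelder's inequality over the union of the cells, with weights
  \<open>1 / (m * p)\<close> and \<open>e j / (m * p)\<close>, turns this identity into a bound for
  its volume. The set \<open>A\<close> may have any shape.\<close>

lemma discrete_lower:
  assumes s: "0 < s" and A: "finite A"
  shows "real (card A) powr (m * p) \<le> sum (cell_mean s \<nu>) A * (\<Prod>j=1..m. sum (cell_mean s (\<sigma> j)) A powr e j)"
proof -
  have mp: "0 < m * p" using m p_pos by simp
  define \<theta> where "\<theta> = (\<lambda>i. if i = 0 then 1 / (m * p) else e i / (m * p))"
  define g where "g = (\<lambda>i. if i = 0 then \<nu> else \<sigma> i)"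
  define t where "t = (\<lambda>i. sum (cell_mean s (g i)) A)"
  let ?I = "{0..m}" and ?v = "cell_volume s TYPE('n)" and ?Q = "lattice_point s -` A :: (real ^ 'n) set"
  have I: "?I = insert 0 {1..m}" by auto
  have \<theta>pos: "0 < \<theta> i" if "i \<in> ?I" for i
    using that divide_pos_pos[OF e_pos[of i] mp] divide_pos_pos[OF zero_less_one mp] unfolding \<theta>_def by auto
  have \<theta>sum: "sum \<theta> ?I = 1"
  proof -
    have "sum \<theta> ?I = 1 / (m * p) + (\<Sum>j=1..m. e j / (m * p))" unfolding I by (simp add: \<theta>_def)
    also have "\<dots> = 1 / (m * p) + (m * p - 1) / (m * p)" unfolding sum_divide_distrib[symmetric] sum_e ..
    finally show ?thesis using p_pos m by (simp add: diff_divide_distrib)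
  qed
  have gm: "g i \<in> borel_measurable lebesgue" if "i \<in> ?I" for i using that by (auto simp: g_def)
  have gfin: "(\<integral>\<^sup>+x\<in>lattice_point s -` {z}. g i x \<partial>lebesgue) \<noteq> top" if "i \<in> ?I" for i z
    using cell_\<nu>_finite[OF s] cell_\<sigma>_finite[OF s] that by (cases "i = 0") (auto simp: g_def)
  have Q: "?Q \<in> sets lebesgue" by (rule sets_lattice_preimage[OF A])
  have v: "0 < ?v" by (rule cell_volume_pos[OF s])
  have t0: "0 \<le> t i" for i unfolding t_def using cell_mean_nonneg[OF s] by (intro sum_nonneg) auto
  have "AE x in lebesgue. indicator ?Q x \<le> (\<Prod>i\<in>?I. (g i x * indicator ?Q x) epowr \<theta> i)"
    using AE_w_pos
  proof eventually_elim
    case (elim x)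
    then have wx: "0 < w j x" if "j \<in> {1..m}" for j using that by blast
    have "(\<Prod>i\<in>?I. g i x epowr \<theta> i) = \<nu> x epowr (1 / (m * p)) * (\<Prod>j=1..m. \<sigma> j x epowr (e j / (m * p)))"
      unfolding I by (simp add: \<theta>_def g_def)
    also have "(\<Prod>j=1..m. \<sigma> j x epowr (e j / (m * p))) = (\<Prod>j=1..m. ennreal ((w j x powr - (1 / (P j - 1))) powr (e j / (m * p))))"
    proof (intro prod.cong refl)
      fix j assume j: "j \<in> {1..m}"
      show "\<sigma> j x epowr (e j / (m * p)) = ennreal ((w j x powr - (1 / (P j - 1))) powr (e j / (m * p)))"
        unfolding \<sigma>_eq[OF j wx[OF j]] using wx[OF j] by (intro epowr_ennreal) auto
    qed
    also have "\<nu> x epowr (1 / (m * p)) = ennreal ((\<Prod>j=1..m. w j x powr (p / P j)) powr (1 / (m * p)))"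
      unfolding product_weight_def using wx mp by (intro epowr_ennreal) (auto intro!: prod_pos simp: less_imp_neq[symmetric])
    also have "\<dots> * (\<Prod>j=1..m. ennreal ((w j x powr - (1 / (P j - 1))) powr (e j / (m * p))))
      = ennreal (\<Prod>j=1..m. (w j x powr (p / P j)) powr (1 / (m * p)) * (w j x powr - (1 / (P j - 1))) powr (e j / (m * p)))"
      unfolding powr_prod prod.distrib by (simp add: prod_ennreal ennreal_mult prod_nonneg)
    also have "\<dots> = ennreal (\<Prod>j=1..m. 1)"
    proof (intro arg_cong[where f = ennreal] prod.cong refl)
      fix j assume j: "j \<in> {1..m}"
      have "p / P j * (1 / (m * p)) + - (1 / (P j - 1)) * (e j / (m * p)) = 0"
      proof -
        have "1 - 1 / P j = (P j - 1) / P j" using P[OF j] by (simp add: diff_divide_distrib)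
        then show ?thesis using P[OF j] p_pos by simp
      qed
      then show "(w j x powr (p / P j)) powr (1 / (m * p)) * (w j x powr - (1 / (P j - 1))) powr (e j / (m * p)) = 1"
        unfolding powr_powr powr_add[symmetric] using wx[OF j] by simp
    qed
    finally have "(\<Prod>i\<in>?I. g i x epowr \<theta> i) = 1" by simp
    then show ?case by (cases "x \<in> ?Q") auto
  qed
  then have "(\<integral>\<^sup>+x. indicator ?Q x \<partial>lebesgue) \<le> (\<integral>\<^sup>+x. (\<Prod>i\<in>?I. (g i x * indicator ?Q x) epowr \<theta> i) \<partial>lebesgue)"
    by (rule nn_integral_mono_AE)
  also have "\<dots> \<le> (\<Prod>i\<in>?I. (\<integral>\<^sup>+x\<in>?Q. g i x \<partial>lebesgue) epowr \<theta> i)"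
    using \<theta>pos \<theta>sum gm Q by (intro nn_integral_hoelder) auto
  also have "\<dots> = (\<Prod>i\<in>?I. ennreal ((?v * t i) powr \<theta> i))"
  proof (intro prod.cong refl)
    fix i assume i: "i \<in> ?I"
    have "(\<integral>\<^sup>+x\<in>?Q. g i x \<partial>lebesgue) = ennreal (?v * t i)"
      unfolding t_def using nn_integral_lattice_preimage[OF s A gm[OF i] gfin[OF i]] by simp
    then show "(\<integral>\<^sup>+x\<in>?Q. g i x \<partial>lebesgue) epowr \<theta> i = ennreal ((?v * t i) powr \<theta> i)"
      using \<theta>pos[OF i] v t0[of i] by (simp add: epowr_ennreal)
  qed
  also have "\<dots> = ennreal (\<Prod>i\<in>?I. ?v powr \<theta> i * t i powr \<theta> i)"
    by (simp add: prod_ennreal powr_mult)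
  \<comment> \<open>The weights add up to 1, so the cell volume comes out to the first power and
    cancels against the left side.\<close>
  also have "(\<Prod>i\<in>?I. ?v powr \<theta> i * t i powr \<theta> i) = ?v * (\<Prod>i\<in>?I. t i powr \<theta> i)"
    unfolding prod.distrib using powr_sum[of ?v \<theta> ?I] v \<theta>sum by simp
  also have "(\<integral>\<^sup>+x. indicator ?Q x \<partial>lebesgue) = ennreal (card A * ?v)"
    using Q by (simp only: nn_integral_indicator emeasure_lattice_preimage[OF s A])
  finally have "card A * ?v \<le> ?v * (\<Prod>i\<in>?I. t i powr \<theta> i)"
    using v by (simp add: prod_nonneg ennreal_le_iff)
  then have "card A \<le> (\<Prod>i\<in>?I. t i powr \<theta> i)" using v by simp
  then have "real (card A) powr (m * p) \<le> (\<Prod>i\<in>?I. t i powr \<theta> i) powr (m * p)"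
    using mp by (intro powr_mono2) auto
  also have "\<dots> = (\<Prod>i\<in>?I. t i powr (\<theta> i * (m * p)))" unfolding powr_prod powr_powr ..
  also have "\<dots> = t 0 powr 1 * (\<Prod>j=1..m. t j powr e j)"
  proof -
    have cancel: "a / (m * p) * (m * p) = a" for a :: real
      unfolding times_divide_eq_left by (rule nonzero_mult_div_cancel_right) (use mp in linarith)
    have "\<theta> j * (m * p) = e j" if "j \<in> {1..m}" for j
    proof -
      have "\<theta> j = e j / (m * p)" using that by (auto simp: \<theta>_def)
      then show ?thesis by (simp only: cancel)
    qed
    then have "(\<Prod>i=1..m. t i powr (\<theta> i * (m * p))) = (\<Prod>j=1..m. t j powr e j)"
      by (intro prod.cong refl) (simp only:)
    moreover have "\<theta> 0 * (m * p) = 1" using cancel[of 1] by (simp only: \<theta>_def if_True simp_thms)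
    ultimately show ?thesis unfolding I by simp
  qed
  also have "\<dots> = sum (cell_mean s \<nu>) A * (\<Prod>j=1..m. sum (cell_mean s (\<sigma> j)) A powr e j)"
    using t0[of 0] by (simp add: powr_one t_def g_def)
  finally show ?thesis .
qed

text \<open>The same \<open>K\<close> serves for every mesh and every window, so a single discrete
  constant covers all of them.\<close>

lemma discrete_weight:
  assumes s: "0 < s" and B: "finite B"
  shows "discrete_multiple_weight m p K P B (cell_mean s \<nu>) (\<lambda>j. cell_mean s (\<sigma> j))"
proof
  show "0 < p" by (rule p_pos)
  show "1 / p = (\<Sum>j=1..m. 1 / P j)" by (rule p)
  show "real (card A) powr (real m * p) \<le> sum (cell_mean s \<nu>) A * (\<Prod>j=1..m. sum (cell_mean s (\<sigma> j)) A powr e j)"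
    if "A \<subseteq> B" for A
    using that B finite_subset by (intro discrete_lower s) blast
qed (use P K B cell_mean_nonneg[OF s] discrete_upper[OF s] in auto)

text \<open>Almost everywhere |f| is the product of (|f|^P w)^(1/P) and the dual weight to the power
  1 - 1/P: the two powers of \<open>w j\<close> cancel where it is positive.\<close>

lemma nn_integral_cell_hoelder:
  assumes j: "j \<in> {1..m}" and f [measurable]: "f \<in> borel_measurable lebesgue"
    and Q [measurable]: "Q \<in> sets lebesgue"
  shows "(\<integral>\<^sup>+x\<in>Q. ennreal \<bar>f x\<bar> \<partial>lebesgue)
    \<le> (\<integral>\<^sup>+x\<in>Q. ennreal \<bar>f x\<bar> epowr P j * ennreal (w j x) \<partial>lebesgue) epowr (1 / P j)
      * (\<integral>\<^sup>+x\<in>Q. \<sigma> j x \<partial>lebesgue) epowr (1 - 1 / P j)"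
proof -
  define g where "g = (\<lambda>i x. (if i then ennreal \<bar>f x\<bar> epowr P j * ennreal (w j x) else \<sigma> j x) * indicator Q x)"
  define \<theta> where "\<theta> = (\<lambda>i. if i then 1 / P j else 1 - 1 / P j)"
  have P1: "0 < 1 / P j" "0 < 1 - 1 / P j" "0 < P j" using P[OF j] by auto
  note [measurable] = w_measurable[OF j]
  have "AE x in lebesgue. ennreal \<bar>f x\<bar> * indicator Q x \<le> (\<Prod>i\<in>UNIV. g i x epowr \<theta> i)"
    using AE_w_pos
  proof eventually_elim
    case (elim x)
    then have wx: "0 < w j x" using j by blast
    have "(ennreal \<bar>f x\<bar> epowr P j * ennreal (w j x)) epowr (1 / P j) * \<sigma> j x epowr (1 - 1 / P j)
        = ennreal \<bar>f x\<bar> * (ennreal (w j x powr (1 / P j)) * ennreal ((w j x powr - (1 / (P j - 1))) powr (1 - 1 / P j)))"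
      using P1 wx by (simp add: epowr_mult epowr_epowr \<sigma>_eq[OF j wx] epowr_ennreal powr_powr mult.assoc)
    also have "ennreal (w j x powr (1 / P j)) * ennreal ((w j x powr - (1 / (P j - 1))) powr (1 - 1 / P j)) = 1"
    proof -
      have "1 / P j + - (1 / (P j - 1)) * (1 - 1 / P j) = 0" using P[OF j] by (simp add: field_simps)
      then have "w j x powr (1 / P j) * (w j x powr - (1 / (P j - 1))) powr (1 - 1 / P j) = 1"
        unfolding powr_powr powr_add[symmetric] using wx by simp
      then show ?thesis by (simp flip: ennreal_mult)
    qed
    finally show ?case by (cases "x \<in> Q") (simp_all add: UNIV_bool g_def \<theta>_def mult.commute)
  qed
  then have "(\<integral>\<^sup>+x\<in>Q. ennreal \<bar>f x\<bar> \<partial>lebesgue) \<le> (\<integral>\<^sup>+x. (\<Prod>i\<in>UNIV. g i x epowr \<theta> i) \<partial>lebesgue)"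
    by (rule nn_integral_mono_AE)
  also have "\<dots> \<le> (\<Prod>i\<in>UNIV. (\<integral>\<^sup>+x. g i x \<partial>lebesgue) epowr \<theta> i)"
  proof (rule nn_integral_hoelder)
    show "g i \<in> borel_measurable lebesgue" for i unfolding g_def by (cases i) auto
  qed (use P1 in \<open>auto simp: UNIV_bool \<theta>_def\<close>)
  finally show ?thesis by (simp add: UNIV_bool g_def \<theta>_def mult.commute)
qed

end

section \<open>From the lattice back to functions on the whole space\<close>

lemma divide_le_mult_divide_ennreal:
  fixes a b c x :: ennreal
  assumes "b \<le> c * a" "a \<noteq> 0" "a \<noteq> top" "b \<noteq> 0" "b \<noteq> top"
  shows "x / a \<le> c * (x / b)"
proof (cases "c = top")
  case True
  then show ?thesis using assms by (cases "x = 0") (auto simp: ennreal_top_mult ennreal_divide_eq_0_iff)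
next
  case False
  obtain \<alpha> where \<alpha>: "a = ennreal \<alpha>" "0 < \<alpha>" using assms(2,3) by (cases a) (auto simp: less_le)
  obtain \<beta> where \<beta>: "b = ennreal \<beta>" "0 < \<beta>" using assms(4,5) by (cases b) (auto simp: less_le)
  obtain \<gamma> where \<gamma>: "c = ennreal \<gamma>" "0 \<le> \<gamma>" using False by (cases c) auto
  have "\<beta> \<le> \<gamma> * \<alpha>" using assms(1) \<alpha> \<beta> \<gamma> by (simp add: ennreal_mult[symmetric] ennreal_le_iff)
  then have "1 / \<alpha> \<le> \<gamma> * (1 / \<beta>)" using \<alpha>(2) \<beta>(2) by (simp add: field_simps)
  then have "inverse a \<le> c * inverse b"
    using \<alpha> \<beta> \<gamma> by (simp add: inverse_ennreal ennreal_mult[symmetric] inverse_eq_divide)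
  then have "x * inverse a \<le> x * (c * inverse b)" by (rule mult_left_mono) simp
  then show ?thesis by (simp add: divide_ennreal_def mult_ac)
qed

lemma argmax_choice:
  fixes V :: "'b \<Rightarrow> real"
  assumes "finite F" "\<And>x. x \<in> X \<Longrightarrow> \<exists>R\<in>F. Q x R"
  obtains r where "\<And>x. x \<in> X \<Longrightarrow> r x \<in> F \<and> Q x (r x)" "\<And>x R. x \<in> X \<Longrightarrow> R \<in> F \<Longrightarrow> Q x R \<Longrightarrow> V R \<le> V (r x)"
proof -
  have "\<exists>R. (R \<in> F \<and> Q x R) \<and> (\<forall>S\<in>F. Q x S \<longrightarrow> V S \<le> V R)" if "x \<in> X" for x
  proof -
    let ?G = "{R \<in> F. Q x R}"
    have "finite (V ` ?G)" "V ` ?G \<noteq> {}" using assms that by auto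
    then have "Max (V ` ?G) \<in> V ` ?G" "\<And>S. S \<in> ?G \<Longrightarrow> V S \<le> Max (V ` ?G)" by (auto intro: Max_in)
    then show ?thesis by auto
  qed
  then obtain r where "\<And>x. x \<in> X \<Longrightarrow> (r x \<in> F \<and> Q x (r x)) \<and> (\<forall>S\<in>F. Q x S \<longrightarrow> V S \<le> V (r x))"
    by metis
  then show ?thesis using that by blast
qed

context locally_finite_multiple_weight
begin

lemma nn_integral_cell_\<nu>:
  assumes s: "0 < s"
  shows "(\<integral>\<^sup>+x\<in>lattice_point s -` {z}. \<nu> x \<partial>lebesgue) = ennreal (cell_volume s TYPE('n) * cell_mean s \<nu> z)"
  by (rule nn_integral_cell[OF s]) (rule cell_finite[OF s \<nu>_finite])

lemma nn_integral_cell_\<sigma>: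
  assumes s: "0 < s" and j: "j \<in> {1..m}"
  shows "(\<integral>\<^sup>+x\<in>lattice_point s -` {z}. \<sigma> j x \<partial>lebesgue) = ennreal (cell_volume s TYPE('n) * cell_mean s (\<sigma> j) z)"
  by (rule nn_integral_cell[OF s]) (rule cell_finite[OF s dual_finite[OF _ j]])

context
  fixes f :: "nat \<Rightarrow> real ^ 'n \<Rightarrow> real"
  assumes loc: "\<And>j. j \<in> {1..m} \<Longrightarrow> locally_integrable (f j)"
    and Lsp: "\<And>j. j \<in> {1..m} \<Longrightarrow> in_Lspace (P j) (w j) (f j)"
begin

abbreviation H :: "nat \<Rightarrow> real ^ 'n \<Rightarrow> ennreal" where
  "H j x \<equiv> ennreal \<bar>f j x\<bar> epowr P j * ennreal (w j x)"

abbreviation fd :: "real \<Rightarrow> nat \<Rightarrow> ('n \<Rightarrow> int) \<Rightarrow> real" where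
  "fd s j \<equiv> cell_mean s (\<lambda>x. ennreal \<bar>f j x\<bar>)"

abbreviation V :: "real \<Rightarrow> ('n \<Rightarrow> int) set \<Rightarrow> real" where
  "V s R \<equiv> \<Prod>j=1..m. box_average (fd s j) R"

lemma f_measurable [measurable]: "j \<in> {1..m} \<Longrightarrow> f j \<in> borel_measurable lebesgue"
  using Lsp by (auto simp: in_Lspace_def)

lemma f_finite:
  assumes j: "j \<in> {1..m}" and R: "R \<in> open_rectangles"
  shows "(\<integral>\<^sup>+x\<in>R. ennreal \<bar>f j x\<bar> \<partial>lebesgue) \<noteq> top"
proof -
  have "compact (closure R)" using emeasure_open_rectangle(5)[OF R] by simp
  then have "integrable lebesgue (\<lambda>x. indicat_real (closure R) x *\<^sub>R f j x)"
    using loc[OF j] unfolding locally_integrable_def set_integrable_def by blast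
  then have "(\<integral>\<^sup>+x. ennreal (norm (indicat_real (closure R) x *\<^sub>R f j x)) \<partial>lebesgue) < \<infinity>"
    by (simp add: integrable_iff_bounded)
  moreover have "(\<integral>\<^sup>+x\<in>R. ennreal \<bar>f j x\<bar> \<partial>lebesgue) \<le> (\<integral>\<^sup>+x. ennreal (norm (indicat_real (closure R) x *\<^sub>R f j x)) \<partial>lebesgue)"
    using closure_subset[of R] by (intro nn_integral_mono) (auto simp: indicator_def)
  ultimately show ?thesis by (auto simp: top_unique)
qed

lemmas cell_f_finite = cell_finite[OF _ f_finite]

lemma H_finite:
  assumes j: "j \<in> {1..m}"
  shows "(\<integral>\<^sup>+x. H j x \<partial>lebesgue) \<noteq> top"
  using Lsp[OF j] P[OF j] by (auto simp: in_Lspace_def Lnorm_def epowr_eq_top_iff)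

lemma H_set_le: "(\<integral>\<^sup>+x\<in>Q. H j x \<partial>lebesgue) \<le> (\<integral>\<^sup>+x. H j x \<partial>lebesgue)"
  by (intro nn_integral_mono) (auto simp: indicator_def)

lemma cell_H_finite:
  "j \<in> {1..m} \<Longrightarrow> (\<integral>\<^sup>+x\<in>lattice_point s -` {z}. H j x \<partial>lebesgue) \<noteq> top"
  using H_finite[of j] H_set_le[of j "lattice_point s -` {z}"] by (auto simp: top_unique)

lemma H_measurable [measurable]: "j \<in> {1..m} \<Longrightarrow> H j \<in> borel_measurable lebesgue"
  by measurable

text \<open>Provides the majorant demanded by the discrete theorem, with \<open>h j\<close> the
  power \<open>1 / P j\<close> of the cell means of \<open>H j\<close>. The volume powers add up to
  1 and cancel.\<close>

lemma cell_hoelder: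
  assumes s: "0 < s" and j: "j \<in> {1..m}"
  shows "fd s j z \<le> cell_mean s (H j) z powr (1 / P j) * cell_mean s (\<sigma> j) z powr (1 - 1 / P j)"
proof -
  let ?Q = "lattice_point s -` {z} :: (real ^ 'n) set" and ?v = "cell_volume s TYPE('n)"
  let ?a = "cell_mean s (H j) z" and ?b = "cell_mean s (\<sigma> j) z"
  have v: "0 < ?v" by (rule cell_volume_pos[OF s])
  have P1: "0 < 1 / P j" "0 < 1 - 1 / P j" using P[OF j] by auto
  have nn: "0 \<le> ?a" "0 \<le> ?b" using cell_mean_nonneg[OF s] by auto
  have "ennreal (?v * fd s j z) = (\<integral>\<^sup>+x\<in>?Q. ennreal \<bar>f j x\<bar> \<partial>lebesgue)"
    by (rule nn_integral_cell[OF s cell_f_finite[OF s j], symmetric])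
  also have "\<dots> \<le> (\<integral>\<^sup>+x\<in>?Q. H j x \<partial>lebesgue) epowr (1 / P j) * (\<integral>\<^sup>+x\<in>?Q. \<sigma> j x \<partial>lebesgue) epowr (1 - 1 / P j)"
    by (intro nn_integral_cell_hoelder j f_measurable sets_lattice_preimage) auto
  also have "\<dots> = ennreal (?v * ?a) epowr (1 / P j) * ennreal (?v * ?b) epowr (1 - 1 / P j)"
    unfolding nn_integral_cell[OF s cell_H_finite[OF j]] nn_integral_cell_\<sigma>[OF s j] ..
  also have "\<dots> = ennreal ((?v * ?a) powr (1 / P j) * (?v * ?b) powr (1 - 1 / P j))"
  proof -
    have "ennreal (?v * c) epowr u = ennreal ((?v * c) powr u)" if "0 \<le> c" "0 < u" for c u
      by (rule epowr_ennreal) (use v that in auto)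
    then show ?thesis using nn P1 by (simp only: ennreal_mult[symmetric] powr_ge_zero)
  qed
  also have "(?v * ?a) powr (1 / P j) * (?v * ?b) powr (1 - 1 / P j)
      = (?v powr (1 / P j) * ?v powr (1 - 1 / P j)) * (?a powr (1 / P j) * ?b powr (1 - 1 / P j))"
    by (simp only: powr_mult mult_ac)
  also have "?v powr (1 / P j) * ?v powr (1 - 1 / P j) = ?v"
    using v by (simp flip: powr_add)
  finally have "?v * fd s j z \<le> ?v * (?a powr (1 / P j) * ?b powr (1 - 1 / P j))"
    using v by (simp add: ennreal_le_iff)
  then show ?thesis using v by simp
qed

lemma V_nonneg: "0 < s \<Longrightarrow> 0 \<le> V s R"
  unfolding box_average_def by (intro prod_nonneg ballI divide_nonneg_nonneg sum_nonneg cell_mean_nonneg) auto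

text \<open>Multiplication by the cell volume turns the sums into integrals. On the right its powers
  \<open>p / P j\<close> add up to 1, so no factor depending on the mesh remains.\<close>

lemma discretised_integral_le:
  assumes s: "0 < s" and B: "finite B"
    and C: "0 \<le> C" "(\<Sum>z\<in>B. cell_mean s \<nu> z * V s (r z) powr p)
      \<le> C * (\<Prod>j=1..m. (\<Sum>z\<in>B. cell_mean s (H j) z) powr (p / P j))"
  shows "(\<integral>\<^sup>+x. (\<Sum>z\<in>B. ennreal (V s (r z) powr p) * indicator (lattice_point s -` {z}) x) * \<nu> x \<partial>lebesgue)
    \<le> ennreal C * (\<Prod>j=1..m. Lnorm (P j) (w j) (\<lambda>x. ennreal \<bar>f j x\<bar>) epowr p)"
proof -
  let ?v = "cell_volume s TYPE('n)"
  let ?S = "\<lambda>j. \<Sum>z\<in>B. cell_mean s (H j) z"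
  have v: "0 < ?v" by (rule cell_volume_pos[OF s])
  have S0: "0 \<le> ?S j" for j using cell_mean_nonneg[OF s] by (intro sum_nonneg) auto
  have "(\<integral>\<^sup>+x. (\<Sum>z\<in>B. ennreal (V s (r z) powr p) * indicator (lattice_point s -` {z}) x) * \<nu> x \<partial>lebesgue)
      = (\<integral>\<^sup>+x. (\<Sum>z\<in>B. ennreal (V s (r z) powr p) * (\<nu> x * indicator (lattice_point s -` {z}) x)) \<partial>lebesgue)"
    by (simp add: sum_distrib_left sum_distrib_right mult_ac)
  also have "\<dots> = (\<Sum>z\<in>B. ennreal (V s (r z) powr p) * (\<integral>\<^sup>+x\<in>lattice_point s -` {z}. \<nu> x \<partial>lebesgue))"
  proof -
    have [measurable]: "lattice_point s -` {z} \<in> sets (lebesgue :: (real ^ 'n) measure)" for z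
      by (rule sets_lattice_preimage) simp
    show ?thesis by (subst nn_integral_sum) (auto simp: nn_integral_cmult)
  qed
  also have "\<dots> = (\<Sum>z\<in>B. ennreal (?v * (cell_mean s \<nu> z * V s (r z) powr p)))"
  proof (intro sum.cong refl)
    fix z
    show "ennreal (V s (r z) powr p) * (\<integral>\<^sup>+x\<in>lattice_point s -` {z}. \<nu> x \<partial>lebesgue)
        = ennreal (?v * (cell_mean s \<nu> z * V s (r z) powr p))"
      unfolding nn_integral_cell_\<nu>[OF s]
      using v cell_mean_nonneg[OF s, of \<nu> z] by (simp add: ennreal_mult[symmetric] mult_ac)
  qed
  also have "\<dots> = ennreal (?v * (\<Sum>z\<in>B. cell_mean s \<nu> z * V s (r z) powr p))"
    using v cell_mean_nonneg[OF s, of \<nu>] by (subst sum_ennreal) (auto simp: sum_distrib_left)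
  also have "\<dots> \<le> ennreal (?v * (C * (\<Prod>j=1..m. ?S j powr (p / P j))))"
    using C v by (intro ennreal_leI mult_left_mono) auto
  also have "?v * (C * (\<Prod>j=1..m. ?S j powr (p / P j))) = C * (\<Prod>j=1..m. (?v * ?S j) powr (p / P j))"
  proof -
    have "(\<Prod>j=1..m. ?v powr (p / P j)) = ?v"
      using powr_sum[of ?v "\<lambda>j. p / P j" "{1..m}"] v unfolding sum_p_div_P by simp
    then show ?thesis unfolding powr_mult prod.distrib by (simp add: mult_ac)
  qed
  also have "ennreal \<dots> = ennreal C * (\<Prod>j=1..m. ennreal ((?v * ?S j) powr (p / P j)))"
    using C by (simp add: ennreal_mult prod_nonneg prod_ennreal)
  also have "\<dots> \<le> ennreal C * (\<Prod>j=1..m. Lnorm (P j) (w j) (\<lambda>x. ennreal \<bar>f j x\<bar>) epowr p)"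
  proof (intro mult_left_mono prod_mono_ennreal)
    fix j assume j: "j \<in> {1..m}"
    have "ennreal ((?v * ?S j) powr (p / P j)) = ennreal (?v * ?S j) epowr (p / P j)"
      using p_div_P_pos[OF j] v S0[of j] by (simp add: epowr_ennreal)
    also have "ennreal (?v * ?S j) = (\<integral>\<^sup>+x\<in>lattice_point s -` B. H j x \<partial>lebesgue)"
      by (rule nn_integral_lattice_preimage[symmetric]) (use s B cell_H_finite[OF j] H_measurable[OF j] in auto)
    also have "\<dots> epowr (p / P j) \<le> (\<integral>\<^sup>+x. H j x \<partial>lebesgue) epowr (p / P j)"
      using p_div_P_pos[OF j] H_set_le by (intro epowr_mono)
    also have "\<dots> = Lnorm (P j) (w j) (\<lambda>x. ennreal \<bar>f j x\<bar>) epowr p"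
      unfolding Lnorm_def using P[OF j] p_pos by (simp add: epowr_epowr)
    finally show "ennreal ((?v * ?S j) powr (p / P j)) \<le> Lnorm (P j) (w j) (\<lambda>x. ennreal \<bar>f j x\<bar>) epowr p" .
  qed simp
  finally show ?thesis .
qed

text \<open>Passing to the larger lattice rectangle costs at most the volume ratio
  \<open>2 ^ CARD('n)\<close> in each of the \<open>m\<close> means.\<close>

lemma average_product_le:
  assumes s: "0 < s" and R: "R \<in> open_rectangles" and ab: "a \<le> b"
    and sub: "R \<subseteq> lattice_point s -` {a..b}"
    and vol: "emeasure lebesgue (lattice_rectangle s a b) \<le> ennreal (2 ^ CARD('n)) * emeasure lebesgue R"
  shows "(\<Prod>j=1..m. average R (\<lambda>x. ennreal \<bar>f j x\<bar>)) \<le> ennreal ((2 ^ CARD('n)) ^ m * V s {a..b})"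
proof -
  let ?L = "lattice_rectangle s a b"
  have L: "?L \<in> open_rectangles" by (rule lattice_rectangle_open_rectangle[OF s ab])
  have "average R (\<lambda>x. ennreal \<bar>f j x\<bar>) \<le> ennreal (2 ^ CARD('n)) * ennreal (box_average (fd s j) {a..b})"
    if j: "j \<in> {1..m}" for j
  proof -
    have "(\<integral>\<^sup>+x\<in>R. ennreal \<bar>f j x\<bar> \<partial>lebesgue) \<le> (\<integral>\<^sup>+x\<in>lattice_point s -` {a..b}. ennreal \<bar>f j x\<bar> \<partial>lebesgue)"
      using sub by (intro nn_integral_mono mult_left_mono) (auto simp: indicator_def)
    also have "\<dots> = (\<integral>\<^sup>+x\<in>?L. ennreal \<bar>f j x\<bar> \<partial>lebesgue)"
      by (rule nn_integral_lattice_rectangle[OF s])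
    finally have "average R (\<lambda>x. ennreal \<bar>f j x\<bar>) \<le> (\<integral>\<^sup>+x\<in>?L. ennreal \<bar>f j x\<bar> \<partial>lebesgue) / emeasure lebesgue R"
      unfolding average_def by (rule divide_right_mono_ennreal)
    also have "\<dots> \<le> ennreal (2 ^ CARD('n)) * average ?L (\<lambda>x. ennreal \<bar>f j x\<bar>)"
      unfolding average_def using emeasure_open_rectangle(1,2)[OF R] emeasure_open_rectangle(1,2)[OF L] vol
      by (intro divide_le_mult_divide_ennreal) auto
    also have "average ?L (\<lambda>x. ennreal \<bar>f j x\<bar>) = ennreal (box_average (fd s j) {a..b})"
      unfolding average_lattice_rectangle[OF s]
      by (rule average_lattice_preimage) (use s ab cell_f_finite[OF s j] f_measurable[OF j] in auto)
    finally show ?thesis .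
  qed
  moreover have b0: "0 \<le> box_average (fd s j) {a..b}" for j
    unfolding box_average_def using cell_mean_nonneg[OF s] by (intro divide_nonneg_nonneg sum_nonneg) auto
  ultimately have "(\<Prod>j=1..m. average R (\<lambda>x. ennreal \<bar>f j x\<bar>))
      \<le> (\<Prod>j=1..m. ennreal (2 ^ CARD('n)) * ennreal (box_average (fd s j) {a..b}))"
    by (intro prod_mono_ennreal)
  also have "\<dots> = (\<Prod>j=1..m. ennreal (2 ^ CARD('n) * box_average (fd s j) {a..b}))"
    using b0 by (intro prod.cong refl ennreal_mult[symmetric]) auto
  also have "\<dots> = ennreal (\<Prod>j=1..m. 2 ^ CARD('n) * box_average (fd s j) {a..b})"
    using b0 by (intro prod_ennreal) auto
  also have "(\<Prod>j=1..m. 2 ^ CARD('n) * box_average (fd s j) {a..b}) = (2 ^ CARD('n)) ^ m * V s {a..b}"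
    by (simp only: prod.distrib prod_constant card_atLeastAtMost) simp
  finally show ?thesis .
qed

text \<open>For fixed \<open>R\<close> containing \<open>x\<close>, the lattice comparison holds for
  all large \<open>N\<close>, where "large" depends on \<open>R\<close>. Each product of means is
  thus below the same liminf, hence so is their supremum, and Fatou's lemma is applied to the
  measurable step functions \<open>G N\<close>.\<close>

lemma strong_maximal_norm_le:
  assumes C: "0 \<le> C" and disc: "\<And>s B r. 0 < s \<Longrightarrow> finite B \<Longrightarrow>
      (\<And>z. z \<in> B \<Longrightarrow> r z \<in> subboxes UNIV B \<and> z \<in> r z) \<Longrightarrow>
      (\<Sum>z\<in>B. cell_mean s \<nu> z * V s (r z) powr p)
        \<le> C * (\<Prod>j=1..m. (\<Sum>z\<in>B. cell_mean s (H j) z) powr (p / P j))"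
  shows "Lnorm p (product_weight m p P w) (strong_maximal m f)
    \<le> ennreal ((((2 ^ CARD('n)) ^ m) powr p * C) powr (1 / p)) * (\<Prod>j=1..m. Lnorm (P j) (w j) (\<lambda>x. ennreal \<bar>f j x\<bar>))"
proof -
  define s :: "nat \<Rightarrow> real" where "s = (\<lambda>N. 2 ^ N)"
  define B :: "nat \<Rightarrow> ('n \<Rightarrow> int) set" where "B = (\<lambda>N. {(\<lambda>_. - int N * 2 ^ N)..(\<lambda>_. int N * 2 ^ N - 1)})"
  have s: "0 < s N" for N by (simp add: s_def)
  have B: "finite (B N)" for N by (simp add: B_def)
  \<comment> \<open>A window has finitely many boxes, so each lattice point has one on which
    \<open>V\<close> is largest; \<open>r\<close> records it.\<close>
  have "\<exists>r. (\<forall>z\<in>B N. r z \<in> subboxes UNIV (B N) \<and> z \<in> r z) \<and>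
      (\<forall>z\<in>B N. \<forall>R\<in>subboxes UNIV (B N). z \<in> R \<longrightarrow> V (s N) R \<le> V (s N) (r z))" for N
  proof -
    have "\<exists>R\<in>subboxes UNIV (B N). z \<in> R" if "z \<in> B N" for z using singleton_subboxes[OF that] by blast
    then obtain r where "\<And>z. z \<in> B N \<Longrightarrow> r z \<in> subboxes UNIV (B N) \<and> z \<in> r z"
      "\<And>z R. z \<in> B N \<Longrightarrow> R \<in> subboxes UNIV (B N) \<Longrightarrow> z \<in> R \<Longrightarrow> V (s N) R \<le> V (s N) (r z)"
      using argmax_choice[OF finite_subboxes[OF B], where X = "B N" and Q = "\<lambda>z R. z \<in> R" and V = "V (s N)"] by metis
    then show ?thesis by blast
  qed
  then obtain r where r: "\<And>N z. z \<in> B N \<Longrightarrow> r N z \<in> subboxes UNIV (B N) \<and> z \<in> r N z"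
    and rmax: "\<And>N z R. z \<in> B N \<Longrightarrow> R \<in> subboxes UNIV (B N) \<Longrightarrow> z \<in> R \<Longrightarrow> V (s N) R \<le> V (s N) (r N z)"
    by metis
  let ?k = "((2 ^ CARD('n)) ^ m) powr p :: real"
  define G where "G = (\<lambda>N x. \<Sum>z\<in>B N. ennreal (V (s N) (r N z) powr p) * indicator (lattice_point (s N) -` {z}) x :: ennreal)"
  let ?L = "\<Prod>j=1..m. Lnorm (P j) (w j) (\<lambda>x. ennreal \<bar>f j x\<bar>)"
  have Gint: "(\<integral>\<^sup>+x. G N x * \<nu> x \<partial>lebesgue) \<le> ennreal C * ?L epowr p" for N
    unfolding G_def epowr_prod[OF p_pos]
    using discretised_integral_le[OF s B C disc[OF s B]] r by blast
  have Gm: "G N \<in> borel_measurable lebesgue" for N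
  proof -
    have [measurable]: "lattice_point (s N) -` {z} \<in> sets (lebesgue :: (real ^ 'n) measure)" for z
      by (rule sets_lattice_preimage) simp
    show ?thesis unfolding G_def by measurable
  qed
  have pw: "strong_maximal m f x epowr p * \<nu> x \<le> liminf (\<lambda>N. ennreal ?k * G N x * \<nu> x)" for x
  proof -
    let ?F = "{R \<in> open_rectangles. x \<in> R}"
    \<comment> \<open>A witness that the supremum is over a nonempty family, as moving the power
      inside requires.\<close>
    have "box (x - 1) (x + 1) \<in> ?F"
      by (auto simp: open_rectangles_def mem_box_cart intro!: exI)
    then have ne: "?F \<noteq> {}" by blast
    have "strong_maximal m f x epowr p * \<nu> x = (SUP R\<in>?F. (\<Prod>j=1..m. average R (\<lambda>x. ennreal \<bar>f j x\<bar>)) epowr p * \<nu> x)"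
      unfolding strong_maximal_def SUP_epowr[OF p_pos ne] SUP_mult_right_ennreal ..
    also have "\<dots> \<le> liminf (\<lambda>N. ennreal ?k * G N x * \<nu> x)"
    proof (rule SUP_least)
      fix R assume R: "R \<in> ?F"
      then have Rr: "R \<in> open_rectangles" "x \<in> R" by auto
      show "(\<Prod>j=1..m. average R (\<lambda>x. ennreal \<bar>f j x\<bar>)) epowr p * \<nu> x \<le> liminf (\<lambda>N. ennreal ?k * G N x * \<nu> x)"
      proof (rule Liminf_bounded)
        show "\<forall>\<^sub>F N in sequentially. (\<Prod>j=1..m. average R (\<lambda>x. ennreal \<bar>f j x\<bar>)) epowr p * \<nu> x \<le> ennreal ?k * G N x * \<nu> x"
          using lattice_approximation[OF Rr(1)]
        proof eventually_elim
          case (elim N)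
          then obtain a b where ab: "a \<le> b" "{a..b} \<subseteq> B N" "R \<subseteq> lattice_point (s N) -` {a..b}"
            "emeasure lebesgue (lattice_rectangle (s N) a b) \<le> ennreal (2 ^ CARD('n)) * emeasure lebesgue R"
            unfolding s_def B_def by blast
          define z where "z = lattice_point (s N) x"
          have z: "z \<in> {a..b}" using ab(3) Rr(2) unfolding z_def by blast
          then have zB: "z \<in> B N" using ab(2) by blast
          have "{a..b} \<in> subboxes UNIV (B N)" using ab(1,2) by (intro subboxesI) auto
          then have Vle: "V (s N) {a..b} \<le> V (s N) (r N z)" by (rule rmax[OF zB _ z])
          have "(\<Prod>j=1..m. average R (\<lambda>x. ennreal \<bar>f j x\<bar>)) epowr p \<le> ennreal ((2 ^ CARD('n)) ^ m * V (s N) {a..b}) epowr p"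
            by (intro epowr_mono p_pos average_product_le s Rr ab)
          also have "\<dots> \<le> ennreal ((2 ^ CARD('n)) ^ m * V (s N) (r N z)) epowr p"
            using Vle by (intro epowr_mono p_pos ennreal_leI mult_left_mono) auto
          also have "\<dots> = ennreal (((2 ^ CARD('n)) ^ m * V (s N) (r N z)) powr p)"
            by (rule epowr_ennreal) (use V_nonneg[OF s] p_pos in auto)
          also have "\<dots> = ennreal ?k * ennreal (V (s N) (r N z) powr p)"
            unfolding powr_mult by (rule ennreal_mult) auto
          also have "ennreal (V (s N) (r N z) powr p) \<le> G N x"
          proof -
            have "ennreal (V (s N) (r N z) powr p) = ennreal (V (s N) (r N z) powr p) * indicator (lattice_point (s N) -` {z}) x"
              by (simp add: z_def)
            also have "\<dots> \<le> G N x" unfolding G_def using B by (intro member_le_sum zB) auto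
            finally show ?thesis .
          qed
          finally have "(\<Prod>j=1..m. average R (\<lambda>x. ennreal \<bar>f j x\<bar>)) epowr p \<le> ennreal ?k * G N x"
            by (simp add: mult_left_mono)
          then show ?case by (rule mult_right_mono) simp
        qed
      qed
    qed
    finally show ?thesis .
  qed
  have "(\<integral>\<^sup>+x. strong_maximal m f x epowr p * \<nu> x \<partial>lebesgue)
      \<le> (\<integral>\<^sup>+x. liminf (\<lambda>N. ennreal ?k * G N x * \<nu> x) \<partial>lebesgue)"
    by (rule nn_integral_mono) (rule pw)
  also have "\<dots> \<le> liminf (\<lambda>N. \<integral>\<^sup>+x. ennreal ?k * G N x * \<nu> x \<partial>lebesgue)"
    using Gm by (intro nn_integral_liminf) auto
  also have "\<dots> \<le> ennreal ?k * (ennreal C * ?L epowr p)"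
  proof (rule Liminf_le)
    show "\<forall>\<^sub>F N in sequentially. (\<integral>\<^sup>+x. ennreal ?k * G N x * \<nu> x \<partial>lebesgue) \<le> ennreal ?k * (ennreal C * ?L epowr p)"
    proof (rule always_eventually, rule allI)
      fix N
      have "(\<integral>\<^sup>+x. ennreal ?k * G N x * \<nu> x \<partial>lebesgue) = ennreal ?k * (\<integral>\<^sup>+x. G N x * \<nu> x \<partial>lebesgue)"
        using Gm[of N] by (simp add: mult.assoc nn_integral_cmult)
      also have "\<dots> \<le> ennreal ?k * (ennreal C * ?L epowr p)" by (intro mult_left_mono Gint) simp
      finally show "(\<integral>\<^sup>+x. ennreal ?k * G N x * \<nu> x \<partial>lebesgue) \<le> ennreal ?k * (ennreal C * ?L epowr p)" .
    qed
  qed simp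
  also have "\<dots> = ennreal (?k * C) * ?L epowr p"
    using C by (simp add: ennreal_mult mult.assoc)
  finally have "Lnorm p (product_weight m p P w) (strong_maximal m f) \<le> (ennreal (?k * C) * ?L epowr p) epowr (1 / p)"
    unfolding Lnorm_def using p_pos by (intro epowr_mono) auto
  also have "\<dots> = ennreal ((?k * C) powr (1 / p)) * ?L"
    using p_pos C by (simp add: epowr_mult epowr_epowr epowr_ennreal)
  finally show ?thesis .
qed

end

lemma strong_maximal_bounded: "strong_maximal_bounded m P w p (product_weight m p P w)"
proof -
  have "\<exists>C\<ge>0. \<forall>(B :: ('n \<Rightarrow> int) set) \<nu> \<sigma> f h r.
    discrete_multiple_weight m p K P B \<nu> \<sigma> \<longrightarrow>
    (\<forall>j\<in>{1..m}. \<forall>x. 0 \<le> f j x \<and> 0 \<le> h j x \<and> f j x \<le> h j x * \<sigma> j x powr (1 - 1 / P j)) \<longrightarrow>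
    (\<forall>x\<in>B. r x \<in> subboxes UNIV B \<and> x \<in> r x) \<longrightarrow>
    (\<Sum>x\<in>B. \<nu> x * (\<Prod>j=1..m. box_average (f j) (r x)) powr p)
      \<le> C * (\<Prod>j=1..m. (\<Sum>x\<in>B. h j x powr P j) powr (p / P j))"
    by (rule discrete_strong_maximal_bound) (rule P)
  then obtain C where C: "0 \<le> C" and disc: "\<forall>(B :: ('n \<Rightarrow> int) set) \<nu> \<sigma> f h r.
    discrete_multiple_weight m p K P B \<nu> \<sigma> \<longrightarrow>
    (\<forall>j\<in>{1..m}. \<forall>x. 0 \<le> f j x \<and> 0 \<le> h j x \<and> f j x \<le> h j x * \<sigma> j x powr (1 - 1 / P j)) \<longrightarrow>
    (\<forall>x\<in>B. r x \<in> subboxes UNIV B \<and> x \<in> r x) \<longrightarrow>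
    (\<Sum>x\<in>B. \<nu> x * (\<Prod>j=1..m. box_average (f j) (r x)) powr p)
      \<le> C * (\<Prod>j=1..m. (\<Sum>x\<in>B. h j x powr P j) powr (p / P j))"
    by (elim exE conjE)
  show ?thesis unfolding strong_maximal_bounded_def
  proof (intro exI conjI allI impI)
    \<comment> \<open>The factor for the \<open>m\<close> means in the power \<open>p\<close>, times
      the discrete constant, followed by the p-th root of \<open>Lnorm\<close>.\<close>
    show "0 \<le> (((2 ^ CARD('n)) ^ m) powr p * C) powr (1 / p)" by simp
    fix f assume f: "\<forall>i\<in>{1..m}. locally_integrable (f i) \<and> in_Lspace (P i) (w i) (f i)"
    show "Lnorm p (product_weight m p P w) (strong_maximal m f)
      \<le> ennreal ((((2 ^ CARD('n)) ^ m) powr p * C) powr (1 / p)) * (\<Prod>i=1..m. Lnorm (P i) (w i) (\<lambda>x. ennreal \<bar>f i x\<bar>))"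
    proof (rule strong_maximal_norm_le[OF _ _ C])
      show "locally_integrable (f j)" "in_Lspace (P j) (w j) (f j)" if "j \<in> {1..m}" for j using f that by auto
      fix s :: real and B and r :: "('n \<Rightarrow> int) \<Rightarrow> ('n \<Rightarrow> int) set"
      assume s: "0 < s" and B: "finite B" and r: "\<And>z. z \<in> B \<Longrightarrow> r z \<in> subboxes UNIV B \<and> z \<in> r z"
      let ?H = "\<lambda>j x. ennreal \<bar>f j x\<bar> epowr P j * ennreal (w j x)"
      let ?f = "\<lambda>j. cell_mean s (\<lambda>x. ennreal \<bar>f j x\<bar>)" and ?h = "\<lambda>j z. cell_mean s (?H j) z powr (1 / P j)"
      have "?f j z \<le> ?h j z * cell_mean s (\<sigma> j) z powr (1 - 1 / P j)" if "j \<in> {1..m}" for j z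
        using cell_hoelder[of f, OF _ _ s that] f by blast
      then have "(\<Sum>z\<in>B. cell_mean s \<nu> z * (\<Prod>j=1..m. box_average (?f j) (r z)) powr p)
        \<le> C * (\<Prod>j=1..m. (\<Sum>z\<in>B. ?h j z powr P j) powr (p / P j))"
        using r cell_mean_nonneg[OF s]
        by (intro disc[rule_format, OF discrete_weight[OF s B]]) auto
      also have "(\<Prod>j=1..m. (\<Sum>z\<in>B. ?h j z powr P j) powr (p / P j)) = (\<Prod>j=1..m. (\<Sum>z\<in>B. cell_mean s (?H j) z) powr (p / P j))"
      proof (intro prod.cong refl arg_cong[where f = "\<lambda>x. x powr _"] sum.cong)
        fix j z assume "j \<in> {1..m}"
        then show "?h j z powr P j = cell_mean s (?H j) z"
          using P[of j] cell_mean_nonneg[OF s, of "?H j" z] by (simp add: powr_powr)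
      qed
      finally show "(\<Sum>z\<in>B. cell_mean s \<nu> z * (\<Prod>j=1..m. box_average (?f j) (r z)) powr p)
        \<le> C * (\<Prod>j=1..m. (\<Sum>z\<in>B. cell_mean s (?H j) z) powr (p / P j))" .
    qed
  qed
qed

end

text \<open>If \<open>\<nu>\<close> does not vanish almost everywhere, every rectangle lies in one of positive \<open>\<nu>\<close>-measure,
  so that the condition makes the weights \<open>w j powr (1 - P j')\<close> locally integrable.\<close>

lemma multiple_A_imp_strong_maximal_bounded:
  fixes w :: "nat \<Rightarrow> real ^ 'n \<Rightarrow> real"
  assumes m: "1 \<le> m"
    and P: "\<And>j. j \<in> {1..m} \<Longrightarrow> 1 < P j"
    and p: "1 / p = (\<Sum>j=1..m. 1 / P j)"
    and w: "\<And>j. j \<in> {1..m} \<Longrightarrow> weight (w j)"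
    and A: "multiple_A m p P w"
  shows "strong_maximal_bounded m P w p (product_weight m p P w)"
proof -
  let ?\<nu> = "\<lambda>x. ennreal (product_weight m p P w x)"
  let ?\<sigma> = "\<lambda>j x. ennreal (w j x) epowr (1 - conj_exponent (P j))"
  let ?A = "\<lambda>R. average R ?\<nu> * (\<Prod>j=1..m. average R (?\<sigma> j) epowr (p / conj_exponent (P j)))"
  have \<nu>m [measurable]: "?\<nu> \<in> borel_measurable lebesgue" using product_weight_measurable[OF w] by simp
  have p_pos: "0 < p" using harmonic_exponent(1)[where m = m and P = P and p = p] m P p by blast
  show ?thesis
  proof (cases "AE x in lebesgue. ?\<nu> x = 0")
    case True
    \<comment> \<open>Here the A_P condition says nothing about the dual weights, but the norm on
      the left is 0 for every \<open>f\<close>.\<close>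
    have "Lnorm p (product_weight m p P w) (strong_maximal m f) = 0" for f
    proof -
      have "(\<integral>\<^sup>+x. strong_maximal m f x epowr p * ?\<nu> x \<partial>lebesgue) = (\<integral>\<^sup>+x. 0 \<partial>(lebesgue :: (real ^ 'n) measure))"
        using True by (intro nn_integral_cong_AE) (auto elim!: eventually_mono)
      then show ?thesis unfolding Lnorm_def using p_pos by simp
    qed
    then show ?thesis unfolding strong_maximal_bounded_def by (intro exI[of _ 0]) auto
  next
    case False
    define K where "K = enn2real (SUP R\<in>open_rectangles. ?A R)"
    have AK: "?A R \<le> ennreal K" if "R \<in> open_rectangles" for R
    proof -
      have "ennreal K = (SUP R\<in>open_rectangles. ?A R)" using A unfolding K_def multiple_A_def by simp
      then show ?thesis using that by (auto intro: SUP_upper)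
    qed
    have Q: "(centered_cube k :: (real ^ 'n) set) \<in> open_rectangles" for k
      by (rule centered_cube_open_rectangle)
    note [measurable] = emeasure_open_rectangle(3)[OF Q]
    have "\<exists>k. (\<integral>\<^sup>+x\<in>centered_cube k. ?\<nu> x \<partial>lebesgue) \<noteq> 0"
    proof (rule ccontr)
      assume "\<not> ?thesis"
      then have "\<forall>k. AE x in lebesgue. ?\<nu> x * indicator (centered_cube k) x = 0"
        by (auto simp: nn_integral_0_iff_AE)
      then have "AE x in lebesgue. \<forall>k. ?\<nu> x * indicator (centered_cube k) x = 0" unfolding AE_all_countable .
      then have "AE x in lebesgue. ?\<nu> x = 0"
      proof eventually_elim
        case (elim x)
        obtain k where "x \<in> centered_cube k" by (rule centered_cube_cover)
        then show ?case using elim by (metis indicator_simps(1) mult.right_neutral)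
      qed
      then show False using False by blast
    qed
    then obtain k0 where k0: "(\<integral>\<^sup>+x\<in>centered_cube k0. ?\<nu> x \<partial>lebesgue) \<noteq> 0" by blast
    have fin: "(\<integral>\<^sup>+x\<in>R. ?\<sigma> j x \<partial>lebesgue) \<noteq> top" if R: "R \<in> open_rectangles" and j: "j \<in> {1..m}" for R j
    proof -
      obtain b where b: "\<And>x. x \<in> R \<Longrightarrow> norm x \<le> b" using emeasure_open_rectangle(5)[OF R] by (auto simp: bounded_iff)
      obtain k1 where k1: "b < real k1" using reals_Archimedean2 by blast
      \<comment> \<open>Large enough for the cube to contain both \<open>R\<close> and the cube of
        positive mass found above.\<close>
      define k where "k = max k0 k1"
      have RQ: "R \<subseteq> centered_cube k" using b k1 by (force simp: k_def intro!: centered_cubeI)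
      have "centered_cube k0 \<subseteq> (centered_cube k :: (real ^ 'n) set)" by (rule centered_cube_mono) (simp add: k_def)
      then have "(\<integral>\<^sup>+x\<in>centered_cube k0. ?\<nu> x \<partial>lebesgue) \<le> (\<integral>\<^sup>+x\<in>centered_cube k. ?\<nu> x \<partial>lebesgue)"
        by (intro nn_integral_mono mult_left_mono) (auto simp: indicator_def)
      then have \<nu>Q: "(\<integral>\<^sup>+x\<in>centered_cube k. ?\<nu> x \<partial>lebesgue) \<noteq> 0" using k0 by auto
      note Qf = emeasure_open_rectangle[OF Q, of k]
      have a\<nu>: "average (centered_cube k) ?\<nu> \<noteq> 0"
        using \<nu>Q unfolding nn_integral_eq_average[OF Qf(1,2)] by auto
      have a\<sigma>: "average (centered_cube k) (?\<sigma> i) \<noteq> 0" if "i \<in> {1..m}" for i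
        using that by (intro average_dual_weight_nonzero Q w P)
      have e_pos: "0 < p / conj_exponent (P i)" if "i \<in> {1..m}" for i
        using p_pos conj_exponent_gt_0[OF P[OF that]] by simp
      \<comment> \<open>The nonzero mean of the product weight rules out 0 * \<infinity>, so the
        product of the dual factors is finite; none of these is 0, so each of them is
        finite.\<close>
      have "?A (centered_cube k) \<noteq> top" using AK[OF Q, of k] by (auto simp: top_unique)
      then have "(\<Prod>i=1..m. average (centered_cube k) (?\<sigma> i) epowr (p / conj_exponent (P i))) \<noteq> top"
        using a\<nu> by (auto simp: ennreal_mult_eq_top_iff)
      then have "average (centered_cube k) (?\<sigma> j) epowr (p / conj_exponent (P j)) \<noteq> top"
        using j a\<sigma> e_pos by (auto simp: ennreal_prod_eq_top epowr_eq_0_iff)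
      then have "average (centered_cube k) (?\<sigma> j) \<noteq> top" using e_pos[OF j] by (auto simp: epowr_eq_top_iff)
      then have "(\<integral>\<^sup>+x\<in>centered_cube k. ?\<sigma> j x \<partial>lebesgue) \<noteq> top"
        unfolding nn_integral_eq_average[OF Qf(1,2)] using Qf(2) by (auto simp: ennreal_mult_eq_top_iff)
      moreover have "(\<integral>\<^sup>+x\<in>R. ?\<sigma> j x \<partial>lebesgue) \<le> (\<integral>\<^sup>+x\<in>centered_cube k. ?\<sigma> j x \<partial>lebesgue)"
        using RQ by (intro nn_integral_mono mult_left_mono) (auto simp: indicator_def)
      ultimately show ?thesis by (auto simp: top_unique)
    qed
    interpret locally_finite_multiple_weight m p K P w
      by unfold_locales (use m P p w AK fin in \<open>auto simp: K_def\<close>)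
    show ?thesis by (rule strong_maximal_bounded)
  qed
qed

theorem theorem2p5:
  fixes m :: nat and p :: real and P :: "nat \<Rightarrow> real"
    and w :: "nat \<Rightarrow> real ^ 'n \<Rightarrow> real"
  assumes "1 \<le> m"
    and "\<And>j. j \<in> {1..m} \<Longrightarrow> 1 < P j"
    and "1 / p = (\<Sum>j=1..m. 1 / P j)"
    and "\<And>j. j \<in> {1..m} \<Longrightarrow> weight (w j)"
  shows "strong_maximal_bounded m P w p (product_weight m p P w) \<longleftrightarrow> multiple_A m p P w"
proof
  assume "strong_maximal_bounded m P w p (product_weight m p P w)"
  then show "multiple_A m p P w"
    by (intro strong_maximal_bounded_imp_multiple_A) (use assms in auto)
next
  assume "multiple_A m p P w"
  then show "strong_maximal_bounded m P w p (product_weight m p P w)"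
    by (intro multiple_A_imp_strong_maximal_bounded) (use assms in auto)
qed

end
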